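(* There exists an absolute constant $C\ge 1$ such that the following holds. Let $\delta>0$, let $N$ be a positive integer, and let $f,g,h:\mathbb{Z}\to\mathbb{C}$ be functions with $|f|,|g|,|h|\le 1$ everywhere and with support contained in $\{1,\dots,N\}$. Suppose that $$\Bigl|\sum_{x\in\mathbb{Z}}\sum_{y\in\mathbb{N}} f(x)\,g(x+y)\,h(x+y^2)\Bigr|\ge \delta N^{3/2},$$ where $\mathbb{N}=\{1,2,3,\dots\}$. Then either $N\le C\delta^{-C}$, or there exist a real number $\alpha$ and a positive integer $q\le C\delta^{-C}$ such that $\|q\alpha\|\le C\delta^{-C}/N$ and $$\Bigl|\sum_{x\in\mathbb{Z}} h(x)e(\alpha x)\Bigr|\ge C^{-1}\delta^{C} N.$$
   Context: Here $\|\beta\|$ denotes the distance from the real number $\beta$ to the nearest integer, and $e(\beta):=e^{2\pi i\beta}$. *)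

theory Defs
  imports "HOL-Analysis.Analysis"
begin

(* round returns a nearest integer; the choice it makes at half-integers does not matter here *)
definition nearest_int_dist :: "real \<Rightarrow> real" where
  "nearest_int_dist \<beta> = \<bar>\<beta> - of_int (round \<beta>)\<bar>"

definition e :: "real \<Rightarrow> complex" where
  "e \<beta> = exp (2 * complex_of_real pi * \<i> * complex_of_real \<beta>)"

end

theory Submission
  imports Defs
begin

text \<open>
  Everything takes place on \<open>\<int> / P\<close> with \<open>P = 32 N\<close>, where functions are periodic functions on
  \<open>\<int>\<close>. Cauchy--Schwarz (PET induction) bounds the configuration \<open>x, x + y, x + y\<^sup>2\<close> by an average of
  box norms of \<open>h\<close> whose directions are integer combinations such as \<open>2 a k - 2 a' k'\<close>. For
  coprime-ish \<open>a, a'\<close> these cover \<open>\<int> / P\<close> evenly, so \<open>h\<close> has a large Gowers norm of order 6.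
  Applied with \<open>h\<close> replaced by its dual function, this allows degree lowering in the manner of
  Peluse and Prendiville: the dual function has large norm of order 2, hence correlates with a
  character, and Weyl's inequality places that character on a major arc. Consequently \<open>g\<close> has
  large averages over progressions of length about \<open>\<surd>N\<close> and small step \<open>q\<close>.
  Applied once more with \<open>g\<close> replaced by its dual function, duality turns this into a new \<open>g\<close> that
  is nearly constant along such progressions. Then \<open>h\<close> itself has large averages over
  the squares \<open>(y + q i)\<^sup>2\<close>, and Fourier analysis with Weyl's inequality yields the claim.
\<close>

section \<open>Averages and Cauchy--Schwarz\<close>

text \<open>No inverse theorem for norms of order 6 is invoked. Degree lowering replaces it, and
  works only for functions that are averages over \<open>y\<close>: such an average can be moved
  outside all differences, where the frequencies that occur are tested against the configuration
  itself and Weyl's inequality applies. Hence the passage to dual functions, at the cost of squaring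
  \<open>\<delta>\<close>. Degree lowering also does Fourier analysis in the directions, so these
  must first run over all of \<int> / P; the counting of pairs with small gcd serves this purpose.
  The first pass informs only about the pair \<open>f\<close>, \<open>g\<close>, since a character
  takes the place of \<open>h\<close>. The second pass keeps \<open>h\<close>: a locally constant
  \<open>g\<close> does not notice small shifts of \<open>y\<close>, so that these act on
  \<open>h\<close> alone. Each step loses a power of \<open>\<delta>\<close> and needs
  \<open>M\<close>, about the square root of \<open>N\<close>, to exceed a power of
  \<open>1 / \<delta>\<close>; where this fails, \<open>N\<close> is small. The factor 32 in
  \<open>P\<close> prevents wrap-around, both of the configuration and of the values
  \<open>2 c k - 2 a k'\<close>.\<close>

definition avg :: "'a set \<Rightarrow> ('a \<Rightarrow> 'b::real_normed_field) \<Rightarrow> 'b" where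
  "avg A f = sum f A / of_nat (card A)"

lemma avg_cong: "A = B \<Longrightarrow> (\<And>x. x \<in> B \<Longrightarrow> f x = g x) \<Longrightarrow> avg A f = avg B g"
  unfolding avg_def by (simp cong: sum.cong)

lemma avg_mult_left: "avg A (\<lambda>x. c * f x) = c * avg A f"
  unfolding avg_def by (simp add: sum_distrib_left)

lemma avg_mult_right: "avg A (\<lambda>x. f x * c) = avg A f * c"
  unfolding avg_def by (simp add: sum_distrib_right)

lemma avg_add: "avg A (\<lambda>x. f x + g x) = avg A f + avg A g"
  unfolding avg_def by (simp add: sum.distrib add_divide_distrib)

lemma avg_diff: "avg A (\<lambda>x. f x - g x) = avg A f - avg A g"
  unfolding avg_def by (simp add: sum_subtractf diff_divide_distrib)

lemma avg_swap: "avg A (\<lambda>x. avg B (\<lambda>y. f x y)) = avg B (\<lambda>y. avg A (\<lambda>x. f x y))"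
  unfolding avg_def
  by (simp add: sum_divide_distrib[symmetric] sum.swap[of _ B A] field_simps)

lemma avg_const: "finite A \<Longrightarrow> A \<noteq> {} \<Longrightarrow> avg A (\<lambda>_. c) = c"
  unfolding avg_def by simp

lemma avg_cnj: "avg A (\<lambda>x. cnj (f x)) = cnj (avg A f)"
  unfolding avg_def by simp

lemma avg_of_real: "avg A (\<lambda>x. complex_of_real (f x)) = complex_of_real (avg A f)"
  unfolding avg_def by simp

lemma avg_mono:
  fixes f g :: "'a \<Rightarrow> real"
  shows "(\<And>x. x \<in> A \<Longrightarrow> f x \<le> g x) \<Longrightarrow> avg A f \<le> avg A g"
  unfolding avg_def by (intro divide_right_mono sum_mono) auto

lemma avg_nonneg:
  fixes f :: "'a \<Rightarrow> real"
  shows "(\<And>x. x \<in> A \<Longrightarrow> 0 \<le> f x) \<Longrightarrow> 0 \<le> avg A f"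
  unfolding avg_def by (intro divide_nonneg_nonneg sum_nonneg) auto

text \<open>An empty or infinite set has average 0, because dividing by the cardinality 0 yields 0;
  \<open>0 \<le> c\<close> covers that case.\<close>

lemma avg_le:
  fixes f :: "'a \<Rightarrow> real"
  assumes "\<And>x. x \<in> A \<Longrightarrow> f x \<le> c" "0 \<le> c"
  shows "avg A f \<le> c"
proof (cases "finite A \<and> A \<noteq> {}")
  case True
  have "avg A f \<le> avg A (\<lambda>_. c)" by (rule avg_mono) (use assms in auto)
  then show ?thesis using True by (simp add: avg_const)
qed (use assms in \<open>auto simp: avg_def\<close>)

lemma norm_avg_le: "norm (avg A f) \<le> avg A (\<lambda>x. norm (f x))"
  unfolding avg_def by (simp add: norm_divide divide_right_mono norm_sum)

lemma norm_avg_le_bound: "(\<And>x. x \<in> A \<Longrightarrow> norm (f x) \<le> c) \<Longrightarrow> 0 \<le> c \<Longrightarrow> norm (avg A f) \<le> c"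
  by (rule order_trans[OF norm_avg_le]) (rule avg_le)

lemma avg_power2_le:
  fixes f :: "'a \<Rightarrow> real"
  shows "(avg A f)\<^sup>2 \<le> avg A (\<lambda>x. (f x)\<^sup>2)"
proof (cases "finite A \<and> A \<noteq> {}")
  case True
  have "(sum f A)\<^sup>2 \<le> card A * (\<Sum>x\<in>A. (f x)\<^sup>2)"
    using sum_squared_le_sum_of_squares[of f A] True by (simp add: mult.commute)
  moreover have "real (card A) > 0" using True by (simp add: card_gt_0_iff)
  ultimately show ?thesis unfolding avg_def
    by (simp add: power_divide divide_simps power2_eq_square mult.commute mult.left_commute)
qed (auto simp: avg_def)

text \<open>Jensen's inequality for powers of two, by iterating the case of squares.\<close>

lemma avg_power_le:
  fixes f :: "'a \<Rightarrow> real"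
  assumes "\<And>x. x \<in> A \<Longrightarrow> 0 \<le> f x"
  shows "(avg A f) ^ (2 ^ n) \<le> avg A (\<lambda>x. f x ^ (2 ^ n))"
proof (induction n)
  case (Suc n)
  have "(avg A f) ^ (2 ^ Suc n) = ((avg A f) ^ (2 ^ n))\<^sup>2"
    by (simp add: power_mult[symmetric] mult.commute)
  also have "\<dots> \<le> (avg A (\<lambda>x. f x ^ (2 ^ n)))\<^sup>2"
    by (rule power_mono[OF Suc.IH]) (simp add: avg_nonneg assms)
  also have "\<dots> \<le> avg A (\<lambda>x. (f x ^ (2 ^ n))\<^sup>2)" by (rule avg_power2_le)
  also have "\<dots> = avg A (\<lambda>x. f x ^ (2 ^ Suc n))"
    by (simp add: power_mult[symmetric] mult.commute)
  finally show ?case .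
qed simp

lemma avg_exists_ge:
  fixes f :: "'a \<Rightarrow> real"
  assumes "finite A" "A \<noteq> {}"
  shows "\<exists>x\<in>A. avg A f \<le> f x"
proof (rule ccontr)
  assume "\<not> ?thesis"
  then have *: "\<And>x. x \<in> A \<Longrightarrow> f x < avg A f" by auto
  have "sum f A < sum (\<lambda>_. avg A f) A" by (rule sum_strict_mono) (use assms * in auto)
  then show False using assms by (simp add: avg_def)
qed

lemma avg_Times: "avg (A \<times> B) f = avg A (\<lambda>x. avg B (\<lambda>y. f (x, y)))"
  unfolding avg_def
  by (simp add: sum.cartesian_product[symmetric] card_cartesian_product sum_divide_distrib[symmetric]
      sum.cartesian_product field_simps)

lemma avg_reindex: "inj_on g A \<Longrightarrow> avg (g ` A) f = avg A (\<lambda>x. f (g x))"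
  unfolding avg_def by (simp add: sum.reindex card_image o_def)

section \<open>Doubling variables by Cauchy--Schwarz\<close>

lemma avg_norm_power2:
  "complex_of_real ((norm (avg A f))\<^sup>2) = avg A (\<lambda>x. avg A (\<lambda>y. f x * cnj (f y)))"
proof -
  have "complex_of_real ((norm (avg A f))\<^sup>2) = avg A f * cnj (avg A f)"
    by (simp only: complex_norm_square[symmetric] of_real_power)
  also have "\<dots> = avg A (\<lambda>x. avg A (\<lambda>y. f x * cnj (f y)))"
    by (simp add: avg_mult_left avg_mult_right avg_cnj)
  finally show ?thesis .
qed

lemma avg_norm_power2_swap:
  "complex_of_real (avg X (\<lambda>x. (norm (avg Y (F x)))\<^sup>2))
    = avg Y (\<lambda>y. avg Y (\<lambda>y'. avg X (\<lambda>x. F x y * cnj (F x y'))))"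
proof -
  have "complex_of_real (avg X (\<lambda>x. (norm (avg Y (F x)))\<^sup>2))
      = avg X (\<lambda>x. avg Y (\<lambda>y. avg Y (\<lambda>y'. F x y * cnj (F x y'))))"
    by (simp only: avg_of_real[symmetric] avg_norm_power2)
  also have "\<dots> = avg Y (\<lambda>y. avg X (\<lambda>x. avg Y (\<lambda>y'. F x y * cnj (F x y'))))"
    by (rule avg_swap)
  also have "\<dots> = avg Y (\<lambda>y. avg Y (\<lambda>y'. avg X (\<lambda>x. F x y * cnj (F x y'))))"
    by (rule avg_cong[OF refl]) (rule avg_swap)
  finally show ?thesis .
qed

lemma norm_avg_power2_le: "(norm (avg A f))\<^sup>2 \<le> avg A (\<lambda>x. (norm (f x))\<^sup>2)"
proof -
  have "(norm (avg A f))\<^sup>2 \<le> (avg A (\<lambda>x. norm (f x)))\<^sup>2"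
    by (rule power_mono[OF norm_avg_le]) simp
  also have "\<dots> \<le> avg A (\<lambda>x. (norm (f x))\<^sup>2)" by (rule avg_power2_le)
  finally show ?thesis .
qed

lemma cs_kill:
  fixes b c :: "'a \<Rightarrow> complex"
  assumes "\<And>x. x \<in> X \<Longrightarrow> norm (b x) \<le> 1"
  shows "(norm (avg X (\<lambda>x. b x * c x)))\<^sup>2 \<le> avg X (\<lambda>x. (norm (c x))\<^sup>2)"
proof -
  have "(norm (avg X (\<lambda>x. b x * c x)))\<^sup>2 \<le> avg X (\<lambda>x. (norm (b x * c x))\<^sup>2)"
    by (rule norm_avg_power2_le)
  also have "\<dots> \<le> avg X (\<lambda>x. (norm (c x))\<^sup>2)"
    by (intro avg_mono power_mono) (auto simp: norm_mult intro!: mult_left_le_one_le assms)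
  finally show ?thesis .
qed

text \<open>The van der Corput move: the bounded factor depending on \<open>x\<close> alone
  disappears and \<open>y\<close> is doubled. The norm stays outside the double average, so that the
  pairs can still be regrouped before absolute values are taken.\<close>

lemma cs_plain:
  fixes b :: "'a \<Rightarrow> complex"
  assumes "\<And>x. x \<in> X \<Longrightarrow> norm (b x) \<le> 1"
  shows "(norm (avg X (\<lambda>x. b x * avg Y (F x))))\<^sup>2
    \<le> norm (avg Y (\<lambda>y. avg Y (\<lambda>y'. avg X (\<lambda>x. F x y * cnj (F x y')))))"
proof -
  have "(norm (avg X (\<lambda>x. b x * avg Y (F x))))\<^sup>2 \<le> avg X (\<lambda>x. (norm (avg Y (F x)))\<^sup>2)"
    by (rule cs_kill) (rule assms)
  also have "\<dots> \<le> norm (complex_of_real (avg X (\<lambda>x. (norm (avg Y (F x)))\<^sup>2)))" by simp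
  also have "\<dots> = norm (avg Y (\<lambda>y. avg Y (\<lambda>y'. avg X (\<lambda>x. F x y * cnj (F x y')))))"
    by (simp only: avg_norm_power2_swap)
  finally show ?thesis .
qed

text \<open>Trades an absolute value for a bounded weight, which can then take part in
  Cauchy--Schwarz. The choice \<open>cnj (sgn z)\<close> vanishes at 0, hence modulus at most 1
  instead of equal to 1.\<close>

lemma phase_function: "\<exists>ph :: complex \<Rightarrow> complex. \<forall>z. norm (ph z) \<le> 1 \<and> of_real (norm z) = ph z * z"
proof -
  have "\<exists>c. norm c \<le> 1 \<and> of_real (norm z) = c * z" for z :: complex
    by (rule exI[of _ "cnj (sgn z)"])
       (auto simp: sgn_eq norm_divide complex_norm_square[symmetric] mult.commute[of "cnj _"] power2_eq_square)
  then show ?thesis by metis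
qed

text \<open>Variant with absolute values inside the average over \<open>y\<close>. They become
  phases \<open>c y\<close>; as these do not depend on \<open>x\<close>, they factor out of the
  inner average again, with modulus at most 1.\<close>

lemma cs_phase:
  fixes b :: "'a \<Rightarrow> complex"
  assumes "\<And>x. x \<in> X \<Longrightarrow> norm (b x) \<le> 1"
  shows "(avg Y (\<lambda>y. norm (avg X (\<lambda>x. b x * F x y))))\<^sup>2
    \<le> avg Y (\<lambda>y. avg Y (\<lambda>y'. norm (avg X (\<lambda>x. F x y * cnj (F x y')))))"
proof -
  obtain s :: "complex \<Rightarrow> complex" where s: "\<And>z. norm (s z) \<le> 1" "\<And>z. of_real (norm z) = s z * z"
    using phase_function by blast
  define c where "c = (\<lambda>y. s (avg X (\<lambda>x. b x * F x y)))"
  have eq: "complex_of_real (avg Y (\<lambda>y. norm (avg X (\<lambda>x. b x * F x y))))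
      = avg X (\<lambda>x. b x * avg Y (\<lambda>y. c y * F x y))"
  proof -
    have "complex_of_real (avg Y (\<lambda>y. norm (avg X (\<lambda>x. b x * F x y))))
        = avg Y (\<lambda>y. c y * avg X (\<lambda>x. b x * F x y))"
      by (simp only: avg_of_real[symmetric] c_def s(2)[symmetric])
    also have "\<dots> = avg Y (\<lambda>y. avg X (\<lambda>x. b x * (c y * F x y)))"
      by (simp add: avg_mult_left[symmetric] mult.left_commute)
    also have "\<dots> = avg X (\<lambda>x. avg Y (\<lambda>y. b x * (c y * F x y)))" by (rule avg_swap)
    finally show ?thesis by (simp add: avg_mult_left)
  qed
  have "(avg Y (\<lambda>y. norm (avg X (\<lambda>x. b x * F x y))))\<^sup>2
      = (norm (avg X (\<lambda>x. b x * avg Y (\<lambda>y. c y * F x y))))\<^sup>2"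
    by (simp add: eq[symmetric])
  also have "\<dots> \<le> norm (avg Y (\<lambda>y. avg Y (\<lambda>y'. avg X (\<lambda>x. c y * F x y * cnj (c y' * F x y')))))"
    by (rule cs_plain) (rule assms)
  also have "\<dots> \<le> avg Y (\<lambda>y. norm (avg Y (\<lambda>y'. avg X (\<lambda>x. c y * F x y * cnj (c y' * F x y')))))"
    by (rule norm_avg_le)
  also have "\<dots> \<le> avg Y (\<lambda>y. avg Y (\<lambda>y'. norm (avg X (\<lambda>x. c y * F x y * cnj (c y' * F x y')))))"
    by (intro avg_mono norm_avg_le)
  also have "\<dots> \<le> avg Y (\<lambda>y. avg Y (\<lambda>y'. norm (avg X (\<lambda>x. F x y * cnj (F x y')))))"
  proof (intro avg_mono)
    fix y y'
    have "avg X (\<lambda>x. c y * F x y * cnj (c y' * F x y')) = (c y * cnj (c y')) * avg X (\<lambda>x. F x y * cnj (F x y'))"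
      by (simp add: avg_mult_left[symmetric] mult_ac)
    moreover have "norm (c y * cnj (c y')) \<le> 1"
      unfolding norm_mult complex_mod_cnj c_def by (intro mult_le_one s) auto
    ultimately show "norm (avg X (\<lambda>x. c y * F x y * cnj (c y' * F x y'))) \<le> norm (avg X (\<lambda>x. F x y * cnj (F x y')))"
      by (simp add: norm_mult mult_left_le_one_le)
  qed
  finally show ?thesis .
qed

text \<open>Substitute \<open>y' = y + a\<close>. The condition \<open>y + a \<in> B\<close> is the
  source of the range weights carried along later.\<close>

lemma sum_pairs_by_difference:
  fixes B K :: "'g::ab_group_add set" and H :: "'g \<Rightarrow> 'g \<Rightarrow> 'b::comm_monoid_add"
  assumes "finite B" "finite K" "\<And>y y'. y \<in> B \<Longrightarrow> y' \<in> B \<Longrightarrow> y' - y \<in> K"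
  shows "(\<Sum>y\<in>B. \<Sum>y'\<in>B. H y y') = (\<Sum>a\<in>K. \<Sum>y\<in>B. if y + a \<in> B then H y (y + a) else 0)"
proof -
  have "(\<Sum>y'\<in>B. H y y') = (\<Sum>a\<in>K. if y + a \<in> B then H y (y + a) else 0)" if "y \<in> B" for y
  proof -
    have "(\<Sum>a\<in>K. if y + a \<in> B then H y (y + a) else 0) = (\<Sum>a\<in>{a\<in>K. y + a \<in> B}. H y (y + a))"
      using assms by (simp add: sum.inter_filter)
    also have "\<dots> = (\<Sum>y'\<in>B. H y y')"
      by (rule sum.reindex_bij_witness[of _ "\<lambda>y'. y' - y" "\<lambda>a. y + a"]) (use assms that in auto)
    finally show ?thesis by simp
  qed
  then have "(\<Sum>y\<in>B. \<Sum>y'\<in>B. H y y') = (\<Sum>y\<in>B. \<Sum>a\<in>K. if y + a \<in> B then H y (y + a) else 0)"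
    by (rule sum.cong[OF refl])
  also have "\<dots> = (\<Sum>a\<in>K. \<Sum>y\<in>B. if y + a \<in> B then H y (y + a) else 0)" by (rule sum.swap)
  finally show ?thesis .
qed

lemma avg_pairs_by_difference:
  fixes B K :: "'g::ab_group_add set"
  assumes "finite B" "finite K" "\<And>y y'. y \<in> B \<Longrightarrow> y' \<in> B \<Longrightarrow> y' - y \<in> K"
  shows "avg B (\<lambda>y. avg B (\<lambda>y'. H y y'))
    = (of_nat (card K) / of_nat (card B)) * avg K (\<lambda>a. avg B (\<lambda>y. if y + a \<in> B then H y (y + a) else 0))"
proof (cases "B = {}")
  case False
  then have "K \<noteq> {}" using assms(3) by auto
  then have K: "card K \<noteq> 0" using assms by simp
  have "avg B (\<lambda>y. avg B (\<lambda>y'. H y y')) = (\<Sum>y\<in>B. \<Sum>y'\<in>B. H y y') / (of_nat (card B) * of_nat (card B))"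
    by (simp add: avg_def sum_divide_distrib[symmetric])
  also have "\<dots> = (\<Sum>a\<in>K. \<Sum>y\<in>B. if y + a \<in> B then H y (y + a) else 0) / (of_nat (card B) * of_nat (card B))"
    by (simp only: sum_pairs_by_difference[OF assms])
  also have "\<dots> = (of_nat (card K) / of_nat (card B)) * avg K (\<lambda>a. avg B (\<lambda>y. if y + a \<in> B then H y (y + a) else 0))"
    using K by (simp add: avg_def sum_divide_distrib[symmetric])
  finally show ?thesis .
qed (simp add: avg_def)

text \<open>\<open>c\<close> bounds the number of differences per point of \<open>B\<close>: 2 for
  an interval, 4 for a square of intervals.\<close>

lemma norm_avg_pairs_by_difference_le:
  fixes B K :: "'g::ab_group_add set" and H :: "'g \<Rightarrow> 'g \<Rightarrow> complex"
  assumes "finite B" "finite K" "\<And>y y'. y \<in> B \<Longrightarrow> y' \<in> B \<Longrightarrow> y' - y \<in> K"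
    and "real (card K) \<le> c * real (card B)"
  shows "norm (avg B (\<lambda>y. avg B (\<lambda>y'. H y y')))
    \<le> c * norm (avg K (\<lambda>a. avg B (\<lambda>y. if y + a \<in> B then H y (y + a) else 0)))"
proof (cases "B = {}")
  case False
  then have "real (card K) / real (card B) \<le> c"
    using assms by (simp add: divide_simps card_gt_0_iff)
  then have "real (card K) / real (card B) * norm (avg K (\<lambda>a. avg B (\<lambda>y. if y + a \<in> B then H y (y + a) else 0)))
      \<le> c * norm (avg K (\<lambda>a. avg B (\<lambda>y. if y + a \<in> B then H y (y + a) else 0)))"
    by (rule mult_right_mono) simp
  then show ?thesis
    by (subst avg_pairs_by_difference[OF assms(1-3)]) (simp_all only: norm_mult norm_divide norm_of_nat)
qed (simp add: avg_def)

section \<open>Averages over tuples of fixed length\<close>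

definition tup :: "'a set \<Rightarrow> nat \<Rightarrow> 'a list set" where
  "tup A k = {xs. set xs \<subseteq> A \<and> length xs = k}"

lemma tup_0 [simp]: "tup A 0 = {[]}"
  by (auto simp: tup_def)

lemma finite_tup [simp]: "finite A \<Longrightarrow> finite (tup A k)"
  by (simp add: tup_def finite_lists_length_eq)

lemma tup_nonempty [simp]: "A \<noteq> {} \<Longrightarrow> tup A k \<noteq> {}"
proof -
  assume "A \<noteq> {}"
  then obtain a where "a \<in> A" by auto
  then have "replicate k a \<in> tup A k" by (auto simp: tup_def)
  then show ?thesis by auto
qed

lemma avg_singleton [simp]: "avg {a} G = G a"
  by (simp add: avg_def)

lemma tup_Suc: "tup A (Suc k) = (\<lambda>(t, ts). t # ts) ` (A \<times> tup A k)"
  by (auto simp: tup_def image_iff length_Suc_conv)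

lemma avg_tup_Suc: "avg (tup A (Suc k)) G = avg A (\<lambda>t. avg (tup A k) (\<lambda>ts. G (t # ts)))"
proof -
  have "inj_on (\<lambda>(t, ts). t # ts) (A \<times> tup A k)" by (auto simp: inj_on_def)
  then show ?thesis unfolding tup_Suc by (simp add: avg_reindex avg_Times)
qed

section \<open>Periodic functions and multiplicative differencing\<close>

text \<open>Functions on \<int> / P stay functions on the integers, so that arguments such as
  \<open>x + y\<^sup>2\<close> need no reduction; averages run over the representatives
  \<open>{0..<P}\<close>.\<close>

definition per :: "int \<Rightarrow> (int \<Rightarrow> 'b) \<Rightarrow> bool" where
  "per P f \<longleftrightarrow> (\<forall>x. f (x + P) = f x)"

lemma per_shift: "per P f \<Longrightarrow> per P (\<lambda>x. f (x + c))"
proof -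
  assume f: "per P f"
  have "f (x + P + c) = f (x + c)" for x
    using f[unfolded per_def, rule_format, of "x + c"] by (simp add: add_ac)
  then show ?thesis by (simp add: per_def)
qed

lemma per_shift_diff: "per P f \<Longrightarrow> per P (\<lambda>x. f (x - c))"
  using per_shift[of P f "-c"] by simp

lemma per_const: "per P (\<lambda>_. c)"
  unfolding per_def by simp

lemma per_mult: "per P f \<Longrightarrow> per P g \<Longrightarrow> per P (\<lambda>x. f x * g x)"
  unfolding per_def by simp

lemma per_cnj: "per P f \<Longrightarrow> per P (\<lambda>x. cnj (f x))"
  unfolding per_def by simp

lemma per_norm: "per P f \<Longrightarrow> per P (\<lambda>x. norm (f x))"
  unfolding per_def by simp

lemma per_avg: "(\<And>y. y \<in> A \<Longrightarrow> per P (F y)) \<Longrightarrow> per P (\<lambda>x. avg A (\<lambda>y. F y x))"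
  unfolding per_def by (simp cong: avg_cong)

lemmas per_rules = per_const per_mult per_cnj per_norm per_shift per_shift_diff per_avg

lemma per_mult_period:
  assumes "per P f" shows "f (x + P * k) = f x"
proof (induction k arbitrary: x rule: int_induct[of _ 0])
  case (step1 i)
  have "f (x + P * (i + 1)) = f ((x + P * i) + P)" by (simp add: algebra_simps)
  also have "\<dots> = f (x + P * i)" using assms unfolding per_def by blast
  finally show ?case using step1 by simp
next
  case (step2 i)
  have "f (x + P * (i - 1)) = f ((x + P * (i - 1)) + P)" using assms unfolding per_def by simp
  also have "\<dots> = f (x + P * i)" by (simp add: algebra_simps)
  finally show ?case using step2 by simp
qed simp

lemma per_mod: "per P f \<Longrightarrow> f (x mod P) = f x"
  using per_mult_period[of P f "x mod P" "x div P"] by simp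

lemma per_of_mod: "per P (\<lambda>x. f (x mod P))"
  unfolding per_def by simp

lemma avg_shift:
  assumes "per P f" "P > 0" shows "avg {0..<P} (\<lambda>x. f (x + t)) = avg {0..<P} f"
proof -
  have "(\<Sum>x\<in>{0..<P}. f (x + t)) = (\<Sum>x\<in>{0..<P}. f x)"
  proof (rule sum.reindex_bij_witness[of _ "\<lambda>x. (x - t) mod P" "\<lambda>x. (x + t) mod P"])
    fix x assume "x \<in> {0..<P}"
    then show "((x + t) mod P - t) mod P = x" "((x - t) mod P + t) mod P = x"
      by (simp_all add: mod_simps)
    show "f ((x + t) mod P) = f (x + t)" by (rule per_mod[OF assms(1)])
  qed (use assms in auto)
  then show ?thesis by (simp add: avg_def)
qed

lemma avg_shift_diff:
  assumes "per P f" "P > 0" shows "avg {0..<P} (\<lambda>x. f (x - t)) = avg {0..<P} f"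
  using avg_shift[OF assms, of "-t"] by simp

section \<open>Multiplicative derivatives\<close>

definition D :: "int \<Rightarrow> (int \<Rightarrow> complex) \<Rightarrow> int \<Rightarrow> complex" where
  "D t u = (\<lambda>x. u (x + t) * cnj (u x))"

fun Dl :: "int list \<Rightarrow> (int \<Rightarrow> complex) \<Rightarrow> int \<Rightarrow> complex" where
  "Dl [] u = u"
| "Dl (t # ts) u = Dl ts (D t u)"

definition bdd1 :: "(int \<Rightarrow> complex) \<Rightarrow> bool" where
  "bdd1 u \<longleftrightarrow> (\<forall>x. norm (u x) \<le> 1)"

lemma bdd1_cnj: "bdd1 u \<Longrightarrow> bdd1 (\<lambda>x. cnj (u x))"
  unfolding bdd1_def by simp

lemma bdd1_avg: "(\<And>y. y \<in> A \<Longrightarrow> bdd1 (F y)) \<Longrightarrow> bdd1 (\<lambda>x. avg A (\<lambda>y. F y x))"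
  unfolding bdd1_def by (auto intro: norm_avg_le_bound)

lemma bdd1_avg_norm: "bdd1 u \<Longrightarrow> norm (avg A u) \<le> 1"
  by (rule norm_avg_le_bound) (auto simp: bdd1_def)

lemma per_D [intro]: "per P u \<Longrightarrow> per P (D t u)"
  unfolding D_def by (rule per_rules | assumption)+

lemma bdd1_D [intro]: "bdd1 u \<Longrightarrow> bdd1 (D t u)"
  by (auto simp: D_def bdd1_def norm_mult intro!: mult_le_one)

lemma per_Dl [intro]: "per P u \<Longrightarrow> per P (Dl ts u)"
  by (induction ts arbitrary: u) auto

lemma bdd1_Dl [intro]: "bdd1 u \<Longrightarrow> bdd1 (Dl ts u)"
  by (induction ts arbitrary: u) auto

lemma D_mult: "D t (\<lambda>x. u x * v x) = (\<lambda>x. D t u x * D t v x)"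
  by (simp add: D_def mult_ac)

lemma D_cnj: "D t (\<lambda>x. cnj (u x)) = (\<lambda>x. cnj (D t u x))"
  by (simp add: D_def)

lemma D_shift: "D t (\<lambda>x. u (x + c)) = (\<lambda>x. D t u (x + c))"
  by (simp add: D_def add_ac)

lemma D_commute: "D s (D t u) = D t (D s u)"
  by (simp add: D_def mult_ac add_ac)

lemma Dl_mult: "Dl ts (\<lambda>x. u x * v x) = (\<lambda>x. Dl ts u x * Dl ts v x)"
  by (induction ts arbitrary: u v) (simp_all add: D_mult)

lemma Dl_cnj: "Dl ts (\<lambda>x. cnj (u x)) = (\<lambda>x. cnj (Dl ts u x))"
  by (induction ts arbitrary: u) (simp_all add: D_cnj)

lemma Dl_shift: "Dl ts (\<lambda>x. u (x + c)) = (\<lambda>x. Dl ts u (x + c))"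
  by (induction ts arbitrary: u) (simp_all add: D_shift)

lemma Dl_D: "Dl ts (D t u) = D t (Dl ts u)"
proof (induction ts arbitrary: u)
  case (Cons a ts)
  have "Dl (a # ts) (D t u) = Dl ts (D t (D a u))" by (simp only: Dl.simps D_commute[of a t])
  then show ?case by (simp add: Cons.IH)
qed simp

lemma per_add_dir:
  assumes "per P u" shows "D (t + P) u = D t u"
proof -
  have "u (x + (t + P)) = u (x + t)" for x
    using assms[unfolded per_def, rule_format, of "x + t"] by (simp add: add_ac)
  then show ?thesis by (simp add: D_def)
qed

text \<open>Averaging over all directions \<open>t\<close> decouples \<open>x + t\<close> from
  \<open>x\<close>.\<close>

lemma avg_D:
  assumes "per P u" "P > 0"
  shows "avg {0..<P} (\<lambda>t. avg {0..<P} (D t u)) = complex_of_real ((norm (avg {0..<P} u))\<^sup>2)"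
proof -
  have "avg {0..<P} (\<lambda>t. avg {0..<P} (D t u)) = avg {0..<P} (\<lambda>x. avg {0..<P} (\<lambda>t. D t u x))"
    by (rule avg_swap)
  also have "\<dots> = avg {0..<P} (\<lambda>x. avg {0..<P} u * cnj (u x))"
  proof (rule avg_cong[OF refl])
    fix x
    have "avg {0..<P} (\<lambda>t. D t u x) = avg {0..<P} (\<lambda>t. u (t + x)) * cnj (u x)"
      by (simp add: D_def avg_mult_right add.commute)
    then show "avg {0..<P} (\<lambda>t. D t u x) = avg {0..<P} u * cnj (u x)"
      by (simp add: avg_shift[OF assms])
  qed
  also have "\<dots> = avg {0..<P} u * cnj (avg {0..<P} u)"
    by (simp add: avg_mult_left avg_cnj)
  finally show ?thesis by (simp only: complex_norm_square)
qed

lemma avg_translates: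
  assumes "per P u" "P > 0"
  shows "avg {0..<P} (\<lambda>x. u (x + a) * cnj (u (x + b))) = avg {0..<P} (D (a - b) u)"
proof -
  have "avg {0..<P} (D (a - b) u) = avg {0..<P} (\<lambda>x. D (a - b) u (x + b))"
    by (rule avg_shift[symmetric]) (use assms in auto)
  then show ?thesis by (simp add: D_def add_ac)
qed

section \<open>Elimination of functions in linear and quadratic configurations\<close>

text \<open>Linear van der Corput: each Cauchy--Schwarz removes one of the functions
  \<open>F (x + L y)\<close> at the price of differencing \<open>F0\<close> in a direction \<open>L k\<close>.\<close>
lemma linear_vdC:
  fixes B K :: "'g::ab_group_add set" and w :: "'g \<Rightarrow> complex"
    and fs :: "(('g \<Rightarrow> int) \<times> (int \<Rightarrow> complex)) list"
  assumes BK: "finite B" "finite K" "\<And>y y'. y \<in> B \<Longrightarrow> y' \<in> B \<Longrightarrow> y' - y \<in> K"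
      "real (card K) \<le> 4 * real (card B)"
    and P: "P > 0"
    and w: "\<And>y. norm (w y) \<le> 1" "\<And>y. y \<notin> B \<Longrightarrow> w y = 0"
    and F0: "per P F0" "bdd1 F0"
    and fs: "\<And>L F. (L, F) \<in> set fs \<Longrightarrow> per P F \<and> bdd1 F \<and> (\<forall>y k. L (y + k) = L y + L k)"
  shows "norm (avg B (\<lambda>y. w y * avg {0..<P} (\<lambda>x. F0 x * (\<Prod>(L, F)\<leftarrow>fs. F (x + L y))))) ^ (2 ^ length fs)
    \<le> 4 ^ (2 ^ length fs) *
      avg (tup K (length fs)) (\<lambda>ks. norm (avg {0..<P} (Dl (map2 (\<lambda>(L, F) k. L k) fs ks) F0)))"
  using w F0 fs
proof (induction "length fs" arbitrary: fs w F0)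
  case 0
  have "norm (avg B (\<lambda>y. w y * avg {0..<P} F0)) \<le> norm (avg {0..<P} F0)"
    by (rule norm_avg_le_bound) (auto simp: norm_mult 0 mult_left_le_one_le)
  also have "\<dots> \<le> 4 * norm (avg {0..<P} F0)" by simp
  finally show ?case using 0(1) by simp
next
  case (Suc n gs)
  from Suc.hyps(2) obtain fn fs where fn: "gs = fn # fs" and n: "n = length fs"
    by (cases gs) simp_all
  obtain L F where "fn = (L, F)" by (cases fn)
  with fn have gs: "gs = (L, F) # fs" by simp
  let ?E = "avg {0..<P} :: _ \<Rightarrow> complex"
  note w = Suc.prems(1,2) and F0 = Suc.prems(3,4)
  have F: "per P F" "bdd1 F" and L: "\<And>y k. L (y + k) = L y + L k"
    using Suc.prems(5)[of L F] by (auto simp: gs)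
  have fs: "per P F'" "bdd1 F'" "\<And>y k. L' (y + k) = L' y + L' k" if "(L', F') \<in> set fs" for L' F'
    using Suc.prems(5)[of L' F'] that by (auto simp: gs)
  have per_prod: "per P (\<lambda>x. \<Prod>(L', F')\<leftarrow>fs. F' (x + c L'))" for c
    using fs(1)
  proof (induction fs)
    case (Cons g gs)
    obtain L' F' where g: "g = (L', F')" by (cases g)
    have "per P F'" "per P (\<lambda>x. \<Prod>(L', F')\<leftarrow>gs. F' (x + c L'))"
      using Cons by (auto simp: g)
    then show ?case unfolding g list.map prod_list.Cons case_prod_conv
      by (rule per_mult[OF per_shift])
  qed (simp add: per_const)
  \<comment> \<open>Translating by \<open>- L y\<close> puts \<open>F\<close> at \<open>x\<close>,
    independent of \<open>y\<close>, so that Cauchy--Schwarz can remove it.\<close>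
  define R where "R = (\<lambda>y x. F0 (x - L y) * (\<Prod>(L', F')\<leftarrow>fs. F' (x + (L' y - L y))))"
  \<comment> \<open>Each remaining function is multiplied by a conjugated shift of itself but keeps
    its form \<open>L'\<close>, so the induction hypothesis yields the same directions.\<close>
  define fs' where "fs' = (\<lambda>k. map (\<lambda>(L', F'). (L', \<lambda>x. F' (x + L k) * cnj (F' (x + L' k)))) fs)"
  define w' where "w' = (\<lambda>k y. w y * cnj (w (y + k)))"
  define X where "X = (\<lambda>k. avg B (\<lambda>y. w' k y * ?E (\<lambda>x. D (L k) F0 x * (\<Prod>(L', F')\<leftarrow>fs' k. F' (x + L' y)))))"
  have per_R: "per P (R y)" for y
    unfolding R_def by (rule per_mult per_shift_diff F0 per_prod)+
  have eq1: "avg B (\<lambda>y. w y * ?E (\<lambda>x. F0 x * (\<Prod>(L, F)\<leftarrow>gs. F (x + L y))))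
      = ?E (\<lambda>x. F x * avg B (\<lambda>y. w y * R y x))"
  proof -
    have "?E (\<lambda>x. F0 x * (\<Prod>(L, F)\<leftarrow>gs. F (x + L y))) = ?E (\<lambda>x. F x * R y x)" for y
    proof -
      have "?E (\<lambda>x. F x * R y x) = ?E (\<lambda>x. F (x + L y) * R y (x + L y))"
        by (rule avg_shift[symmetric, OF _ P]) (rule per_mult F per_R)+
      then show ?thesis by (simp add: R_def gs algebra_simps)
    qed
    then have "avg B (\<lambda>y. w y * ?E (\<lambda>x. F0 x * (\<Prod>(L, F)\<leftarrow>gs. F (x + L y))))
        = avg B (\<lambda>y. ?E (\<lambda>x. F x * (w y * R y x)))"
      by (simp add: avg_mult_left[symmetric] mult.left_commute)
    also have "\<dots> = ?E (\<lambda>x. avg B (\<lambda>y. F x * (w y * R y x)))" by (rule avg_swap)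
    finally show ?thesis by (simp add: avg_mult_left)
  qed
  \<comment> \<open>After translating by \<open>L (y + k)\<close>, additivity leaves
    \<open>F0\<close> at \<open>x + L k\<close> and at \<open>x\<close> only: \<open>y\<close> has
    dropped out and \<open>F0\<close> is differenced in direction \<open>L k\<close>.\<close>
  have eq2: "(if y + k \<in> B then ?E (\<lambda>x. w y * R y x * cnj (w (y + k) * R (y + k) x)) else 0)
      = w' k y * ?E (\<lambda>x. D (L k) F0 x * (\<Prod>(L', F')\<leftarrow>fs' k. F' (x + L' y)))" for k y
  proof (cases "y + k \<in> B")
    case True
    have p1: "per P (\<lambda>x. R y x * cnj (R (y + k) x))"
      by (rule per_mult per_cnj per_R)+
    have "?E (\<lambda>x. w y * R y x * cnj (w (y + k) * R (y + k) x))
        = w' k y * ?E (\<lambda>x. R y x * cnj (R (y + k) x))"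
      by (simp add: w'_def avg_mult_left[symmetric] mult_ac)
    also have "?E (\<lambda>x. R y x * cnj (R (y + k) x))
        = ?E (\<lambda>x. R y (x + L (y + k)) * cnj (R (y + k) (x + L (y + k))))"
      by (rule avg_shift[symmetric, OF p1 P])
    also have "\<dots> = ?E (\<lambda>x. D (L k) F0 x * (\<Prod>(L', F')\<leftarrow>fs' k. F' (x + L' y)))"
    proof (rule avg_cong[OF refl])
      fix x
      have "(\<Prod>(L', F')\<leftarrow>fs. F' (x + L (y + k) + (L' y - L y)))
            * cnj (\<Prod>(L', F')\<leftarrow>fs. F' (x + L (y + k) + (L' (y + k) - L (y + k))))
          = (\<Prod>(L', F')\<leftarrow>fs' k. F' (x + L' y))"
        unfolding fs'_def using fs(3)
      proof (induction fs)
        case (Cons g gs)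
        obtain L' F' where g: "g = (L', F')" by (cases g)
        have "L' (y + k) = L' y + L' k" using Cons.prems[of L' F'] by (simp add: g)
        then have a: "x + L (y + k) + (L' (y + k) - L (y + k)) = x + L' y + L' k"
            "x + L (y + k) + (L' y - L y) = x + L' y + L k" by (simp_all add: L)
        have IH: "(\<Prod>(L', F')\<leftarrow>gs. F' (x + L (y + k) + (L' y - L y)))
            * cnj (\<Prod>(L', F')\<leftarrow>gs. F' (x + L (y + k) + (L' (y + k) - L (y + k))))
          = (\<Prod>(L', F')\<leftarrow>map (\<lambda>(L', F'). (L', \<lambda>x. F' (x + L k) * cnj (F' (x + L' k)))) gs. F' (x + L' y))"
          by (rule Cons.IH) (use Cons.prems in auto)
        show ?case
          by (simp only: list.map prod_list.Cons g case_prod_conv a complex_cnj_mult IH[symmetric] mult_ac)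
      qed simp
      then show "R y (x + L (y + k)) * cnj (R (y + k) (x + L (y + k)))
          = D (L k) F0 x * (\<Prod>(L', F')\<leftarrow>fs' k. F' (x + L' y))"
        by (simp add: R_def D_def L algebra_simps)
    qed
    finally show ?thesis using True by simp
  qed (simp add: w'_def w(2))
  have len: "length (fs' k) = n" for k by (simp add: fs'_def n)
  have IH: "norm (X k) ^ (2 ^ n)
      \<le> 4 ^ (2 ^ n) * avg (tup K n) (\<lambda>ks. norm (?E (Dl (map2 (\<lambda>(L, F) k. L k) fs ks) (D (L k) F0))))" for k
  proof -
    have m: "map2 (\<lambda>(L, F) k. L k) (fs' k) ks = map2 (\<lambda>(L, F) k. L k) fs ks" for ks
      unfolding fs'_def by (induction fs arbitrary: ks) (auto split: list.splits simp: zip_Cons1)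
    have "norm (X k) ^ (2 ^ length (fs' k))
      \<le> 4 ^ (2 ^ length (fs' k)) * avg (tup K (length (fs' k)))
          (\<lambda>ks. norm (?E (Dl (map2 (\<lambda>(L, F) k. L k) (fs' k) ks) (D (L k) F0))))"
      unfolding X_def
    proof (rule Suc.hyps(1))
      show "norm (w' k y) \<le> 1" for y
        unfolding w'_def norm_mult complex_mod_cnj by (intro mult_le_one w) auto
      show "w' k y = 0" if "y \<notin> B" for y using w(2)[OF that] by (simp add: w'_def)
      fix L' F' assume "(L', F') \<in> set (fs' k)"
      then obtain F'' where "(L', F'') \<in> set fs" "F' = (\<lambda>x. F'' (x + L k) * cnj (F'' (x + L' k)))"
        by (auto simp: fs'_def)
      then show "per P F' \<and> bdd1 F' \<and> (\<forall>y k. L' (y + k) = L' y + L' k)"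
        using fs[of L' F'']
        by (auto intro!: per_mult per_cnj per_shift simp: bdd1_def norm_mult mult_le_one)
    qed (use F0 len in auto)
    then show ?thesis by (simp add: len m)
  qed
  have "(norm (?E (\<lambda>x. F x * avg B (\<lambda>y. w y * R y x))))\<^sup>2
      \<le> norm (avg B (\<lambda>y. avg B (\<lambda>y'. ?E (\<lambda>x. w y * R y x * cnj (w y' * R y' x)))))"
    by (rule cs_plain) (use F in \<open>auto simp: bdd1_def\<close>)
  also have "\<dots> \<le> 4 * norm (avg K (\<lambda>k. avg B (\<lambda>y.
      if y + k \<in> B then ?E (\<lambda>x. w y * R y x * cnj (w (y + k) * R (y + k) x)) else 0)))"
    by (rule norm_avg_pairs_by_difference_le) (use BK in auto)
  also have "\<dots> = 4 * norm (avg K X)"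
    by (simp only: eq2 X_def)
  also have "\<dots> \<le> 4 * avg K (\<lambda>k. norm (X k))"
    by (intro mult_left_mono norm_avg_le) auto
  finally have "((norm (?E (\<lambda>x. F x * avg B (\<lambda>y. w y * R y x))))\<^sup>2) ^ (2 ^ n) \<le> (4 * avg K (\<lambda>k. norm (X k))) ^ (2 ^ n)"
    by (rule power_mono) simp
  also have "\<dots> \<le> 4 ^ (2 ^ n) * avg K (\<lambda>k. norm (X k) ^ (2 ^ n))"
    unfolding power_mult_distrib by (intro mult_left_mono avg_power_le) auto
  also have "\<dots> \<le> 4 ^ (2 ^ n) * avg K (\<lambda>k. 4 ^ (2 ^ n) *
      avg (tup K n) (\<lambda>ks. norm (?E (Dl (map2 (\<lambda>(L, F) k. L k) fs ks) (D (L k) F0)))))"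
    by (intro mult_left_mono avg_mono IH) auto
  also have "\<dots> = 4 ^ (2 ^ Suc n) * avg (tup K (Suc n)) (\<lambda>ks. norm (?E (Dl (map2 (\<lambda>(L, F) k. L k) gs ks) F0)))"
    unfolding avg_tup_Suc avg_mult_left by (simp add: gs power_add[symmetric] mult_2)
  finally have *: "((norm (?E (\<lambda>x. F x * avg B (\<lambda>y. w y * R y x))))\<^sup>2) ^ (2 ^ n)
    \<le> 4 ^ (2 ^ Suc n) * avg (tup K (Suc n)) (\<lambda>ks. norm (?E (Dl (map2 (\<lambda>(L, F) k. L k) gs ks) F0)))" .
  have "(z\<^sup>2) ^ (2 ^ n) = z ^ (2 ^ Suc n)" for z :: real
    by (simp only: power_mult[symmetric] power_Suc)
  then show ?case using * unfolding eq1 Suc.hyps(2)[symmetric] by simp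
qed

section \<open>PET differencing of the quadratic configuration\<close>

definition diff_range :: "int \<Rightarrow> int set" where
  "diff_range M = {- M<..<M}"

lemma finite_diff_range [simp]: "finite (diff_range M)"
  by (simp add: diff_range_def)

lemma card_diff_range: "M \<ge> 1 \<Longrightarrow> real (card (diff_range M)) = 2 * real_of_int M - 1"
  by (simp add: diff_range_def)

lemma diff_range_nonempty: "M \<ge> 1 \<Longrightarrow> diff_range M \<noteq> {}"
proof -
  assume "M \<ge> 1"
  then have "0 \<in> diff_range M" by (simp add: diff_range_def)
  then show ?thesis by blast
qed

lemma diff_range_diff: "y \<in> {1..M} \<Longrightarrow> y' \<in> {1..M} \<Longrightarrow> y' - y \<in> diff_range M"
  by (auto simp: diff_range_def)

text \<open>The range conditions left behind by two regroupings by difference.\<close>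

definition pet_weight :: "int \<Rightarrow> int \<Rightarrow> int \<Rightarrow> int \<Rightarrow> complex" where
  "pet_weight M a b y = (if y \<in> {1..M} \<and> y + a \<in> {1..M} \<and> y + b \<in> {1..M} \<and> y + a + b \<in> {1..M} then 1 else 0)"

text \<open>The average is cyclic in \<open>x\<close>, while \<open>y\<close> stays in an interval.
  In the applications \<open>M\<^sup>2\<close> and \<open>P\<close> are comparable, the natural
  scale for \<open>y\<^sup>2\<close>.\<close>

definition roth :: "int \<Rightarrow> int \<Rightarrow> (int \<Rightarrow> complex) \<Rightarrow> (int \<Rightarrow> complex) \<Rightarrow> (int \<Rightarrow> complex) \<Rightarrow> complex" where
  "roth P M f g h = avg {0..<P} (\<lambda>x. avg {1..M} (\<lambda>y. f x * g (x + y) * h (x + y\<^sup>2)))"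

text \<open>Cauchy--Schwarz removes \<open>f\<close>, then \<open>g\<close>. The second differencing
  acts on \<open>y\<^sup>2 - y\<close>, and once one copy of \<open>h\<close> has been moved to
  \<open>x\<close> all other arguments are linear in \<open>y\<close>. Each regrouping costs a
  factor 2, and the first one is squared: \<open>8 = 2\<^sup>2 * 2\<close>.\<close>

lemma pet_differencing:
  fixes P M :: int
  assumes f: "bdd1 f" and g: "per P g" "bdd1 g" and h: "per P h" "bdd1 h" and P: "P > 0" and M: "M \<ge> 1"
  shows "norm (roth P M f g h) ^ 4 \<le>
    8 * norm (avg (diff_range M) (\<lambda>a. avg (diff_range M) (\<lambda>b. avg {1..M} (\<lambda>y. pet_weight M a b y *
      avg {0..<P} (\<lambda>x. h x * cnj (h (x + 2*a*y + a\<^sup>2)) * cnj (h (x + 2*b*y + (b\<^sup>2 - b)))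
        * h (x + 2*(a+b)*y + ((a+b)\<^sup>2 - b)))))))"
proof -
  let ?A = "diff_range M" and ?B = "{1..M}" and ?X = "{0..<P}"
  have cardA: "real (card ?A) \<le> 2 * real (card ?B)" using M by (simp add: card_diff_range)
  have gd: "norm (g x * cnj (g (x + a))) \<le> 1" for x a
    using g(2) by (simp add: norm_mult bdd1_def mult_le_one)
  \<comment> \<open>Here \<open>g\<close> has been translated back to \<open>x\<close>, which turns
    \<open>y\<^sup>2\<close> into \<open>y\<^sup>2 - y\<close>.\<close>
  define H where "H = (\<lambda>a x y. if y + a \<in> ?B then h (x + (y\<^sup>2 - y)) * cnj (h (x + ((y + a)\<^sup>2 - y))) else 0)"
  have perH: "per P (\<lambda>x. H a x y)" for a y
  proof (cases "y + a \<in> ?B")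
    case True
    then show ?thesis unfolding H_def by simp (rule per_mult per_cnj per_shift h)+
  qed (auto simp: H_def per_def)
  define Z where "Z = avg ?A (\<lambda>a. avg ?X (\<lambda>x. g x * cnj (g (x + a)) * avg ?B (H a x)))"
  have "(norm (roth P M f g h))\<^sup>2 = (norm (avg ?X (\<lambda>x. f x * avg ?B (\<lambda>y. g (x + y) * h (x + y\<^sup>2)))))\<^sup>2"
    by (simp add: roth_def mult.assoc avg_mult_left)
  also have "\<dots> \<le> norm (avg ?B (\<lambda>y. avg ?B (\<lambda>y'. avg ?X (\<lambda>x. g (x + y) * h (x + y\<^sup>2) * cnj (g (x + y') * h (x + y'\<^sup>2))))))"
    by (rule cs_plain) (use f in \<open>auto simp: bdd1_def\<close>)
  also have "\<dots> \<le> 2 * norm (avg ?A (\<lambda>a. avg ?B (\<lambda>y. if y + a \<in> ?B then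
      avg ?X (\<lambda>x. g (x + y) * h (x + y\<^sup>2) * cnj (g (x + (y + a)) * h (x + (y + a)\<^sup>2))) else 0)))"
    by (rule norm_avg_pairs_by_difference_le) (use cardA diff_range_diff in auto)
  also have "avg ?A (\<lambda>a. avg ?B (\<lambda>y. if y + a \<in> ?B then
      avg ?X (\<lambda>x. g (x + y) * h (x + y\<^sup>2) * cnj (g (x + (y + a)) * h (x + (y + a)\<^sup>2))) else 0)) = Z"
    unfolding Z_def
  proof (rule avg_cong[OF refl])
    fix a
    have "(if y + a \<in> ?B then
      avg ?X (\<lambda>x. g (x + y) * h (x + y\<^sup>2) * cnj (g (x + (y + a)) * h (x + (y + a)\<^sup>2))) else 0)
      = avg ?X (\<lambda>x. g x * cnj (g (x + a)) * H a x y)" for y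
    proof (cases "y + a \<in> ?B")
      case True
      have "per P (\<lambda>x. g x * cnj (g (x + a)) * H a x y)"
        by (rule per_mult per_cnj per_shift g perH)+
      from avg_shift[OF this P, of y, symmetric]
      have "avg ?X (\<lambda>x. g x * cnj (g (x + a)) * H a x y)
         = avg ?X (\<lambda>x. g (x + y) * cnj (g (x + y + a)) * H a (x + y) y)" .
      then show ?thesis using True by (simp add: H_def algebra_simps)
    next
      case False
      then show ?thesis by (simp only: H_def if_False mult_zero_right) (simp add: avg_def)
    qed
    then have "avg ?B (\<lambda>y. if y + a \<in> ?B then
      avg ?X (\<lambda>x. g (x + y) * h (x + y\<^sup>2) * cnj (g (x + (y + a)) * h (x + (y + a)\<^sup>2))) else 0)
      = avg ?B (\<lambda>y. avg ?X (\<lambda>x. g x * cnj (g (x + a)) * H a x y))" by presburger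
    also have "\<dots> = avg ?X (\<lambda>x. avg ?B (\<lambda>y. g x * cnj (g (x + a)) * H a x y))" by (rule avg_swap)
    finally show "avg ?B (\<lambda>y. if y + a \<in> ?B then
      avg ?X (\<lambda>x. g (x + y) * h (x + y\<^sup>2) * cnj (g (x + (y + a)) * h (x + (y + a)\<^sup>2))) else 0)
      = avg ?X (\<lambda>x. g x * cnj (g (x + a)) * avg ?B (H a x))" by (simp add: avg_mult_left)
  qed
  finally have 1: "(norm (roth P M f g h))\<^sup>2 \<le> 2 * norm Z" .
  have "Z = avg (?A \<times> ?X) (\<lambda>p. (case p of (a, x) \<Rightarrow> g x * cnj (g (x + a))) * avg ?B (case p of (a, x) \<Rightarrow> H a x))"
    by (simp add: Z_def avg_Times)
  then have "(norm Z)\<^sup>2 \<le> norm (avg ?B (\<lambda>y. avg ?B (\<lambda>y'. avg (?A \<times> ?X)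
      (\<lambda>p. (case p of (a, x) \<Rightarrow> H a x) y * cnj ((case p of (a, x) \<Rightarrow> H a x) y')))))"
    by (simp only:) (rule cs_plain, use gd in auto)
  also have "\<dots> \<le> 2 * norm (avg ?A (\<lambda>b. avg ?B (\<lambda>y. if y + b \<in> ?B then avg (?A \<times> ?X)
      (\<lambda>p. (case p of (a, x) \<Rightarrow> H a x) y * cnj ((case p of (a, x) \<Rightarrow> H a x) (y + b))) else 0)))"
    by (rule norm_avg_pairs_by_difference_le) (use cardA diff_range_diff in auto)
  also have "avg ?A (\<lambda>b. avg ?B (\<lambda>y. if y + b \<in> ?B then avg (?A \<times> ?X)
      (\<lambda>p. (case p of (a, x) \<Rightarrow> H a x) y * cnj ((case p of (a, x) \<Rightarrow> H a x) (y + b))) else 0))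
    = avg ?A (\<lambda>b. avg ?B (\<lambda>y. avg ?A (\<lambda>a. pet_weight M a b y *
      avg ?X (\<lambda>x. h x * cnj (h (x + 2*a*y + a\<^sup>2)) * cnj (h (x + 2*b*y + (b\<^sup>2 - b)))
        * h (x + 2*(a+b)*y + ((a+b)\<^sup>2 - b))))))"
  proof (intro avg_cong[OF refl])
    fix b y assume y: "y \<in> ?B"
    have "avg ?X (\<lambda>x. (if y + b \<in> ?B then H a x y * cnj (H a x (y + b)) else 0)) = pet_weight M a b y *
      avg ?X (\<lambda>x. h x * cnj (h (x + 2*a*y + a\<^sup>2)) * cnj (h (x + 2*b*y + (b\<^sup>2 - b)))
        * h (x + 2*(a+b)*y + ((a+b)\<^sup>2 - b)))" for a
    proof (cases "pet_weight M a b y = 0")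
      case True
      then have "(if y + b \<in> ?B then H a x y * cnj (H a x (y + b)) else 0) = 0" for x
        using y by (auto simp: pet_weight_def H_def add_ac split: if_splits)
      then show ?thesis using True by (simp add: avg_def)
    next
      case False
      then have in_B: "y + b \<in> ?B" "y + a \<in> ?B" "y + b + a \<in> ?B" and 1: "pet_weight M a b y = 1"
        by (auto simp: pet_weight_def add_ac split: if_splits)
      define G where "G = (\<lambda>x. h x * cnj (h (x + 2*a*y + a\<^sup>2)) * cnj (h (x + 2*b*y + (b\<^sup>2 - b)))
        * h (x + 2*(a+b)*y + ((a+b)\<^sup>2 - b)))"
      have "per P G" unfolding G_def add.assoc
        by (rule per_mult per_cnj per_shift h)+
      from avg_shift[OF this P, of "y\<^sup>2 - y", symmetric]
      have "avg ?X G = avg ?X (\<lambda>x. G (x + (y\<^sup>2 - y)))" .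
      also have "\<dots> = avg ?X (\<lambda>x. H a x y * cnj (H a x (y + b)))"
        using in_B by (simp add: G_def H_def power2_eq_square algebra_simps)
      finally show ?thesis using in_B 1 by (simp add: G_def)
    qed
    note e = this
    show "(if y + b \<in> ?B then avg (?A \<times> ?X)
      (\<lambda>p. (case p of (a, x) \<Rightarrow> H a x) y * cnj ((case p of (a, x) \<Rightarrow> H a x) (y + b))) else 0)
      = avg ?A (\<lambda>a. pet_weight M a b y *
      avg ?X (\<lambda>x. h x * cnj (h (x + 2*a*y + a\<^sup>2)) * cnj (h (x + 2*b*y + (b\<^sup>2 - b)))
        * h (x + 2*(a+b)*y + ((a+b)\<^sup>2 - b))))"
      unfolding e[symmetric]
      by (cases "y + b \<in> ?B") (simp_all only: if_True if_False avg_Times case_prod_conv, simp add: avg_def)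
  qed
  also have "\<dots> = avg ?A (\<lambda>a. avg ?A (\<lambda>b. avg ?B (\<lambda>y. pet_weight M a b y *
      avg ?X (\<lambda>x. h x * cnj (h (x + 2*a*y + a\<^sup>2)) * cnj (h (x + 2*b*y + (b\<^sup>2 - b)))
        * h (x + 2*(a+b)*y + ((a+b)\<^sup>2 - b))))))"
    by (subst (2) avg_swap, subst avg_swap) (rule refl)
  finally have 2: "(norm Z)\<^sup>2 \<le> 2 * norm \<dots>" .
  have "norm (roth P M f g h) ^ 4 = ((norm (roth P M f g h))\<^sup>2)\<^sup>2" by simp
  also have "\<dots> \<le> (2 * norm Z)\<^sup>2" by (rule power_mono[OF 1]) simp
  also have "\<dots> = 4 * (norm Z)\<^sup>2" by (simp add: power_mult_distrib)
  finally show ?thesis using 2 by simp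
qed

text \<open>The five directions are the coefficients of \<open>(y, y')\<close> in the doubled four-point form of
  \<open>h\<close> after the translate \<open>h (x + 2 a' y')\<close> has been moved to the origin. Differencing in a
  direction with two independent parameters is what makes them equidistribute later.\<close>
definition box_avg :: "int \<Rightarrow> int \<Rightarrow> (int \<Rightarrow> complex) \<Rightarrow> int \<Rightarrow> int \<Rightarrow> int \<Rightarrow> int \<Rightarrow> real" where
  "box_avg P M h a b a' b' = avg (tup (diff_range M \<times> diff_range M) 5) (\<lambda>ks. norm (avg {0..<P}
    (Dl (map2 (\<lambda>L k. L k) [\<lambda>(k, k'). 2*a*k - 2*a'*k', \<lambda>(k, k'). 2*b*k - 2*a'*k',
       \<lambda>(k, k'). 2*(a+b)*k - 2*a'*k', \<lambda>(k, k'). 2*b'*k', \<lambda>(k, k'). 2*(b'-a')*k'] ks) h)))"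

text \<open>One more Cauchy--Schwarz removes \<open>h x\<close> and doubles all of
  \<open>(a, b, y)\<close>. For fixed \<open>a, b, a', b'\<close> six values of \<open>h\<close>
  remain, at points linear in \<open>(y, y')\<close>. One of them serves as the base, and the linear
  van der Corput lemma removes the other five; thus \<open>64 = 2 * 2 ^ 5\<close>.\<close>

lemma pet_doubling:
  fixes P M :: int
  assumes h: "per P h" "bdd1 h" and P: "P > 0" and M: "M \<ge> 1"
  shows "norm (avg (diff_range M) (\<lambda>a. avg (diff_range M) (\<lambda>b. avg {1..M} (\<lambda>y. pet_weight M a b y *
      avg {0..<P} (\<lambda>x. h x * cnj (h (x + 2*a*y + a\<^sup>2)) * cnj (h (x + 2*b*y + (b\<^sup>2 - b)))
        * h (x + 2*(a+b)*y + ((a+b)\<^sup>2 - b))))))) ^ 64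
    \<le> 4 ^ 32 * avg (diff_range M) (\<lambda>a. avg (diff_range M) (\<lambda>b. avg (diff_range M) (\<lambda>a'. avg (diff_range M) (\<lambda>b'.
        box_avg P M h a b a' b'))))"
proof -
  let ?A = "diff_range M" and ?B = "{1..M}" and ?X = "{0..<P}"
  define V where "V = (\<lambda>x a b y. pet_weight M a b y * (cnj (h (x + 2*a*y + a\<^sup>2)) * cnj (h (x + 2*b*y + (b\<^sup>2 - b)))
        * h (x + 2*(a+b)*y + ((a+b)\<^sup>2 - b))))"
  define N where "N = (\<lambda>a b a' b'. norm (avg (?B \<times> ?B) (\<lambda>(y, y'). avg ?X (\<lambda>x. V x a b y * cnj (V x a' b' y')))))"
  define T where "T = avg ?A (\<lambda>a. avg ?A (\<lambda>b. avg ?B (\<lambda>y. pet_weight M a b y *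
      avg ?X (\<lambda>x. h x * cnj (h (x + 2*a*y + a\<^sup>2)) * cnj (h (x + 2*b*y + (b\<^sup>2 - b)))
        * h (x + 2*(a+b)*y + ((a+b)\<^sup>2 - b))))))"
  define Q where "Q = ?A \<times> ?A \<times> ?B"
  have "T = avg Q (\<lambda>(a, b, y). avg ?X (\<lambda>x. h x * V x a b y))"
    by (simp add: T_def Q_def avg_Times V_def avg_mult_left[symmetric] mult_ac)
  also have "\<dots> = avg Q (\<lambda>q. avg ?X (\<lambda>x. h x * (case q of (a, b, y) \<Rightarrow> V x a b y)))"
    by (simp add: case_prod_unfold)
  also have "\<dots> = avg ?X (\<lambda>x. avg Q (\<lambda>q. h x * (case q of (a, b, y) \<Rightarrow> V x a b y)))" by (rule avg_swap)
  also have "\<dots> = avg ?X (\<lambda>x. h x * avg Q (\<lambda>q. case q of (a, b, y) \<Rightarrow> V x a b y))" by (simp add: avg_mult_left)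
  finally have T: "T = \<dots>" .
  have "(norm T)\<^sup>2 \<le> norm (avg Q (\<lambda>q. avg Q (\<lambda>q'. avg ?X (\<lambda>x.
      (case q of (a, b, y) \<Rightarrow> V x a b y) * cnj (case q' of (a, b, y) \<Rightarrow> V x a b y)))))"
    unfolding T by (rule cs_plain) (use h in \<open>auto simp: bdd1_def\<close>)
  also have "avg Q (\<lambda>q. avg Q (\<lambda>q'. avg ?X (\<lambda>x.
      (case q of (a, b, y) \<Rightarrow> V x a b y) * cnj (case q' of (a, b, y) \<Rightarrow> V x a b y))))
    = avg ?A (\<lambda>a. avg ?A (\<lambda>b. avg ?B (\<lambda>y. avg ?A (\<lambda>a'. avg ?A (\<lambda>b'. avg ?B (\<lambda>y'.
        avg ?X (\<lambda>x. V x a b y * cnj (V x a' b' y'))))))))"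
    by (simp add: Q_def avg_Times)
  also have "\<dots> = avg ?A (\<lambda>a. avg ?A (\<lambda>b. avg ?A (\<lambda>a'. avg ?B (\<lambda>y. avg ?A (\<lambda>b'. avg ?B (\<lambda>y'.
        avg ?X (\<lambda>x. V x a b y * cnj (V x a' b' y'))))))))"
    by (intro avg_cong[OF refl]) (rule avg_swap)
  also have "\<dots> = avg ?A (\<lambda>a. avg ?A (\<lambda>b. avg ?A (\<lambda>a'. avg ?A (\<lambda>b'. avg ?B (\<lambda>y. avg ?B (\<lambda>y'.
        avg ?X (\<lambda>x. V x a b y * cnj (V x a' b' y'))))))))"
    by (intro avg_cong[OF refl]) (rule avg_swap)
  also have "norm \<dots> \<le> avg ?A (\<lambda>a. avg ?A (\<lambda>b. avg ?A (\<lambda>a'. avg ?A (\<lambda>b'. N a b a' b'))))"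
    unfolding N_def avg_Times case_prod_conv
    by (intro order_trans[OF norm_avg_le] avg_mono order.refl)
  finally have 1: "(norm T)\<^sup>2 \<le> avg ?A (\<lambda>a. avg ?A (\<lambda>b. avg ?A (\<lambda>a'. avg ?A (\<lambda>b'. N a b a' b'))))" .
  have N0: "0 \<le> N a b a' b'" for a b a' b' by (simp add: N_def)
  have 2: "N a b a' b' ^ 32 \<le> 4 ^ 32 * box_avg P M h a b a' b'" for a b a' b'
  proof -
    define fs where "fs = [(\<lambda>(k, k'). 2*a*k - 2*a'*k', \<lambda>x. cnj (h (x + a\<^sup>2))),
       (\<lambda>(k, k'). 2*b*k - 2*a'*k', \<lambda>x. cnj (h (x + (b\<^sup>2 - b)))),
       (\<lambda>(k, k'). 2*(a+b)*k - 2*a'*k', \<lambda>x. h (x + ((a+b)\<^sup>2 - b))),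
       (\<lambda>(k, k'). 2*b'*k', \<lambda>x. cnj (h (x + ((a'+b')\<^sup>2 - b')))),
       (\<lambda>(k :: int, k'). 2*(b'-a')*k', \<lambda>x. h (x + (b'\<^sup>2 - b')))]"
    define w where "w = (\<lambda>(y, y'). pet_weight M a b y * pet_weight M a' b' y')"
    have len: "length fs = 5" by (simp add: fs_def)
    have e: "avg ?X (\<lambda>x. V x a b y * cnj (V x a' b' y'))
       = w (y, y') * avg ?X (\<lambda>x. h (x + a'\<^sup>2) * (\<Prod>(L, F)\<leftarrow>fs. F (x + L (y, y'))))" for y y'
    proof -
      define G where "G = (\<lambda>x. h (x + a'\<^sup>2) * (\<Prod>(L, F)\<leftarrow>fs. F (x + L (y, y'))))"
      have "per P G" unfolding G_def fs_def list.map prod_list.Cons prod_list.Nil case_prod_conv add.assoc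
        by (rule per_const per_mult per_cnj per_shift h)+
      from avg_shift[OF this P, of "2*a'*y'", symmetric]
      have G: "avg ?X G = avg ?X (\<lambda>x. G (x + 2*a'*y'))" .
      have "V x a b y * cnj (V x a' b' y') = w (y, y') * G (x + 2*a'*y')" for x
      proof -
        have c: "cnj (pet_weight M a' b' y') = pet_weight M a' b' y'" by (simp add: pet_weight_def)
        show ?thesis by (simp add: V_def w_def G_def fs_def c algebra_simps)
      qed
      then show ?thesis by (simp add: G_def[symmetric] G avg_mult_left)
    qed
    have "norm (avg (?B \<times> ?B) (\<lambda>y. w y * avg ?X (\<lambda>x. h (x + a'\<^sup>2) * (\<Prod>(L, F)\<leftarrow>fs. F (x + L y))))) ^ (2 ^ length fs)
      \<le> 4 ^ (2 ^ length fs) * avg (tup (?A \<times> ?A) (length fs))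
          (\<lambda>ks. norm (avg ?X (Dl (map2 (\<lambda>(L, F) k. L k) fs ks) (\<lambda>x. h (x + a'\<^sup>2)))))"
    proof (rule linear_vdC)
      show "y' - y \<in> ?A \<times> ?A" if "y \<in> ?B \<times> ?B" "y' \<in> ?B \<times> ?B" for y y'
        using that by (auto simp: diff_range_def)
      have "(2 * real_of_int M - 1)\<^sup>2 \<le> (2 * real_of_int M)\<^sup>2"
        by (rule power_mono) (use M in auto)
      then show "real (card (?A \<times> ?A)) \<le> 4 * real (card (?B \<times> ?B))"
        using M by (simp add: card_cartesian_product card_diff_range power2_eq_square)
      show "norm (w y) \<le> 1" for y by (auto simp: w_def pet_weight_def split: prod.splits)
      show "w y = 0" if "y \<notin> ?B \<times> ?B" for y using that by (auto simp: w_def pet_weight_def split: prod.splits)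
      show "per P (\<lambda>x. h (x + a'\<^sup>2))" by (rule per_shift[OF h(1)])
      show "bdd1 (\<lambda>x. h (x + a'\<^sup>2))" using h(2) by (simp add: bdd1_def)
      fix L F assume "(L, F) \<in> set fs"
      then have *: "(L, F) \<in> set fs \<and> bdd1 F \<and> (\<forall>y k. L (y + k) = L y + L k)"
        using h(2) by (auto simp: fs_def bdd1_def algebra_simps)
      have "per P F" using * h(1) by (auto simp: fs_def intro!: per_cnj per_shift)
      with * show "per P F \<and> bdd1 F \<and> (\<forall>y k. L (y + k) = L y + L k)" by simp
    qed (use P in auto)
    moreover have "avg (?B \<times> ?B) (\<lambda>y. w y * avg ?X (\<lambda>x. h (x + a'\<^sup>2) * (\<Prod>(L, F)\<leftarrow>fs. F (x + L y))))
      = avg (?B \<times> ?B) (\<lambda>(y, y'). avg ?X (\<lambda>x. V x a b y * cnj (V x a' b' y')))"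
      by (simp add: avg_Times e)
    moreover have "avg ?X (Dl ts (\<lambda>x. h (x + a'\<^sup>2))) = avg ?X (Dl ts h)" for ts
      unfolding Dl_shift using h(1) P by (intro avg_shift) auto
    moreover have "map2 (\<lambda>(L, F) k. L k) fs ks = map2 (\<lambda>L k. L k) (map fst fs) ks" for ks
      by (simp add: zip_map1 case_prod_unfold)
    ultimately show ?thesis by (simp add: N_def box_avg_def len) (simp add: fs_def)
  qed
  have "norm T ^ 64 = ((norm T)\<^sup>2) ^ 32" by (simp flip: power_mult)
  also have "\<dots> \<le> (avg ?A (\<lambda>a. avg ?A (\<lambda>b. avg ?A (\<lambda>a'. avg ?A (\<lambda>b'. N a b a' b'))))) ^ (2 ^ 5)"
    using power_mono[OF 1, of 32] by simp
  also have "\<dots> = (avg (?A \<times> ?A \<times> ?A \<times> ?A) (\<lambda>(a, b, a', b'). N a b a' b')) ^ (2 ^ 5)"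
    by (simp add: avg_Times)
  also have "\<dots> \<le> avg (?A \<times> ?A \<times> ?A \<times> ?A) (\<lambda>p. (case p of (a, b, a', b') \<Rightarrow> N a b a' b') ^ (2 ^ 5))"
    by (rule avg_power_le) (auto simp: N0)
  also have "\<dots> = avg ?A (\<lambda>a. avg ?A (\<lambda>b. avg ?A (\<lambda>a'. avg ?A (\<lambda>b'. N a b a' b' ^ 32))))"
    by (simp add: avg_Times)
  also have "\<dots> \<le> avg ?A (\<lambda>a. avg ?A (\<lambda>b. avg ?A (\<lambda>a'. avg ?A (\<lambda>b'. 4 ^ 32 * box_avg P M h a b a' b'))))"
    by (intro avg_mono 2)
  finally show ?thesis by (simp only: T_def avg_mult_left)
qed

section \<open>Equidistribution of directions and control by Gowers norms\<close>

text \<open>The pair \<open>(a, c)\<close> is good if the values \<open>2 c k - 2 a k'\<close> are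
  equidistributed modulo \<open>P\<close> up to the factor \<open>R\<close>.\<close>
definition good_pair :: "int \<Rightarrow> int \<Rightarrow> real \<Rightarrow> int \<Rightarrow> int \<Rightarrow> bool" where
  "good_pair P M R a c \<longleftrightarrow> (\<forall>G :: int \<Rightarrow> real. (\<forall>t. 0 \<le> G t) \<longrightarrow> per P G \<longrightarrow>
     avg (diff_range M) (\<lambda>k. avg (diff_range M) (\<lambda>k'. G (2*c*k - 2*a*k'))) \<le> R * avg {0..<P} G)"

text \<open>Subtracting the minimum and dividing by \<open>d\<close> embeds \<open>S\<close> into an
  initial segment of the nonnegative integers.\<close>

lemma card_congruent_subset:
  fixes S :: "int set" and d :: int
  assumes S: "S \<subseteq> {l<..<u}" and d: "d > 0" and cong: "\<And>x y. x \<in> S \<Longrightarrow> y \<in> S \<Longrightarrow> d dvd x - y" and lu: "l \<le> u"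
  shows "real (card S) \<le> real_of_int (u - l) / real_of_int d + 1"
proof (cases "S = {}")
  case False
  have fin: "finite S" using S by (rule finite_subset) simp
  define m where "m = Min S"
  have m: "m \<in> S" "\<And>x. x \<in> S \<Longrightarrow> m \<le> x" using False fin by (auto simp: m_def)
  have "inj_on (\<lambda>x. (x - m) div d) S"
  proof (rule inj_onI)
    fix x y assume xy: "x \<in> S" "y \<in> S" "(x - m) div d = (y - m) div d"
    have "x - m = d * ((x - m) div d)"
      by (rule dvd_mult_div_cancel[OF cong[OF xy(1) m(1)], symmetric])
    also have "\<dots> = d * ((y - m) div d)" by (simp only: xy(3))
    also have "\<dots> = y - m" by (rule dvd_mult_div_cancel[OF cong[OF xy(2) m(1)]])
    finally show "x = y" by simp
  qed
  moreover have "(\<lambda>x. (x - m) div d) ` S \<subseteq> {0..(u - l) div d}"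
  proof (rule image_subsetI)
    fix x assume "x \<in> S"
    then have "m \<le> x" "x < u" "l < m" using S m by auto
    then have "0 \<le> x - m" "x - m \<le> u - l" by simp_all
    then show "(x - m) div d \<in> {0..(u - l) div d}"
      using d by (auto simp: zdiv_mono1 pos_imp_zdiv_nonneg_iff)
  qed
  ultimately have "card S \<le> card {0..(u - l) div d}"
    by (rule card_inj_on_le) simp
  also have "real \<dots> = real_of_int ((u - l) div d) + 1"
    using lu d by (simp add: pos_imp_zdiv_nonneg_iff)
  also have "\<dots> \<le> real_of_int (u - l) / real_of_int d + 1"
    using real_of_int_div4[of "u - l" d] by simp
  finally show ?thesis by simp
qed (use lu d in simp)

text \<open>As \<open>a\<close> and \<open>c\<close> are at most \<open>2 * M\<close> in size, two
  values of \<open>2*c*k - 2*a*k'\<close> differ by at most \<open>16 * M\<^sup>2 < P\<close>, so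
  congruent values are equal. In a fibre the coordinates \<open>k\<close> are then congruent modulo
  \<open>\<bar>a\<bar> div gcd a c\<close>, which is at least \<open>M / m\<^sup>2\<close>. Hence no
  residue is hit more than about \<open>m\<^sup>2\<close> times.\<close>

lemma good_pair_of_gcd:
  fixes P M a c :: int and m :: nat
  assumes M: "M \<ge> 1" and P: "32 * M\<^sup>2 \<le> P" "P \<le> 128 * M\<^sup>2"
    and ac: "\<bar>a\<bar> \<le> 2 * M" "\<bar>c\<bar> \<le> 2 * M" and m: "m > 0"
    and a: "real_of_int M \<le> real m * real_of_int \<bar>a\<bar>" and g: "gcd a c \<le> int m"
  shows "good_pair P M (384 * real m ^ 2) a c"
  unfolding good_pair_def
proof (intro allI impI)
  fix G :: "int \<Rightarrow> real" assume G: "\<forall>t. 0 \<le> G t" "per P G"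
  let ?K = "diff_range M \<times> diff_range M" and ?X = "{0..<P}"
  have M2: "M\<^sup>2 > 0" using M by simp
  have P0: "P > 0" using P M2 by linarith
  have a0: "a \<noteq> 0" using a M by auto
  define v where "v = (\<lambda>(k, k'). 2*c*k - 2*a*k')"
  have vb: "\<bar>v p - v p'\<bar> < P" if p: "p \<in> ?K" "p' \<in> ?K" for p p'
  proof -
    have t: "\<bar>2 * c * k\<bar> \<le> 4 * M\<^sup>2" "\<bar>2 * a * k\<bar> \<le> 4 * M\<^sup>2" if "k \<in> diff_range M" for k
    proof -
      have k: "\<bar>k\<bar> \<le> M" using that by (auto simp: diff_range_def)
      have "\<bar>c\<bar> * \<bar>k\<bar> \<le> 2 * M * M" "\<bar>a\<bar> * \<bar>k\<bar> \<le> 2 * M * M"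
        by (intro mult_mono k ac; use M in simp)+
      then show "\<bar>2 * c * k\<bar> \<le> 4 * M\<^sup>2" "\<bar>2 * a * k\<bar> \<le> 4 * M\<^sup>2"
        by (simp_all add: abs_mult power2_eq_square)
    qed
    obtain k k' l l' where pp: "p = (k, k')" "p' = (l, l')" by (cases p, cases p')
    then have "k \<in> diff_range M" "k' \<in> diff_range M" "l \<in> diff_range M" "l' \<in> diff_range M" using p by auto
    from t[OF this(1)] t[OF this(2)] t[OF this(3)] t[OF this(4)] show ?thesis
      using P M2 unfolding pp v_def case_prod_conv by linarith
  qed
  have fiber: "real (card {p \<in> ?K. v p mod P = t}) \<le> 3 * real m ^ 2" for t
  proof -
    let ?S = "{p \<in> ?K. v p mod P = t}"
    define d where "d = \<bar>a\<bar> div gcd a c"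
    have gp: "gcd a c > 0" using a0 by simp
    have ad: "\<bar>a\<bar> = gcd a c * d" by (simp add: d_def)
    have "0 < gcd a c * d" using a0 unfolding ad[symmetric] by simp
    then have d0: "d > 0" using gp by (rule zero_less_mult_pos)
    have veq: "v p = v p'" if "p \<in> ?S" "p' \<in> ?S" for p p'
    proof -
      have "v p mod P = v p' mod P" using that by simp
      then have "P dvd v p - v p'" by (simp only: mod_eq_dvd_iff)
      moreover have "\<bar>v p - v p'\<bar> < P" using vb that by auto
      ultimately show ?thesis using dvd_imp_le_int[of "v p - v p'" P] P0 by auto
    qed
    \<comment> \<open>For a given value, \<open>k\<close> determines \<open>k'\<close> because
      \<open>a \<noteq> 0\<close>; it suffices to count first coordinates.\<close>
    have inj: "inj_on fst ?S"
    proof (rule inj_onI)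
      fix p p' assume p: "p \<in> ?S" "p' \<in> ?S" "fst p = fst p'"
      from veq[OF p(1,2)] p(3) a0 show "p = p'" by (cases p, cases p') (auto simp: v_def)
    qed
    have "real (card ?S) = real (card (fst ` ?S))" by (simp add: card_image inj)
    also have "\<dots> \<le> real_of_int (M - (- M)) / real_of_int d + 1"
    proof (rule card_congruent_subset)
      show "fst ` ?S \<subseteq> {- M<..<M}" by (auto simp: diff_range_def)
      fix x y assume "x \<in> fst ` ?S" "y \<in> fst ` ?S"
      then obtain x' y' where xy: "(x, x') \<in> ?S" "(y, y') \<in> ?S" by auto
      from veq[OF this] have "c * (x - y) = a * (x' - y')" by (simp add: v_def algebra_simps)
      moreover have "gcd a c * (c div gcd a c) = c" "gcd a c * (a div gcd a c) = a" by simp_all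
      ultimately have "gcd a c * ((c div gcd a c) * (x - y)) = gcd a c * ((a div gcd a c) * (x' - y'))"
        by (simp only: mult.assoc[symmetric])
      then have "(c div gcd a c) * (x - y) = (a div gcd a c) * (x' - y')"
        using gp by (subst (asm) mult_cancel_left) linarith
      then have "a div gcd a c dvd c div gcd a c * (x - y)" by simp
      moreover have "coprime (a div gcd a c) (c div gcd a c)" using a0 by (simp add: div_gcd_coprime)
      ultimately have "a div gcd a c dvd x - y" by (simp add: coprime_dvd_mult_right_iff)
      then show "d dvd x - y" unfolding d_def
        by (metis abs_div abs_dvd_iff abs_gcd_int gcd_dvd1)
    qed (use d0 M in auto)
    also have "real_of_int (M - (- M)) / real_of_int d \<le> 2 * real m ^ 2"
    proof -
      have "2 * real_of_int M \<le> 2 * (real m * real_of_int \<bar>a\<bar>)" using a by simp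
      also have "real_of_int \<bar>a\<bar> = real_of_int (gcd a c) * real_of_int d" by (simp only: ad of_int_mult)
      also have "\<dots> \<le> real m * real_of_int d"
        by (rule mult_right_mono) (use g d0 in linarith)+
      finally have "2 * real_of_int M \<le> 2 * real m ^ 2 * real_of_int d"
        by (simp add: power2_eq_square mult_left_mono)
      then show ?thesis using d0 by (simp add: divide_simps)
    qed
    also have "1 \<le> real m ^ 2" using m by simp
    finally show ?thesis by simp
  qed
  have "(\<Sum>p\<in>?K. G (v p)) = (\<Sum>p\<in>?K. G (v p mod P))"
    by (simp add: per_mod[OF G(2)])
  also have "\<dots> = (\<Sum>t\<in>?X. \<Sum>p\<in>{p \<in> ?K. v p mod P = t}. G (v p mod P))"
    by (rule sum.group[symmetric]) (use P0 in auto)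
  also have "\<dots> = (\<Sum>t\<in>?X. real (card {p \<in> ?K. v p mod P = t}) * G t)"
    by (rule sum.cong[OF refl]) simp
  also have "\<dots> \<le> (\<Sum>t\<in>?X. 3 * real m ^ 2 * G t)"
    by (intro sum_mono mult_right_mono fiber) (use G in auto)
  also have "\<dots> = 3 * real m ^ 2 * real_of_int P * avg ?X G"
    using P0 by (simp add: avg_def sum_distrib_left[symmetric])
  \<comment> \<open>The constant 384 is the fibre bound 3 times the bound 128 for
    \<open>P / M\<^sup>2\<close>.\<close>
  also have "\<dots> \<le> 3 * real m ^ 2 * (128 * real (card ?K)) * avg ?X G"
  proof -
    have "real_of_int P \<le> real_of_int (128 * M\<^sup>2)" using P(2) by linarith
    also have "\<dots> \<le> 128 * (2 * real_of_int M - 1)\<^sup>2"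
      using power_mono[of "real_of_int M" "2 * real_of_int M - 1" 2] M by simp
    also have "\<dots> = 128 * real (card ?K)"
      using M by (simp add: card_cartesian_product card_diff_range power2_eq_square)
    finally show ?thesis
      by (intro mult_right_mono mult_left_mono) (auto intro!: avg_nonneg simp: G)
  qed
  finally have le: "(\<Sum>p\<in>?K. G (v p)) \<le> 384 * real m ^ 2 * avg ?X G * real (card ?K)" by (simp add: mult_ac)
  have "real (card ?K) > 0" using diff_range_nonempty[OF M] by (simp add: card_gt_0_iff)
  with le have "avg ?K (\<lambda>p. G (v p)) \<le> 384 * real m ^ 2 * avg ?X G"
    unfolding avg_def[of ?K] by (simp add: divide_simps)
  then show "avg (diff_range M) (\<lambda>k. avg (diff_range M) (\<lambda>k'. G (2*c*k - 2*a*k'))) \<le> 384 * real m ^ 2 * avg {0..<P} G"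
    by (simp add: avg_Times v_def)
qed

text \<open>Comparison with the telescoping terms \<open>1 / (n * (n + 1))\<close>.\<close>

lemma sum_inverse_squares_tail:
  fixes m n :: nat
  assumes "m > 0"
  shows "(\<Sum>q\<in>{m<..n}. 1 / (real q)\<^sup>2) \<le> 1 / real m"
proof -
  have "(\<Sum>q\<in>{m<..n}. 1 / (real q)\<^sup>2) \<le> 1 / real m - 1 / real n" if "m \<le> n" using that
  proof (induction n rule: dec_induct)
    case (step n)
    have n: "real n > 0" using step assms by simp
    have "1 / (real (Suc n))\<^sup>2 \<le> 1 / (real n * real (Suc n))"
      using n by (intro divide_left_mono) (auto simp: power2_eq_square)
    also have "\<dots> = 1 / real n - 1 / real (Suc n)" using n by (simp add: field_simps)
    finally have "1 / (real (Suc n))\<^sup>2 \<le> 1 / real n - 1 / real (Suc n)" .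
    moreover have "{m<..Suc n} = insert (Suc n) {m<..n}" using step by auto
    ultimately show ?case using step by simp
  qed simp
  moreover have "1 / real n \<ge> 0" by simp
  ultimately have "(\<Sum>q\<in>{m<..n}. 1 / (real q)\<^sup>2) \<le> 1 / real m" if "m \<le> n"
    using that by linarith
  moreover have "(\<Sum>q\<in>{m<..n}. 1 / (real q)\<^sup>2) \<le> 1 / real m" if "\<not> m \<le> n"
    using that by simp
  ultimately show ?thesis by blast
qed

text \<open>The bound \<open>q \<le> 2 * M\<close> lets the additive 1 be absorbed into
  \<open>2 * M / q\<close>.\<close>

lemma card_multiples_shifted_diff_range:
  fixes M s :: int and q :: nat
  assumes "M \<ge> 1" "q > 0" "int q \<le> 2 * M"
  shows "real (card {a \<in> diff_range M. int q dvd a + s}) \<le> 4 * real_of_int M / real q"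
proof -
  have "real (card {a \<in> diff_range M. int q dvd a + s}) \<le> real_of_int (M - (- M)) / real_of_int (int q) + 1"
  proof (rule card_congruent_subset)
    fix x y assume "x \<in> {a \<in> diff_range M. int q dvd a + s}" "y \<in> {a \<in> diff_range M. int q dvd a + s}"
    then have "int q dvd (x + s) - (y + s)" by (intro dvd_diff) auto
    then show "int q dvd x - y" by simp
  qed (use assms in \<open>auto simp: diff_range_def\<close>)
  also have "\<dots> \<le> 4 * real_of_int M / real q" using assms by (simp add: field_simps)
  finally show ?thesis .
qed

text \<open>Few \<open>a\<close> make \<open>a + s'\<close> small, which costs \<open>3 / m\<close>.
  A common divisor \<open>q\<close> has density of order \<open>1 / q\<^sup>2\<close>, and the sum
  over \<open>q > m\<close> costs \<open>16 / m\<close>. The shifts allow for directions such as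
  \<open>a + b\<close> with \<open>a\<close> held fixed.\<close>

lemma bad_pairs_card:
  fixes M s s' :: int and m :: nat
  assumes M: "M \<ge> 1" and s: "\<bar>s\<bar> \<le> M" "\<bar>s'\<bar> \<le> M" and m: "m > 0" "int m \<le> M"
  shows "real (card {(a, c) \<in> diff_range M \<times> diff_range M. real_of_int M > real m * real_of_int \<bar>a + s'\<bar>
      \<or> gcd (a + s') (c + s) > int m}) \<le> 19 / real m * real (card (diff_range M \<times> diff_range M))"
proof -
  let ?A = "diff_range M"
  define S1 where "S1 = {a \<in> ?A. real_of_int M > real m * real_of_int \<bar>a + s'\<bar>}"
  define T where "T = (\<lambda>q. {a \<in> ?A. int q dvd a + s'} \<times> {c \<in> ?A. int q dvd c + s})"
  define n where "n = nat (2 * M)"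
  have sub: "{(a, c) \<in> ?A \<times> ?A. real_of_int M > real m * real_of_int \<bar>a + s'\<bar> \<or> gcd (a + s') (c + s) > int m}
      \<subseteq> S1 \<times> ?A \<union> (\<Union>q\<in>{m<..n}. T q)"
  proof
    fix p assume p: "p \<in> {(a, c) \<in> ?A \<times> ?A. real_of_int M > real m * real_of_int \<bar>a + s'\<bar> \<or> gcd (a + s') (c + s) > int m}"
    obtain a c where pac: "p = (a, c)" by (cases p)
    show "p \<in> S1 \<times> ?A \<union> (\<Union>q\<in>{m<..n}. T q)"
    proof (cases "real_of_int M > real m * real_of_int \<bar>a + s'\<bar>")
      case True
      then show ?thesis using p by (simp add: pac S1_def)
    next
      case False
      then have not2: "real m * real_of_int \<bar>a + s'\<bar> \<ge> real_of_int M" by simp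
      have ac: "a \<in> ?A" "c \<in> ?A" "gcd (a + s') (c + s) > int m" using p False by (auto simp: pac)
    \<comment> \<open>So the gcd is at most \<open>\<bar>a + s'\<bar>\<close>, which limits the
      divisors \<open>q\<close> to \<open>2 * M\<close>.\<close>
    have "a + s' \<noteq> 0"
    proof
      assume "a + s' = 0"
      with not2 have "real_of_int M \<le> 0" by (simp only: abs_zero of_int_0 mult_zero_right)
      with M show False by simp
    qed
    moreover have "\<bar>a + s'\<bar> \<le> 2 * M" using ac(1) s by (auto simp: diff_range_def)
    ultimately have "gcd (a + s') (c + s) \<le> 2 * M"
      using gcd_le1_int[of "\<bar>a + s'\<bar>" "c + s"] by auto
    then have "(a, c) \<in> T (nat (gcd (a + s') (c + s)))" "nat (gcd (a + s') (c + s)) \<in> {m<..n}"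
      using ac by (auto simp: T_def n_def nat_less_iff)
    then show ?thesis unfolding pac by blast
    qed
  qed
  have fin: "finite S1" "finite (T q)" for q by (simp_all add: S1_def T_def)
  have "card {(a, c) \<in> ?A \<times> ?A. real_of_int M > real m * real_of_int \<bar>a + s'\<bar> \<or> gcd (a + s') (c + s) > int m}
    \<le> card (S1 \<times> ?A \<union> (\<Union>q\<in>{m<..n}. T q))"
    by (rule card_mono[OF _ sub]) (use fin in auto)
  also have "\<dots> \<le> card (S1 \<times> ?A) + (\<Sum>q\<in>{m<..n}. card (T q))"
    by (rule order_trans[OF card_Un_le]) (simp add: card_UN_le)
  finally have "real (card {(a, c) \<in> ?A \<times> ?A. real_of_int M > real m * real_of_int \<bar>a + s'\<bar> \<or> gcd (a + s') (c + s) > int m})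
    \<le> real (card (S1 \<times> ?A)) + (\<Sum>q\<in>{m<..n}. real (card (T q)))"
    by (simp flip: of_nat_sum of_nat_add)
  also have "real (card (S1 \<times> ?A)) \<le> 3 * real_of_int M / real m * real (card ?A)"
  proof -
    have "real (card S1) \<le> 2 * real_of_int (M div int m) + 1"
    proof -
      have "S1 \<subseteq> {- s' - M div int m..- s' + M div int m}"
      proof
        fix a assume "a \<in> S1"
        then have "real_of_int (int m * \<bar>a + s'\<bar>) \<le> real_of_int M" by (simp add: S1_def)
        then have "(int m * \<bar>a + s'\<bar>) div int m \<le> M div int m"
          using m by (intro zdiv_mono1) linarith+
        then have "\<bar>a + s'\<bar> \<le> M div int m" using m by simp
        then show "a \<in> {- s' - M div int m..- s' + M div int m}" by auto
      qed
      then have "card S1 \<le> card {- s' - M div int m..- s' + M div int m}" by (rule card_mono[rotated]) simp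
      moreover have "M div int m \<ge> 0" using M m by (simp add: pos_imp_zdiv_nonneg_iff)
      ultimately show ?thesis by simp
    qed
    also have "\<dots> \<le> 2 * (real_of_int M / real m) + 1"
      using real_of_int_div4[of M "int m"] m by simp
    also have "\<dots> \<le> 3 * real_of_int M / real m"
      using m by (simp add: field_simps)
    finally show ?thesis unfolding card_cartesian_product of_nat_mult by (rule mult_right_mono) simp
  qed
  also have "(\<Sum>q\<in>{m<..n}. real (card (T q))) \<le> (\<Sum>q\<in>{m<..n}. 16 * (real_of_int M)\<^sup>2 * (1 / (real q)\<^sup>2))"
  proof (rule sum_mono)
    fix q assume "q \<in> {m<..n}"
    then have "q > 0" "int q \<le> 2 * M" by (auto simp: n_def le_nat_iff)
    note c = card_multiples_shifted_diff_range[OF M this]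
    have "real (card (T q)) = real (card {a \<in> ?A. int q dvd a + s'}) * real (card {a \<in> ?A. int q dvd a + s})"
      by (simp add: T_def card_cartesian_product)
    also have "\<dots> \<le> (4 * real_of_int M / real q) * (4 * real_of_int M / real q)"
      by (intro mult_mono c) (use M in auto)
    finally show "real (card (T q)) \<le> 16 * (real_of_int M)\<^sup>2 * (1 / (real q)\<^sup>2)"
      by (simp add: power2_eq_square)
  qed
  also have "\<dots> \<le> 16 * (real_of_int M)\<^sup>2 * (1 / real m)"
    unfolding sum_distrib_left[symmetric]
    by (intro mult_left_mono sum_inverse_squares_tail m) simp
  also have "3 * real_of_int M / real m * real (card ?A) + 16 * (real_of_int M)\<^sup>2 * (1 / real m)
    \<le> 3 * real (card ?A) / real m * real (card ?A) + 16 * (real (card ?A))\<^sup>2 * (1 / real m)"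
  proof -
    have "real_of_int M \<le> real (card ?A)" using M by (simp add: card_diff_range)
    moreover from this have "(real_of_int M)\<^sup>2 \<le> (real (card ?A))\<^sup>2" by (rule power_mono) (use M in simp)
    ultimately show ?thesis by (intro add_mono mult_right_mono divide_right_mono mult_left_mono) auto
  qed
  also have "\<dots> = 19 / real m * real (card (?A \<times> ?A))"
    by (simp add: card_cartesian_product power2_eq_square field_simps)
  finally show ?thesis by simp
qed

text \<open>Take \<open>m\<close> about \<open>19 / \<eta>\<close>. Then
  \<open>384 * m\<^sup>2\<close> is at most \<open>153600 / \<eta>\<^sup>2\<close>, and
  \<open>1 / \<eta> \<ge> 2\<close> absorbs 153600 into an 18th power. In the same way the sixth
  power in the hypothesis guarantees \<open>m \<le> M\<close>.\<close>

lemma bad_pairs_avg: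
  fixes P M s s' :: int and \<eta> :: real
  assumes M: "M \<ge> 1" and P: "32 * M\<^sup>2 \<le> P" "P \<le> 128 * M\<^sup>2" and s: "\<bar>s\<bar> \<le> M" "\<bar>s'\<bar> \<le> M"
    and \<eta>: "0 < \<eta>" "\<eta> \<le> 1 / 2" "(1 / \<eta>) ^ 6 \<le> real_of_int M"
  shows "avg (diff_range M) (\<lambda>a. avg (diff_range M) (\<lambda>c. if good_pair P M ((1 / \<eta>) ^ 20) (a + s') (c + s) then 0 else 1)) \<le> \<eta>"
proof -
  let ?A = "diff_range M"
  define m where "m = nat \<lceil>19 / \<eta>\<rceil>"
  have y: "1 / \<eta> \<ge> 2" using \<eta> by (simp add: field_simps)
  have m1: "19 / \<eta> \<le> real m" unfolding m_def by linarith
  have m2: "real m \<le> 20 * (1 / \<eta>)" unfolding m_def using y by linarith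
  have m0: "m > 0" using m1 \<eta> by (cases m) (auto simp: field_simps)
  have p5: "2 ^ n \<le> (1 / \<eta>) ^ n" for n by (rule power_mono) (use y in auto)
  have "real m \<le> (1 / \<eta>) ^ 5 * (1 / \<eta>)"
    by (rule order_trans[OF m2]) (intro mult_right_mono order_trans[OF _ p5[of 5]], use y \<eta> in auto)
  then have mM: "int m \<le> M" using \<eta>(3) by (simp add: power_numeral_reduce)
  have R: "384 * real m ^ 2 \<le> (1 / \<eta>) ^ 20"
  proof -
    have "384 * real m ^ 2 \<le> 384 * (20 * (1 / \<eta>)) ^ 2"
      by (intro mult_left_mono power_mono m2) auto
    also have "\<dots> = 153600 * (1 / \<eta>) ^ 2" by (simp add: power2_eq_square)
    also have "\<dots> \<le> (1 / \<eta>) ^ 18 * (1 / \<eta>) ^ 2"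
      by (intro mult_right_mono order_trans[OF _ p5[of 18]]) auto
    also have "\<dots> = (1 / \<eta>) ^ 20" by (simp flip: power_add)
    finally show ?thesis .
  qed
  let ?bad = "{(a, c) \<in> ?A \<times> ?A. real_of_int M > real m * real_of_int \<bar>a + s'\<bar> \<or> gcd (a + s') (c + s) > int m}"
  have good: "good_pair P M ((1 / \<eta>) ^ 20) (a + s') (c + s)" if "a \<in> ?A" "c \<in> ?A" "(a, c) \<notin> ?bad" for a c
  proof -
    have "P > 0" using P M by (smt (verit) zero_less_power)
    have "good_pair P M (384 * real m ^ 2) (a + s') (c + s)"
      by (rule good_pair_of_gcd[OF M P _ _ m0]) (use that s in \<open>auto simp: diff_range_def not_less\<close>)
    then show ?thesis unfolding good_pair_def
      using R by (meson avg_nonneg mult_right_mono order_trans)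
  qed
  have "avg ?A (\<lambda>a. avg ?A (\<lambda>c. if good_pair P M ((1 / \<eta>) ^ 20) (a + s') (c + s) then 0 else 1))
     = avg (?A \<times> ?A) (\<lambda>(a, c). if good_pair P M ((1 / \<eta>) ^ 20) (a + s') (c + s) then 0 else (1::real))"
    by (simp add: avg_Times)
  also have "\<dots> \<le> avg (?A \<times> ?A) (\<lambda>p. if p \<in> ?bad then 1 else 0)"
  proof (rule avg_mono)
    fix p assume p: "p \<in> ?A \<times> ?A"
    obtain a c where pc: "p = (a, c)" by (cases p)
    show "(case p of (a, c) \<Rightarrow> if good_pair P M ((1 / \<eta>) ^ 20) (a + s') (c + s) then 0 else (1::real))
        \<le> (if p \<in> ?bad then 1 else 0)"
    proof (cases "(a, c) \<in> ?bad")
      case True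
      then show ?thesis by (simp only: pc case_prod_conv if_True) simp
    next
      case False
      then have "good_pair P M ((1 / \<eta>) ^ 20) (a + s') (c + s)" using good p by (simp add: pc)
      then show ?thesis by (simp only: pc case_prod_conv if_True) simp
    qed
  qed
  also have "\<dots> = real (card ?bad) / real (card (?A \<times> ?A))"
  proof -
    have "(\<Sum>p\<in>?A \<times> ?A. if p \<in> ?bad then 1 else (0::real)) = real (card (?A \<times> ?A \<inter> ?bad))"
      by (simp add: sum.If_cases Int_def)
    moreover have "?A \<times> ?A \<inter> ?bad = ?bad" by auto
    ultimately show ?thesis by (simp add: avg_def)
  qed
  also have "\<dots> \<le> 19 / real m"
  proof -
    have "real (card (?A \<times> ?A)) > 0" using diff_range_nonempty[OF M] by (simp add: card_gt_0_iff)
    then show ?thesis unfolding pos_divide_le_eq[OF \<open>real (card (?A \<times> ?A)) > 0\<close>]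
      by (intro bad_pairs_card M s m0 mM)
  qed
  also have "\<dots> \<le> \<eta>" using m1 m0 \<eta> by (simp add: field_simps)
  finally show ?thesis .
qed

section \<open>From short directions to averages over the whole group\<close>

lemma per_norm_avg_D: "per P u \<Longrightarrow> per P (\<lambda>t. norm (avg {0..<P} (D t u)))"
  unfolding per_def[of P "\<lambda>t. norm (avg {0..<P} (D t u))"] by (simp add: per_add_dir)

lemma good_pairD:
  assumes "good_pair P M R a c" "\<And>t. 0 \<le> G t" "per P G"
  shows "avg (diff_range M) (\<lambda>k. avg (diff_range M) (\<lambda>k'. G (2*c*k - 2*a*k'))) \<le> R * avg {0..<P} G"
  using assms unfolding good_pair_def by blast

text \<open>Cauchy--Schwarz over \<open>(c, k)\<close> replaces the single product
  \<open>2 (c + s) k\<close> by a difference of two such products, which is equidistributed for all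
  but a proportion \<open>\<eta>\<close> of the pairs \<open>(c, c')\<close>. Bad pairs are bounded
  trivially by 1.\<close>

lemma direction_averaging:
  fixes P M s :: int and \<eta> :: real
  assumes u: "per P u" "bdd1 u" and M: "M \<ge> 1" and P: "32 * M\<^sup>2 \<le> P" "P \<le> 128 * M\<^sup>2" and s: "\<bar>s\<bar> \<le> M"
    and \<eta>: "0 < \<eta>" "\<eta> \<le> 1 / 2" "(1 / \<eta>) ^ 6 \<le> real_of_int M"
  shows "(avg (diff_range M) (\<lambda>c. avg (diff_range M) (\<lambda>k. norm (avg {0..<P} (D (2*(c+s)*k) u)))))\<^sup>2
    \<le> (1 / \<eta>) ^ 20 * avg {0..<P} (\<lambda>t. norm (avg {0..<P} (D t u))) + \<eta>"
proof -
  let ?A = "diff_range M" and ?X = "{0..<P}"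
  have P0: "P > 0" using P M by (smt (verit) zero_less_power)
  define G where "G = (\<lambda>t. norm (avg ?X (D t u)))"
  have G: "0 \<le> G t" "G t \<le> 1" "per P G" for t
    using u per_norm_avg_D[OF u(1)] by (auto simp: G_def intro!: bdd1_avg_norm)
  define F where "F = (\<lambda>x (c, k). u (x + 2*(c+s)*k))"
  define bad where "bad = (\<lambda>a c. if good_pair P M ((1 / \<eta>) ^ 20) (a + s) (c + s) then 0 else (1::real))"
  have "avg ?A (\<lambda>c. avg ?A (\<lambda>k. norm (avg ?X (D (2*(c+s)*k) u))))
      = avg (?A \<times> ?A) (\<lambda>y. norm (avg ?X (\<lambda>x. cnj (u x) * F x y)))"
    by (simp add: avg_Times F_def D_def mult.commute)
  also have "\<dots>\<^sup>2 \<le> avg (?A \<times> ?A) (\<lambda>y. avg (?A \<times> ?A) (\<lambda>y'. norm (avg ?X (\<lambda>x. F x y * cnj (F x y')))))"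
    by (rule cs_phase) (use u in \<open>auto simp: bdd1_def\<close>)
  also have "\<dots> = avg ?A (\<lambda>c. avg ?A (\<lambda>k. avg ?A (\<lambda>c'. avg ?A (\<lambda>k'. G (2*(c+s)*k - 2*(c'+s)*k')))))"
    by (simp add: avg_Times F_def G_def avg_translates[OF u(1) P0])
  also have "\<dots> = avg ?A (\<lambda>c. avg ?A (\<lambda>c'. avg ?A (\<lambda>k. avg ?A (\<lambda>k'. G (2*(c+s)*k - 2*(c'+s)*k')))))"
    by (rule avg_cong[OF refl], rule avg_swap)
  also have "\<dots> \<le> avg ?A (\<lambda>c. avg ?A (\<lambda>c'. (1 / \<eta>) ^ 20 * avg ?X G + bad c' c))"
  proof (intro avg_mono)
    fix c c'
    have R0: "0 \<le> (1 / \<eta>) ^ 20 * avg ?X G" using \<eta> G by (intro mult_nonneg_nonneg avg_nonneg) auto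
    show "avg ?A (\<lambda>k. avg ?A (\<lambda>k'. G (2*(c+s)*k - 2*(c'+s)*k'))) \<le> (1 / \<eta>) ^ 20 * avg ?X G + bad c' c"
    proof (cases "good_pair P M ((1 / \<eta>) ^ 20) (c' + s) (c + s)")
      case True
      then show ?thesis using good_pairD[OF True G(1,3)] by (simp add: bad_def)
    next
      case False
      have "avg ?A (\<lambda>k. avg ?A (\<lambda>k'. G (2*(c+s)*k - 2*(c'+s)*k'))) \<le> 1"
        by (intro avg_le G) auto
      then show ?thesis using False R0 by (simp add: bad_def)
    qed
  qed
  also have "\<dots> = (1 / \<eta>) ^ 20 * avg ?X G + avg ?A (\<lambda>c. avg ?A (\<lambda>c'. bad c' c))"
    by (simp only: avg_add avg_const[OF finite_diff_range diff_range_nonempty[OF M]])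
  also have "avg ?A (\<lambda>c. avg ?A (\<lambda>c'. bad c' c)) = avg ?A (\<lambda>c'. avg ?A (\<lambda>c. bad c' c))" by (rule avg_swap)
  also have "\<dots> \<le> \<eta>"
    unfolding bad_def by (rule bad_pairs_avg[OF M P s s \<eta>])
  finally show ?thesis by (simp add: G_def)
qed

lemma five: "(5::nat) = Suc (Suc (Suc (Suc (Suc 0))))"
  by simp

text \<open>Equidistribution is applied to the first three directions in turn, at a factor
  \<open>R\<close> each. If one of the three pairs is bad, the trivial bound 1 is paid by its
  \<open>bad\<close> term. The last two directions have only one free parameter for fixed
  \<open>a'\<close>, \<open>b'\<close> and must wait until these are averaged.\<close>

lemma box_avg_le_global:
  fixes P M :: int and h :: "int \<Rightarrow> complex"
  assumes h: "per P h" "bdd1 h" and M: "M \<ge> 1" and P0: "P > 0" and R: "R \<ge> 0"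
  defines "Q \<equiv> \<lambda>t1 t2 t3 t4 t5. norm (avg {0..<P} (Dl [t1, t2, t3, t4, t5] h))"
    and "bad \<equiv> \<lambda>a c. if good_pair P M R a c then 0 else (1::real)"
  shows "box_avg P M h a b a' b' \<le> R ^ 3 * avg {0..<P} (\<lambda>t1. avg {0..<P} (\<lambda>t2. avg {0..<P} (\<lambda>t3.
      avg (diff_range M) (\<lambda>k. avg (diff_range M) (\<lambda>k'. Q t1 t2 t3 (2*b'*k) (2*(b'-a')*k'))))))
    + (bad a' a + bad a' b + bad a' (a + b))"
proof -
  let ?A = "diff_range M" and ?X = "{0..<P}" and ?K = "diff_range M \<times> diff_range M"
  have K: "finite ?K" "?K \<noteq> {}" using diff_range_nonempty[OF M] by auto
  have Q: "0 \<le> Q t1 t2 t3 t4 t5" "Q t1 t2 t3 t4 t5 \<le> 1" for t1 t2 t3 t4 t5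
    unfolding Q_def by (rule norm_ge_zero, rule bdd1_avg_norm[OF bdd1_Dl[OF h(2)]])
  have Qper: "Q (t1 + P) t2 t3 t4 t5 = Q t1 t2 t3 t4 t5" "Q t1 (t2 + P) t3 t4 t5 = Q t1 t2 t3 t4 t5"
    "Q t1 t2 (t3 + P) t4 t5 = Q t1 t2 t3 t4 t5" for t1 t2 t3 t4 t5
    unfolding Q_def Dl.simps using h by (simp_all add: per_add_dir per_D)
  define S where "S = (\<lambda>t1 t2 t3. avg ?A (\<lambda>k. avg ?A (\<lambda>k'. Q t1 t2 t3 (2*b'*k) (2*(b'-a')*k'))))"
  have S0: "0 \<le> S t1 t2 t3" for t1 t2 t3 unfolding S_def by (intro avg_nonneg Q)
  have S1: "S t1 t2 t3 \<le> 1" for t1 t2 t3 unfolding S_def by (intro avg_le Q) auto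
  have Sper: "S (t1 + P) t2 t3 = S t1 t2 t3" "S t1 (t2 + P) t3 = S t1 t2 t3" "S t1 t2 (t3 + P) = S t1 t2 t3" for t1 t2 t3
    unfolding S_def by (simp_all only: Qper)
  have "box_avg P M h a b a' b' = avg ?K (\<lambda>p1. avg ?K (\<lambda>p2. avg ?K (\<lambda>p3. avg ?K (\<lambda>p4. avg ?K (\<lambda>p5.
     Q (case p1 of (k, k') \<Rightarrow> 2*a*k - 2*a'*k') (case p2 of (k, k') \<Rightarrow> 2*b*k - 2*a'*k')
       (case p3 of (k, k') \<Rightarrow> 2*(a+b)*k - 2*a'*k') (case p4 of (k, k') \<Rightarrow> 2*b'*k') (case p5 of (k, k') \<Rightarrow> 2*(b'-a')*k'))))))"
    unfolding box_avg_def Q_def 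
    by (simp only: five avg_tup_Suc tup_0 avg_singleton zip_Cons_Cons zip_Nil list.map case_prod_conv)
  also have "\<dots> = avg ?A (\<lambda>k1. avg ?A (\<lambda>k1'. avg ?A (\<lambda>k2. avg ?A (\<lambda>k2'. avg ?A (\<lambda>k3. avg ?A (\<lambda>k3'.
      S (2*a*k1 - 2*a'*k1') (2*b*k2 - 2*a'*k2') (2*(a+b)*k3 - 2*a'*k3')))))))"
    unfolding S_def by (simp only: avg_Times case_prod_conv avg_const[OF finite_diff_range diff_range_nonempty[OF M]])
  also have "\<dots> \<le> R ^ 3 * avg ?X (\<lambda>t1. avg ?X (\<lambda>t2. avg ?X (\<lambda>t3. S t1 t2 t3))) + (bad a' a + bad a' b + bad a' (a + b))"
    (is "?L \<le> R ^ 3 * ?G + ?bad")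
  proof (cases "good_pair P M R a' a \<and> good_pair P M R a' b \<and> good_pair P M R a' (a + b)")
    case True
    then have g: "good_pair P M R a' a" "good_pair P M R a' b" "good_pair P M R a' (a + b)" by auto
    have "?L \<le> R * avg ?X (\<lambda>t1. avg ?A (\<lambda>k2. avg ?A (\<lambda>k2'. avg ?A (\<lambda>k3. avg ?A (\<lambda>k3'.
      S t1 (2*b*k2 - 2*a'*k2') (2*(a+b)*k3 - 2*a'*k3'))))))"
      by (rule good_pairD[OF g(1)]) (auto intro!: avg_nonneg S0 simp: per_def Sper)
    also have "\<dots> \<le> R * avg ?X (\<lambda>t1. R * avg ?X (\<lambda>t2. avg ?A (\<lambda>k3. avg ?A (\<lambda>k3'.
      S t1 t2 (2*(a+b)*k3 - 2*a'*k3')))))"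
      by (intro mult_left_mono avg_mono good_pairD[OF g(2)] R) (auto intro!: avg_nonneg S0 simp: per_def Sper)
    also have "\<dots> \<le> R * avg ?X (\<lambda>t1. R * avg ?X (\<lambda>t2. R * avg ?X (\<lambda>t3. S t1 t2 t3)))"
      by (intro mult_left_mono avg_mono good_pairD[OF g(3)] R) (auto intro!: avg_nonneg S0 simp: per_def Sper)
    also have "\<dots> = R ^ 3 * ?G" by (simp add: avg_mult_left power3_eq_cube)
    finally show ?thesis using True by (simp add: bad_def)
  next
    case False
    have "?L \<le> 1" by (intro avg_le S1) auto
    moreover have "1 \<le> ?bad" using False by (auto simp: bad_def)
    moreover have "0 \<le> R ^ 3 * ?G" using R by (intro mult_nonneg_nonneg avg_nonneg S0) auto
    ultimately show ?thesis by linarith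
  qed
  finally show ?thesis by (simp only: S_def)
qed

text \<open>The bookkeeping of every averaging step:
  \<open>4 * \<eta> \<le> \<delta> ^ j \<le> Y\<close>, so after subtraction of the error
  \<open>3 * \<eta>\<close> at least \<open>\<eta>\<close> is left for the main term.\<close>

lemma inverse_power_step:
  fixes \<delta> \<eta> c Y Z :: real
  assumes \<delta>: "0 < \<delta>" "\<delta> \<le> 1 / 2" and Y: "\<delta> ^ j \<le> Y" and le: "Y \<le> (1 / \<eta>) ^ n * Z + 3 * \<eta>" and \<eta>: "\<eta> = \<delta> ^ (j + 3)"
  shows "\<delta> ^ ((n + 1) * (j + 3)) \<le> Z"
proof -
  have \<eta>0: "\<eta> > 0" using \<delta> by (simp add: \<eta>)
  have "\<delta> ^ 3 \<le> (1 / 2) ^ 3" by (rule power_mono) (use \<delta> in auto)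
  then have "4 * \<delta> ^ 3 \<le> 1" by (simp add: power3_eq_cube)
  then have "4 * \<eta> \<le> \<delta> ^ j"
    using mult_left_mono[of "4 * \<delta> ^ 3" 1 "\<delta> ^ j"] \<delta> by (simp add: \<eta> power_add)
  then have "\<eta> \<le> (1 / \<eta>) ^ n * Z" using Y le by linarith
  then have "\<eta> ^ n * \<eta> \<le> \<eta> ^ n * ((1 / \<eta>) ^ n * Z)" by (rule mult_left_mono) (use \<eta>0 in simp)
  also have "\<dots> = Z" using \<eta>0 by (simp add: power_divide)
  finally have "\<eta> ^ (n + 1) \<le> Z" by (simp add: mult.commute)
  then show ?thesis by (simp only: \<eta> power_mult[symmetric] mult.commute)
qed

lemma pow_half_le:
  fixes \<delta> :: real
  assumes "0 < \<delta>" "\<delta> \<le> 1 / 2" "n \<ge> 1" shows "\<delta> ^ n \<le> 1 / 2"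
proof -
  have "\<delta> ^ n \<le> \<delta> ^ 1" by (rule power_decreasing) (use assms in auto)
  then show ?thesis using assms by simp
qed

text \<open>The averages \<open>norm (avg {0..<P} (Dl ts F)) ^ 2\<close> over \<open>ts\<close> of length \<open>k\<close>
  form the \<open>2^(k+1)\<close>-th power of the Gowers norm of order \<open>k + 1\<close>.\<close>
definition gowers :: "int \<Rightarrow> nat \<Rightarrow> (int \<Rightarrow> complex) \<Rightarrow> real" where
  "gowers P k F = avg (tup {0..<P} k) (\<lambda>ts. (norm (avg {0..<P} (Dl ts F)))\<^sup>2)"

lemma gowers_control:
  "\<exists>k\<ge>1. \<forall>(\<delta>::real) P M f g h. 0 < \<delta> \<longrightarrow> \<delta> \<le> 1 / 2 \<longrightarrow> (1 / \<delta>) ^ k \<le> real_of_int M \<longrightarrow>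
     32 * M\<^sup>2 \<le> P \<longrightarrow> P \<le> 128 * M\<^sup>2 \<longrightarrow> bdd1 f \<longrightarrow> per P g \<longrightarrow> bdd1 g \<longrightarrow> per P h \<longrightarrow> bdd1 h \<longrightarrow>
     \<delta> \<le> norm (roth P M f g h) \<longrightarrow> \<delta> ^ k \<le> gowers P 5 h"
proof -
  \<comment> \<open>\<open>e1 = 256 + 256\<close>: the second 256 absorbs the constant
    \<open>8 ^ 64 * 4 ^ 32 = 2 ^ 256\<close>. The others come from
    \<open>inverse_power_step\<close>, with \<open>n = 60\<close> for three factors
    \<open>(1 / \<eta>) ^ 20\<close>, then \<open>n = 20\<close> after a squaring. \<open>k\<close>
    dominates every lower bound required of \<open>M\<close>.\<close>
  define e1 e2 e3 e4 :: nat where "e1 = 512" and "e2 = 61 * (e1 + 3)" and "e3 = 21 * (2 * e2 + 3)" and "e4 = 21 * (2 * e3 + 3)"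
  define k where "k = 6 * (e1 + 3) + 6 * (2 * e2 + 3) + 6 * (2 * e3 + 3) + 2 * e4"
  have k0: "k \<ge> 1" by (simp add: k_def)
  have "\<delta> ^ k \<le> gowers P 5 h"
    if \<delta>: "0 < \<delta>" "\<delta> \<le> 1 / 2" and Mk: "(1 / \<delta>) ^ k \<le> real_of_int M" and P: "32 * M\<^sup>2 \<le> P" "P \<le> 128 * M\<^sup>2"
      and f: "bdd1 f" and g: "per P g" "bdd1 g" and h: "per P h" "bdd1 h" and large: "\<delta> \<le> norm (roth P M f g h)"
    for \<delta> :: real and P M f g h
  proof -
    let ?A = "diff_range M" and ?X = "{0..<P}"
    have y: "1 / \<delta> \<ge> 1" using \<delta> by (simp add: field_simps)
    have "1 \<le> (1 / \<delta>) ^ k" using y by (rule one_le_power)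
    then have M: "M \<ge> 1" using Mk by linarith
    have P0: "P > 0" using P M by (smt (verit) zero_less_power)
    have X: "finite ?X" "?X \<noteq> {}" using P0 by auto
    note A = finite_diff_range[of M] diff_range_nonempty[OF M]
    have Mpow: "(1 / \<delta> ^ j) ^ 6 \<le> real_of_int M" if "6 * j \<le> k" for j
    proof -
      have "(1 / \<delta> ^ j) ^ 6 = (1 / \<delta>) ^ (6 * j)" by (simp add: power_divide power_mult[symmetric] mult.commute)
      also have "\<dots> \<le> (1 / \<delta>) ^ k" by (rule power_increasing) (use that y in auto)
      finally show ?thesis using Mk by simp
    qed
    define Q where "Q = (\<lambda>t1 t2 t3 t4 t5. norm (avg ?X (Dl [t1, t2, t3, t4, t5] h)))"
    have Q0: "0 \<le> Q t1 t2 t3 t4 t5" for t1 t2 t3 t4 t5 by (simp add: Q_def)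
    define T where "T = norm (avg ?A (\<lambda>a. avg ?A (\<lambda>b. avg {1..M} (\<lambda>y. pet_weight M a b y *
      avg ?X (\<lambda>x. h x * cnj (h (x + 2*a*y + a\<^sup>2)) * cnj (h (x + 2*b*y + (b\<^sup>2 - b)))
        * h (x + 2*(a+b)*y + ((a+b)\<^sup>2 - b)))))))"
    define B where "B = avg ?A (\<lambda>a. avg ?A (\<lambda>b. avg ?A (\<lambda>a'. avg ?A (\<lambda>b'. box_avg P M h a b a' b'))))"
    have "\<delta> ^ 256 = (\<delta> ^ 4) ^ 64" by (simp flip: power_mult)
    also have "\<dots> \<le> (8 * T) ^ 64"
    proof (rule power_mono)
      have "\<delta> ^ 4 \<le> norm (roth P M f g h) ^ 4" by (rule power_mono[OF large]) (use \<delta> in simp)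
      also have "\<dots> \<le> 8 * T" unfolding T_def by (rule pet_differencing[OF f g h P0 M])
      finally show "\<delta> ^ 4 \<le> 8 * T" .
    qed (use \<delta> in simp)
    also have "\<dots> = 8 ^ 64 * T ^ 64" by (simp only: power_mult_distrib)
    also have "\<dots> \<le> 8 ^ 64 * (4 ^ 32 * B)"
      unfolding T_def B_def by (intro mult_left_mono pet_doubling[OF h P0 M]) simp
    finally have "\<delta> ^ 256 \<le> 2 ^ 256 * B" by simp
    then have "\<delta> ^ 256 * (1 / 2) ^ 256 \<le> B" by (simp add: power_divide field_simps)
    moreover have "\<delta> ^ 256 * \<delta> ^ 256 \<le> \<delta> ^ 256 * (1 / 2) ^ 256"
      by (intro mult_left_mono power_mono) (use \<delta> in auto)
    ultimately have B: "\<delta> ^ e1 \<le> B" by (simp add: e1_def flip: power_add)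
    \<comment> \<open>for most quadruples the three directions involving two parameters equidistribute modulo \<open>P\<close>\<close>
    define \<eta>1 where "\<eta>1 = \<delta> ^ (e1 + 3)"
    have k1: "6 * (e1 + 3) \<le> k" "e1 + 3 \<ge> 1" by (simp_all add: k_def)
    have \<eta>1: "0 < \<eta>1" "\<eta>1 \<le> 1 / 2" "(1 / \<eta>1) ^ 6 \<le> real_of_int M"
      unfolding \<eta>1_def by (rule zero_less_power[OF \<delta>(1)], rule pow_half_le[OF \<delta> k1(2)], rule Mpow[OF k1(1)])
    define R where "R = (1 / \<eta>1) ^ 20"
    define bad where "bad = (\<lambda>a c. if good_pair P M R a c then 0 else (1::real))"
    define S where "S = (\<lambda>a' b'. avg ?X (\<lambda>t1. avg ?X (\<lambda>t2. avg ?X (\<lambda>t3.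
        avg ?A (\<lambda>k. avg ?A (\<lambda>k'. Q t1 t2 t3 (2*b'*k) (2*(b'-a')*k')))))))"
    have "B \<le> avg ?A (\<lambda>a. avg ?A (\<lambda>b. avg ?A (\<lambda>a'. avg ?A (\<lambda>b'.
        R ^ 3 * S a' b' + (bad a' a + bad a' b + bad a' (a + b))))))"
      unfolding B_def S_def Q_def bad_def
      by (intro avg_mono box_avg_le_global[OF h M P0]) (use \<eta>1 in \<open>simp add: R_def\<close>)
    also have "\<dots> = R ^ 3 * avg ?A (\<lambda>a'. avg ?A (\<lambda>b'. S a' b'))
       + (avg ?A (\<lambda>a. avg ?A (\<lambda>a'. bad a' a)) + avg ?A (\<lambda>b. avg ?A (\<lambda>a'. bad a' b))
          + avg ?A (\<lambda>a. avg ?A (\<lambda>b. avg ?A (\<lambda>a'. bad a' (a + b)))))"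
      by (simp only: avg_add avg_const[OF A] avg_mult_left)
    also have "\<dots> \<le> R ^ 3 * avg ?A (\<lambda>a'. avg ?A (\<lambda>b'. S a' b')) + 3 * \<eta>1"
    proof -
      have bs: "avg ?A (\<lambda>c. avg ?A (\<lambda>a'. bad a' (c + s))) \<le> \<eta>1" if "\<bar>s\<bar> \<le> M" for s
      proof -
        have "avg ?A (\<lambda>a'. avg ?A (\<lambda>c. bad a' (c + s))) \<le> \<eta>1"
          using bad_pairs_avg[OF M P that _ \<eta>1, of 0] M by (simp add: bad_def R_def)
        then show ?thesis by (subst avg_swap)
      qed
      have "avg ?A (\<lambda>a. avg ?A (\<lambda>b. avg ?A (\<lambda>a'. bad a' (a + b)))) \<le> \<eta>1"
      proof (rule avg_le)
        fix a assume "a \<in> ?A"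
        then have "\<bar>a\<bar> \<le> M" by (auto simp: diff_range_def)
        from bs[OF this] show "avg ?A (\<lambda>b. avg ?A (\<lambda>a'. bad a' (a + b))) \<le> \<eta>1" by (simp add: add.commute)
      qed (use \<eta>1 in simp)
      moreover have "avg ?A (\<lambda>a. avg ?A (\<lambda>a'. bad a' a)) \<le> \<eta>1" using bs[of 0] M by simp
      ultimately show ?thesis by linarith
    qed
    finally have "B \<le> (1 / \<eta>1) ^ 60 * avg ?A (\<lambda>a'. avg ?A (\<lambda>b'. S a' b')) + 3 * \<eta>1"
      by (simp add: R_def flip: power_mult)
    from inverse_power_step[OF \<delta> B this \<eta>1_def]
    have S: "\<delta> ^ e2 \<le> avg ?A (\<lambda>a'. avg ?A (\<lambda>b'. S a' b'))" by (simp add: e2_def)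
    \<comment> \<open>for fixed \<open>b'\<close>, one more Cauchy--Schwarz doubles \<open>a'\<close> and makes the direction \<open>2 (b' - a') k'\<close> global\<close>
    define \<eta>2 where "\<eta>2 = \<delta> ^ (2 * e2 + 3)"
    have k2: "6 * (2 * e2 + 3) \<le> k" "2 * e2 + 3 \<ge> 1" by (simp_all add: k_def)
    have \<eta>2: "0 < \<eta>2" "\<eta>2 \<le> 1 / 2" "(1 / \<eta>2) ^ 6 \<le> real_of_int M"
      unfolding \<eta>2_def by (rule zero_less_power[OF \<delta>(1)], rule pow_half_le[OF \<delta> k2(2)], rule Mpow[OF k2(1)])
    \<comment> \<open>\<open>diff_range\<close> is symmetric, so \<open>b' - a'\<close> with
      \<open>a'\<close> averaged has the form \<open>c + b'\<close> required by
      \<open>direction_averaging\<close> with shift \<open>b'\<close>.\<close>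
    have neg: "avg ?A (\<lambda>a'. G (b - a')) = avg ?A (\<lambda>c. G (c + b))" for b :: int and G :: "int \<Rightarrow> real"
    proof -
      have "(\<Sum>a'\<in>?A. G (b - a')) = (\<Sum>c\<in>?A. G (c + b))"
        by (rule sum.reindex_bij_witness[of _ uminus uminus]) (auto simp: diff_range_def)
      then show ?thesis by (simp add: avg_def)
    qed
    define Y where "Y = ?X \<times> ?X \<times> ?X \<times> ?A \<times> ?A"
    define W where "W = (\<lambda>(t1, t2, t3, b', k). avg ?A (\<lambda>c. avg ?A (\<lambda>k'. Q t1 t2 t3 (2*b'*k) (2*(c+b')*k'))))"
    define V where "V = (\<lambda>(t1, t2, t3, b', k). avg ?X (\<lambda>t. Q t1 t2 t3 (2*b'*k) t))"
    have SY: "avg ?A (\<lambda>a'. avg ?A (\<lambda>b'. S a' b')) = avg Y W"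
    proof -
      have "avg ?A (\<lambda>a'. avg ?A (\<lambda>b'. S a' b')) = avg ?A (\<lambda>b'. avg ?A (\<lambda>a'. S a' b'))" by (rule avg_swap)
      also have "\<dots> = avg ?A (\<lambda>b'. avg ?A (\<lambda>a'. avg ?X (\<lambda>t1. avg ?X (\<lambda>t2. avg ?X (\<lambda>t3.
         avg ?A (\<lambda>k. avg ?A (\<lambda>k'. Q t1 t2 t3 (2*b'*k) (2*(b'-a')*k'))))))))"
        by (simp only: S_def)
      also have "\<dots> = avg ?A (\<lambda>b'. avg (?X \<times> ?X \<times> ?X \<times> ?A) (\<lambda>(t1, t2, t3, k). avg ?A (\<lambda>a'.
         avg ?A (\<lambda>k'. Q t1 t2 t3 (2*b'*k) (2*(b'-a')*k')))))"
      proof (rule avg_cong[OF refl])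
        fix b'
        have "avg ?A (\<lambda>a'. avg (?X \<times> ?X \<times> ?X \<times> ?A) (\<lambda>q. case q of (t1, t2, t3, k) \<Rightarrow>
           avg ?A (\<lambda>k'. Q t1 t2 t3 (2*b'*k) (2*(b'-a')*k'))))
          = avg (?X \<times> ?X \<times> ?X \<times> ?A) (\<lambda>q. avg ?A (\<lambda>a'. case q of (t1, t2, t3, k) \<Rightarrow>
           avg ?A (\<lambda>k'. Q t1 t2 t3 (2*b'*k) (2*(b'-a')*k'))))" by (rule avg_swap)
        then show "avg ?A (\<lambda>a'. avg ?X (\<lambda>t1. avg ?X (\<lambda>t2. avg ?X (\<lambda>t3.
         avg ?A (\<lambda>k. avg ?A (\<lambda>k'. Q t1 t2 t3 (2*b'*k) (2*(b'-a')*k')))))))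
         = avg (?X \<times> ?X \<times> ?X \<times> ?A) (\<lambda>(t1, t2, t3, k). avg ?A (\<lambda>a'.
         avg ?A (\<lambda>k'. Q t1 t2 t3 (2*b'*k) (2*(b'-a')*k'))))"
          by (simp only: avg_Times case_prod_conv)
      qed
      also have "\<dots> = avg ?A (\<lambda>b'. avg (?X \<times> ?X \<times> ?X \<times> ?A) (\<lambda>(t1, t2, t3, k). W (t1, t2, t3, b', k)))"
        by (simp only: neg[where G = "\<lambda>c. avg ?A (\<lambda>k'. Q _ _ _ _ (2*c*k'))"] W_def case_prod_conv)
      also have "\<dots> = avg (?X \<times> ?X \<times> ?X \<times> ?A) (\<lambda>q. avg ?A (\<lambda>b'. case q of (t1, t2, t3, k) \<Rightarrow> W (t1, t2, t3, b', k)))"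
        by (rule avg_swap)
      also have "\<dots> = avg ?X (\<lambda>t1. avg ?X (\<lambda>t2. avg ?X (\<lambda>t3. avg ?A (\<lambda>k. avg ?A (\<lambda>b'. W (t1, t2, t3, b', k))))))"
        by (simp only: avg_Times case_prod_conv)
      also have "\<dots> = avg ?X (\<lambda>t1. avg ?X (\<lambda>t2. avg ?X (\<lambda>t3. avg ?A (\<lambda>b'. avg ?A (\<lambda>k. W (t1, t2, t3, b', k))))))"
        by (rule avg_cong[OF refl], rule avg_cong[OF refl], rule avg_cong[OF refl], rule avg_swap)
      also have "\<dots> = avg Y W" by (simp only: Y_def avg_Times)
      finally show ?thesis .
    qed
    have WV: "(W q)\<^sup>2 \<le> (1 / \<eta>2) ^ 20 * V q + \<eta>2" if "q \<in> Y" for q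
    proof -
      obtain t1 t2 t3 b' k where q: "q = (t1, t2, t3, b', k)" by (cases q)
      have b': "\<bar>b'\<bar> \<le> M" using that by (auto simp: q Y_def diff_range_def)
      have "per P (Dl [t1, t2, t3, 2*b'*k] h)" "bdd1 (Dl [t1, t2, t3, 2*b'*k] h)"
        by (rule per_Dl[OF h(1)], rule bdd1_Dl[OF h(2)])
      from direction_averaging[OF this M P b' \<eta>2]
      show ?thesis unfolding q W_def V_def Q_def by simp
    qed
    have "(avg Y W)\<^sup>2 \<le> avg Y (\<lambda>q. (W q)\<^sup>2)" by (rule avg_power2_le)
    also have "\<dots> \<le> avg Y (\<lambda>q. (1 / \<eta>2) ^ 20 * V q + \<eta>2)" by (rule avg_mono[OF WV])
    also have "\<dots> = (1 / \<eta>2) ^ 20 * avg Y V + \<eta>2"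
      using X A by (simp add: avg_add avg_mult_left Y_def avg_const)
    finally have YV: "(avg Y W)\<^sup>2 \<le> (1 / \<eta>2) ^ 20 * avg Y V + 3 * \<eta>2" using \<eta>2 by linarith
    have "\<delta> ^ (2 * e2) \<le> (avg Y W)\<^sup>2"
      using power_mono[OF S, of 2] \<delta> by (simp add: SY mult.commute[of 2] power_mult)
    from inverse_power_step[OF \<delta> this YV \<eta>2_def]
    have V: "\<delta> ^ e3 \<le> avg Y V" by (simp add: e3_def)
    \<comment> \<open>Now \<open>b'\<close> and \<open>k\<close> are averaged, with shift 0, and the
      last short direction \<open>2 b' k\<close> becomes global too.\<close>
    define \<eta>3 where "\<eta>3 = \<delta> ^ (2 * e3 + 3)"
    have k3: "6 * (2 * e3 + 3) \<le> k" "2 * e3 + 3 \<ge> 1" by (simp_all add: k_def)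
    have \<eta>3: "0 < \<eta>3" "\<eta>3 \<le> 1 / 2" "(1 / \<eta>3) ^ 6 \<le> real_of_int M"
      unfolding \<eta>3_def by (rule zero_less_power[OF \<delta>(1)], rule pow_half_le[OF \<delta> k3(2)], rule Mpow[OF k3(1)])
    define Y' where "Y' = ?X \<times> ?X \<times> ?X \<times> ?X"
    define W' where "W' = (\<lambda>(t1, t2, t3, t). avg ?A (\<lambda>b'. avg ?A (\<lambda>k. Q t1 t2 t3 t (2*b'*k))))"
    define V' where "V' = (\<lambda>(t1, t2, t3, t). avg ?X (\<lambda>t'. Q t1 t2 t3 t t'))"
    \<comment> \<open>The remaining short direction has to be the last derivative for
      \<open>direction_averaging\<close> to apply.\<close>
    have Qc: "Q t1 t2 t3 s t = Q t1 t2 t3 t s" for t1 t2 t3 s t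
      by (simp add: Q_def D_commute[of s t])
    have VY: "avg Y V = avg Y' W'"
    proof -
      have "avg Y V = avg ?X (\<lambda>t1. avg ?X (\<lambda>t2. avg ?X (\<lambda>t3. avg (?A \<times> ?A) (\<lambda>p. avg ?X (\<lambda>t.
          case p of (b', k) \<Rightarrow> Q t1 t2 t3 t (2*b'*k))))))"
        by (simp only: Y_def V_def avg_Times case_prod_conv Qc[of _ _ _ "2 * _ * _"])
      also have "\<dots> = avg ?X (\<lambda>t1. avg ?X (\<lambda>t2. avg ?X (\<lambda>t3. avg ?X (\<lambda>t. avg (?A \<times> ?A) (\<lambda>p.
          case p of (b', k) \<Rightarrow> Q t1 t2 t3 t (2*b'*k))))))"
        by (intro avg_cong[OF refl]) (rule avg_swap)
      also have "\<dots> = avg Y' W'" by (simp only: Y'_def W'_def avg_Times case_prod_conv)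
      finally show ?thesis .
    qed
    have WV': "(W' q)\<^sup>2 \<le> (1 / \<eta>3) ^ 20 * V' q + \<eta>3" if "q \<in> Y'" for q
    proof -
      obtain t1 t2 t3 t where q: "q = (t1, t2, t3, t)" by (cases q)
      have s: "\<bar>0::int\<bar> \<le> M" using M by simp
      have "per P (Dl [t1, t2, t3, t] h)" "bdd1 (Dl [t1, t2, t3, t] h)"
        by (rule per_Dl[OF h(1)], rule bdd1_Dl[OF h(2)])
      from direction_averaging[OF this M P s \<eta>3]
      show ?thesis unfolding q W'_def V'_def Q_def by simp
    qed
    have "(avg Y' W')\<^sup>2 \<le> avg Y' (\<lambda>q. (W' q)\<^sup>2)" by (rule avg_power2_le)
    also have "\<dots> \<le> avg Y' (\<lambda>q. (1 / \<eta>3) ^ 20 * V' q + \<eta>3)" by (rule avg_mono[OF WV'])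
    also have "\<dots> = (1 / \<eta>3) ^ 20 * avg Y' V' + \<eta>3"
      using X by (simp add: avg_add avg_mult_left Y'_def avg_const)
    finally have YV': "(avg Y' W')\<^sup>2 \<le> (1 / \<eta>3) ^ 20 * avg Y' V' + 3 * \<eta>3" using \<eta>3 by linarith
    have "\<delta> ^ (2 * e3) \<le> (avg Y' W')\<^sup>2"
      using power_mono[OF V, of 2] \<delta> by (simp add: VY mult.commute[of 2] power_mult)
    from inverse_power_step[OF \<delta> this YV' \<eta>3_def]
    have V': "\<delta> ^ e4 \<le> avg Y' V'" by (simp add: e4_def)
    have "avg Y' V' = avg (tup ?X 5) (\<lambda>ts. norm (avg ?X (Dl ts h)))"
      by (simp only: Y'_def V'_def Q_def avg_Times case_prod_conv five avg_tup_Suc tup_0 avg_singleton)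
    then have "(\<delta> ^ e4)\<^sup>2 \<le> (avg (tup ?X 5) (\<lambda>ts. norm (avg ?X (Dl ts h))))\<^sup>2"
      using V' \<delta> by (intro power_mono) auto
    also have "\<dots> \<le> gowers P 5 h" unfolding gowers_def by (rule avg_power2_le)
    finally have "\<delta> ^ (2 * e4) \<le> gowers P 5 h" by (simp add: mult.commute[of 2] power_mult)
    moreover have "\<delta> ^ k \<le> \<delta> ^ (2 * e4)"
      by (rule power_decreasing) (use \<delta> in \<open>auto simp: k_def\<close>)
    ultimately show ?thesis by simp
  qed
  with k0 show ?thesis by blast
qed

section \<open>Exponential sums and major arcs\<close>

lemma e_add: "e (a + b) = e a * e b"
  by (simp add: e_def ring_distribs exp_add)

lemma norm_e [simp]: "norm (e a) = 1"
proof -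
  have "e a = exp (\<i> * complex_of_real (2 * pi * a))" by (simp add: e_def mult_ac)
  then show ?thesis by (simp only: norm_exp_i_times)
qed

lemma e_of_int [simp]: "e (of_int n) = 1"
  unfolding e_def using exp_integer_2pi[of "of_int n"] by (simp add: mult_ac)

lemma e_0 [simp]: "e 0 = 1"
  by (simp add: e_def)

lemma cnj_e: "cnj (e a) = e (- a)"
  by (simp add: e_def exp_cnj)

section \<open>Distance to the nearest integer\<close>

abbreviation (input) "nd \<equiv> nearest_int_dist"

lemma nd_nonneg [simp]: "0 \<le> nd x"
  by (simp add: nearest_int_dist_def)

lemma nd_le: "nd x \<le> \<bar>x - of_int n\<bar>"
  unfolding nearest_int_dist_def by (rule round_diff_minimal)

lemma nd_le_half: "nd x \<le> 1 / 2"
  unfolding nearest_int_dist_def using of_int_round_abs_le[of x] by (simp add: abs_minus_commute)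

lemma nd_witness: "\<exists>n. nd x = \<bar>x - of_int n\<bar>"
  by (auto simp: nearest_int_dist_def)

lemma nd_minus [simp]: "nd (- x) = nd x"
proof -
  have "nd (- x) \<le> nd x" for x
  proof -
    obtain n where "nd x = \<bar>x - of_int n\<bar>" using nd_witness by blast
    with nd_le[of "- x" "- n"] show ?thesis by (simp add: abs_minus_commute)
  qed
  from this[of x] this[of "- x"] show ?thesis by simp
qed

lemma nd_add: "nd (x + y) \<le> nd x + nd y"
proof -
  obtain n m where "nd x = \<bar>x - of_int n\<bar>" "nd y = \<bar>y - of_int m\<bar>" using nd_witness by metis
  with nd_le[of "x + y" "n + m"] show ?thesis by simp
qed

lemma nd_diff: "nd (x - y) \<le> nd x + nd y"
  using nd_add[of x "- y"] by simp

lemma nd_add_int: "nd (x + of_int n) = nd x"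
proof -
  have "nd (x + of_int n) \<le> nd x" for x n
  proof -
    obtain m where "nd x = \<bar>x - of_int m\<bar>" using nd_witness by blast
    with nd_le[of "x + of_int n" "m + n"] show ?thesis by simp
  qed
  from this[of x n] this[of "x + of_int n" "- n"] show ?thesis by simp
qed

lemma nd_eq_abs: "\<bar>x\<bar> \<le> 1 / 2 \<Longrightarrow> nd x = \<bar>x\<bar>"
proof (rule antisym)
  assume x: "\<bar>x\<bar> \<le> 1 / 2"
  show "nd x \<le> \<bar>x\<bar>" using nd_le[of x 0] by simp
  obtain n where n: "nd x = \<bar>x - of_int n\<bar>" using nd_witness by blast
  show "\<bar>x\<bar> \<le> nd x"
  proof (cases "n = 0")
    case False
    then have "1 \<le> \<bar>real_of_int n\<bar>" by linarith
    then show ?thesis using x n by linarith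
  qed (simp add: n)
qed

lemma nd_mult_nat: "nd (of_int n * x) \<le> \<bar>of_int n\<bar> * nd x"
proof -
  obtain m where m: "nd x = \<bar>x - of_int m\<bar>" using nd_witness by blast
  have "nd (of_int n * x) \<le> \<bar>of_int n * x - of_int (n * m)\<bar>" by (rule nd_le)
  also have "\<dots> = \<bar>of_int n\<bar> * \<bar>x - of_int m\<bar>" by (simp add: abs_mult[symmetric] right_diff_distrib)
  finally show ?thesis by (simp add: m)
qed

text \<open>The cubic Taylor bound gives \<open>sin t \<ge> t - t ^ 3 / 6 \<ge> t / 3\<close> for
  \<open>0 \<le> t \<le> 2\<close>, and \<open>t = pi * x\<close> is at least
  \<open>3 * x\<close>.\<close>

lemma abs_le_abs_sin_pi:
  assumes "\<bar>x\<bar> \<le> 1 / 2" shows "\<bar>x\<bar> \<le> \<bar>sin (pi * x)\<bar>"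
proof -
  have pos: "x \<le> sin (pi * x)" if "0 \<le> x" "x \<le> 1 / 2" for x :: real
  proof -
    define t where "t = pi * x"
    have t: "0 \<le> t" "t \<le> 2" unfolding t_def using that pi_less_4
      by (auto intro: order_trans[OF mult_mono[of pi 4 x "1/2"]])
    have "\<bar>sin t - (\<Sum>m<3. sin_coeff m * t ^ m)\<bar> \<le> inverse (fact 3) * \<bar>t\<bar> ^ 3"
      by (rule Maclaurin_sin_bound)
    moreover have "(\<Sum>m<3. sin_coeff m * t ^ m) = t" by (simp add: eval_nat_numeral sin_coeff_def)
    moreover have "inverse (fact 3 :: real) * \<bar>t\<bar> ^ 3 = t * t\<^sup>2 / 6"
      using t by (simp add: fact_numeral power3_eq_cube power2_eq_square)
    ultimately have "t - t * t\<^sup>2 / 6 \<le> sin t" by linarith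
    moreover have "t\<^sup>2 \<le> 2\<^sup>2" using t by (intro power_mono)
    then have "t * t\<^sup>2 \<le> t * 4" using t by (intro mult_left_mono) auto
    ultimately have "t / 3 \<le> sin t" by linarith
    moreover have "x \<le> t / 3" using pi_gt3 that mult_right_mono[of 3 pi x] by (simp add: t_def)
    ultimately show ?thesis by (simp add: t_def)
  qed
  show ?thesis using pos[of x] pos[of "- x"] assms by (cases "0 \<le> x") auto
qed

lemma norm_e_minus_1_eq: "norm (e z - 1) = 2 * \<bar>sin (pi * z)\<bar>"
proof -
  have "(norm (e z - 1))\<^sup>2 = (cos (2*pi*z) - 1)\<^sup>2 + (sin (2*pi*z))\<^sup>2"
  proof -
    have "e z = Complex (cos (2*pi*z)) (sin (2*pi*z))"
      by (simp add: e_def exp_eq_polar cis.code complex_eq_iff Re_exp Im_exp)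
    then show ?thesis by (simp add: cmod_def)
  qed
  also have "\<dots> = 2 - 2 * cos (2 * (pi*z))" using sin_cos_squared_add[of "2*pi*z"]
    by (simp add: power2_eq_square algebra_simps)
  also have "\<dots> = (2 * sin (pi*z))\<^sup>2" by (simp add: cos_double_sin power2_eq_square)
  also have "\<dots> = (2 * \<bar>sin (pi*z)\<bar>)\<^sup>2" by (simp add: power_mult_distrib)
  finally show ?thesis by (rule power2_eq_imp_eq) auto
qed

lemma norm_e_minus_1: "2 * nd x \<le> norm (e x - 1)"
proof -
  obtain n where n: "nd x = \<bar>x - of_int n\<bar>" using nd_witness by blast
  define z where "z = x - of_int n"
  have "e x = e (z + of_int n)" by (simp add: z_def)
  then have ex: "e x = e z" by (simp only: e_add e_of_int mult_1_right)
  have "\<bar>z\<bar> \<le> 1 / 2" using nd_le_half[of x] n by (simp add: z_def)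
  then show ?thesis using abs_le_abs_sin_pi[of z] n unfolding ex norm_e_minus_1_eq by (simp add: z_def)
qed

lemma norm_e_minus_1_le: "norm (e x - 1) \<le> 2 * pi * nd x"
proof -
  obtain n where n: "nd x = \<bar>x - of_int n\<bar>" using nd_witness by blast
  define z where "z = x - of_int n"
  have "e x = e (z + of_int n)" by (simp add: z_def)
  then have ex: "e x = e z" by (simp only: e_add e_of_int mult_1_right)
  have "\<bar>sin (pi * z)\<bar> \<le> \<bar>pi * z\<bar>" by (rule abs_sin_x_le_abs_x)
  then show ?thesis unfolding ex norm_e_minus_1_eq n z_def[symmetric] by (simp add: abs_mult)
qed

text \<open>Multiplication by \<open>e \<beta> - 1\<close> telescopes. The product form also covers
  integral \<open>\<beta>\<close>, where a quotient would have denominator 0.\<close>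

lemma norm_geometric_sum_e:
  fixes l u :: int
  shows "norm (\<Sum>y\<in>{l..u}. e (\<beta> * of_int y)) * nd \<beta> \<le> 1"
proof (cases "l \<le> u")
  case True
  have "(e \<beta> - 1) * (\<Sum>y\<in>{l..u}. e (\<beta> * of_int y)) = e (\<beta> * of_int (u + 1)) - e (\<beta> * of_int l)"
    using True
  proof (induction u rule: int_ge_induct)
    case base
    show ?case by (simp add: algebra_simps e_add)
  next
    case (step u)
    have "{l..u + 1} = insert (u + 1) {l..u}" using step(1) by auto
    then have "(e \<beta> - 1) * (\<Sum>y\<in>{l..u + 1}. e (\<beta> * of_int y))
      = (e \<beta> - 1) * e (\<beta> * of_int (u + 1)) + (e \<beta> - 1) * (\<Sum>y\<in>{l..u}. e (\<beta> * of_int y))"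
      by (simp add: algebra_simps)
    also have "\<dots> = e (\<beta> * of_int (u + 1 + 1)) - e (\<beta> * of_int l)"
    proof -
      have "e (\<beta> * of_int (u + 1 + 1)) = e \<beta> * e (\<beta> * of_int (u + 1))"
        unfolding e_add[symmetric] by (simp add: algebra_simps)
      then show ?thesis unfolding step.IH by (simp add: left_diff_distrib)
    qed
    finally show ?case .
  qed
  then have "norm (e \<beta> - 1) * norm (\<Sum>y\<in>{l..u}. e (\<beta> * of_int y)) = norm (e (\<beta> * of_int (u + 1)) - e (\<beta> * of_int l))"
    by (simp only: norm_mult[symmetric])
  also have "\<dots> \<le> 2" by (rule order_trans[OF norm_triangle_ineq4]) simp
  finally have "norm (e \<beta> - 1) * norm (\<Sum>y\<in>{l..u}. e (\<beta> * of_int y)) \<le> 2" .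
  moreover have "2 * nd \<beta> * norm (\<Sum>y\<in>{l..u}. e (\<beta> * of_int y)) \<le> norm (e \<beta> - 1) * norm (\<Sum>y\<in>{l..u}. e (\<beta> * of_int y))"
    by (intro mult_right_mono norm_e_minus_1) simp
  ultimately show ?thesis by (simp add: mult.commute)
qed simp

text \<open>A fibre whose points differ by less than \<open>d\<close> fits into an interval of
  \<open>d\<close> integers, so some fibre must be longer.\<close>

lemma pigeonhole_far:
  fixes G :: "int set" and f :: "int \<Rightarrow> 'v"
  assumes "finite G" "card (f ` G) * d < card G"
  shows "\<exists>a\<in>G. \<exists>b\<in>G. f a = f b \<and> int d \<le> b - a"
proof (rule ccontr)
  assume "\<not> ?thesis"
  then have near: "\<And>a b. a \<in> G \<Longrightarrow> b \<in> G \<Longrightarrow> f a = f b \<Longrightarrow> b - a < int d" by force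
  have "card {x \<in> G. f x = v} \<le> d" for v
  proof (cases "{x \<in> G. f x = v} = {}")
    case False
    let ?F = "{x \<in> G. f x = v}"
    have fin: "finite ?F" using assms by simp
    have "Min ?F \<in> ?F" using fin False by (rule Min_in)
    then have "?F \<subseteq> {Min ?F..<Min ?F + int d}"
      using near[of "Min ?F"] fin by (fastforce simp: Min_le)
    then have "card ?F \<le> card {Min ?F..<Min ?F + int d}" by (rule card_mono[rotated]) simp
    then show ?thesis by simp
  qed (simp only: card.empty)
  moreover have "card G = (\<Sum>v\<in>f ` G. card {x \<in> G. f x = v})"
    using sum.group[of G "f ` G" f "\<lambda>_. 1::nat"] assms(1) by simp
  ultimately have "card G \<le> card (f ` G) * d"
    using sum_bounded_above[of "f ` G" "\<lambda>v. card {x \<in> G. f x = v}" d] by simp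
  with assms(2) show False by simp
qed

text \<open>For a proportion about \<open>\<eta>\<close> of all \<open>a\<close> the geometric sum
  is large, and then \<open>2 a \<theta>\<close> is within about \<open>1 / (\<eta> M)\<close> of an
  integer. Differences of such \<open>a\<close> share this property up to a factor 2. The first
  pigeonholing finds a bounded difference, giving precision \<open>1 / M\<close>; the second finds a
  difference of order \<open>M\<close> in one residue class, which gains the second factor
  \<open>M\<close>.\<close>

lemma major_arc_core:
  fixes M :: int and \<theta> \<eta> :: real
  assumes M: "(1 / \<eta>) ^ 20 \<le> real_of_int M" and \<eta>: "0 < \<eta>" "\<eta> \<le> 1 / 2"
    and large: "\<eta> \<le> avg (diff_range M) (\<lambda>a. norm (avg {1..M} (\<lambda>y. if y + a \<in> {1..M} then e (\<theta> * of_int (2 * a * y)) else 0)))"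
  shows "\<exists>q::nat. 1 \<le> q \<and> real q \<le> (1 / \<eta>) ^ 20 \<and> nd (real q * \<theta>) \<le> (1 / \<eta>) ^ 20 / (real_of_int M)\<^sup>2"
proof -
  let ?A = "diff_range M"
  define y where "y = 1 / \<eta>"
  have y2: "2 \<le> y" unfolding y_def using \<eta> by (simp add: field_simps)
  have yM: "y ^ 20 \<le> real_of_int M" using M by (simp add: y_def)
  have pw: "2 ^ n * y ^ k \<le> y ^ (n + k)" for n k
    unfolding power_add using y2 by (intro mult_right_mono power_mono) auto
  have yk: "2 ^ n * y ^ k \<le> real_of_int M" if "n + k \<le> 20" for n k
    by (rule order_trans[OF pw], rule order_trans[OF power_increasing[OF that] yM]) (use y2 in simp)
  have M1: "M \<ge> 1" using yk[of 0 0] by simp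
  have M0: "real_of_int M > 0" using M1 by simp
  define S where "S = (\<lambda>a. norm (avg {1..M} (\<lambda>y. if y + a \<in> {1..M} then e (\<theta> * of_int (2 * a * y)) else 0)))"
  have S1: "S a \<le> 1" for a unfolding S_def by (intro norm_avg_le_bound) auto
  have Snd: "S a * nd (2 * of_int a * \<theta>) \<le> 1 / real_of_int M" for a
  proof -
    have eq: "{y \<in> {1..M}. y + a \<in> {1..M}} = {max 1 (1 - a)..min M (M - a)}" by auto
    have "(\<Sum>y\<in>{1..M}. if y + a \<in> {1..M} then e (\<theta> * of_int (2 * a * y)) else 0)
        = (\<Sum>y\<in>{max 1 (1 - a)..min M (M - a)}. e (2 * of_int a * \<theta> * of_int y))"
      unfolding eq[symmetric] sum.inter_filter[OF finite_atLeastAtMost_int] by (simp add: mult_ac cong: if_cong)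
    then have "S a = norm (\<Sum>y\<in>{max 1 (1 - a)..min M (M - a)}. e (2 * of_int a * \<theta> * of_int y)) / real_of_int M"
      using M1 by (simp add: S_def avg_def norm_divide)
    then show ?thesis
      using norm_geometric_sum_e[of "2 * of_int a * \<theta>" "max 1 (1 - a)" "min M (M - a)"] M0
      by (simp add: divide_right_mono)
  qed
  define G where "G = {a \<in> ?A. \<eta> / 2 \<le> S a}"
  have finG: "finite G" by (simp add: G_def)
  have Gnd: "nd (2 * of_int a * \<theta>) \<le> 2 * y / real_of_int M" if "a \<in> G" for a
  proof -
    have "\<eta> / 2 * nd (2 * of_int a * \<theta>) \<le> S a * nd (2 * of_int a * \<theta>)"
      using that by (intro mult_right_mono) (auto simp: G_def)
    also have "\<dots> \<le> 1 / real_of_int M" by (rule Snd)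
    finally show ?thesis using \<eta> M0 by (simp add: y_def field_simps)
  qed
  have cardG: "real_of_int M \<le> 2 * y * real (card G)"
  proof -
    have "\<eta> \<le> avg ?A S" using large by (simp add: S_def)
    also have "\<dots> \<le> avg ?A (\<lambda>a. (if a \<in> G then 1 else 0) + \<eta> / 2)"
      by (rule avg_mono) (use S1 \<eta> in \<open>auto simp: G_def intro: order_trans[OF S1]\<close>)
    also have "\<dots> = avg ?A (\<lambda>a. if a \<in> G then 1 else 0) + \<eta> / 2"
      by (simp only: avg_add avg_const[OF finite_diff_range diff_range_nonempty[OF M1]])
    also have "avg ?A (\<lambda>a. if a \<in> G then 1 else 0) = real (card G) / real (card ?A)"
    proof -
      have "?A \<inter> G = G" by (auto simp: G_def)
      then show ?thesis by (simp add: avg_def sum.If_cases)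
    qed
    also have "\<dots> \<le> real (card G) / real_of_int M"
      using M1 by (intro divide_left_mono) (auto simp: card_diff_range)
    finally have "\<eta> / 2 * real_of_int M \<le> real (card G)" using M0 by (simp add: field_simps)
    then show ?thesis using \<eta> by (simp add: y_def field_simps)
  qed
  \<comment> \<open>two elements of \<open>G\<close> at bounded distance give a denominator with a first approximation\<close>
  define q1 where "q1 = \<lceil>8 * y\<rceil>"
  have q1: "8 * y \<le> real_of_int q1" "real_of_int q1 \<le> 9 * y" unfolding q1_def using y2 by linarith+
  have q1pos: "q1 > 0" using q1(1) y2 by linarith
  have "card ((\<lambda>a. a div q1) ` G) \<le> card {- (M div q1) - 1..M div q1}"
  proof (rule card_mono)
    show "(\<lambda>a. a div q1) ` G \<subseteq> {- (M div q1) - 1..M div q1}"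
    proof (rule image_subsetI)
      fix a assume "a \<in> G"
      then have a: "- M \<le> a" "a \<le> M" by (auto simp: G_def diff_range_def)
      have "a div q1 \<le> M div q1" using a q1pos by (intro zdiv_mono1)
      moreover have "- (M div q1) - 1 \<le> a div q1"
      proof -
        have "(- (M div q1) - 1) * q1 \<le> - M"
          using pos_mod_bound[OF q1pos, of M] div_mult_mod_eq[of M q1] unfolding left_diff_distrib
          by linarith
        then have "((- (M div q1) - 1) * q1) div q1 \<le> a div q1"
          using a q1pos by (intro zdiv_mono1) auto
        then show ?thesis using q1pos by simp
      qed
      ultimately show "a div q1 \<in> {- (M div q1) - 1..M div q1}" by simp
    qed
  qed simp
  then have "real (card ((\<lambda>a. a div q1) ` G)) \<le> real (card {- (M div q1) - 1..M div q1})"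
    by (rule of_nat_mono)
  also have "\<dots> = 2 * real_of_int (M div q1) + 2"
  proof -
    have "0 \<le> M div q1" using M1 q1pos by (simp add: pos_imp_zdiv_nonneg_iff)
    then show ?thesis by simp
  qed
  also have "\<dots> \<le> 2 * (real_of_int M / real_of_int q1) + 2"
    using real_of_int_div4[of M q1] by simp
  also have "\<dots> \<le> 2 * (real_of_int M / (8 * y)) + 2"
    using q1 M0 y2 by (intro add_mono mult_left_mono divide_left_mono) auto
  also have "\<dots> < real (card G)"
  proof -
    have "8 * y < real_of_int M" using yk[of 4 1] y2 by simp
    then have "2 * (real_of_int M / (8 * y)) + 2 < real_of_int M / (2 * y)"
      using y2 by (simp add: field_simps)
    also have "\<dots> \<le> real (card G)" using cardG y2 by (simp add: field_simps)
    finally show ?thesis .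
  qed
  finally have "card ((\<lambda>a. a div q1) ` G) * 1 < card G" by simp
  from pigeonhole_far[OF finG this] obtain a0 b0 where ab0: "a0 \<in> G" "b0 \<in> G" "a0 div q1 = b0 div q1" "1 \<le> b0 - a0"
    by auto
  define q0 where "q0 = b0 - a0"
  have q0: "q0 \<ge> 1" "q0 < q1"
  proof -
    show "q0 \<ge> 1" using ab0 by (simp add: q0_def)
    have "b0 - a0 = (b0 div q1 * q1 + b0 mod q1) - (a0 div q1 * q1 + a0 mod q1)"
      by (simp only: div_mult_mod_eq)
    also have "\<dots> = b0 mod q1 - a0 mod q1" unfolding ab0(3) by (rule add_diff_cancel_left)
    finally show "q0 < q1" unfolding q0_def using q1pos pos_mod_bound[of q1 b0] pos_mod_sign[of q1 a0] by linarith
  qed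
  obtain n where n: "nd (2 * of_int q0 * \<theta>) = \<bar>2 * of_int q0 * \<theta> - of_int n\<bar>" using nd_witness by blast
  define \<beta> where "\<beta> = 2 * of_int q0 * \<theta> - of_int n"
  have \<beta>: "\<bar>\<beta>\<bar> \<le> 4 * y / real_of_int M"
  proof -
    have "nd (2 * of_int q0 * \<theta>) = nd (2 * of_int b0 * \<theta> - 2 * of_int a0 * \<theta>)"
      by (simp add: q0_def algebra_simps)
    also have "\<dots> \<le> nd (2 * of_int b0 * \<theta>) + nd (2 * of_int a0 * \<theta>)" by (rule nd_diff)
    also have "\<dots> \<le> 2 * y / real_of_int M + 2 * y / real_of_int M" by (intro add_mono Gnd ab0)
    finally show ?thesis by (simp add: \<beta>_def n)
  qed
  \<comment> \<open>two elements of \<open>G\<close> far apart, in the same class, improve the approximation\<close>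
  define d where "d = nat \<lfloor>real_of_int M / (400 * y ^ 3)\<rfloor>"
  \<comment> \<open>Equal floors force \<open>\<bar>J * \<beta>\<bar> \<le> 1 / 2\<close> for the
    quotient difference \<open>J\<close>, so that the distance of \<open>J * \<beta>\<close> to the
    nearest integer is its absolute value and can be divided by \<open>J\<close>.\<close>
  define f where "f = (\<lambda>a. (a mod q0, \<lfloor>2 * of_int (a div q0) * \<beta>\<rfloor>))"
  define r where "r = \<lceil>8 * y\<rceil>"
  have r: "real_of_int r \<le> 9 * y" "8 * y \<le> real_of_int r" unfolding r_def using y2 by linarith+
  have dlow: "real_of_int M / (800 * y ^ 3) \<le> real d"
  proof -
    have "800 * y ^ 3 \<le> 2 ^ 10 * y ^ 3" using y2 by (intro mult_right_mono) auto
    also have "\<dots> \<le> real_of_int M" by (rule yk) simp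
    finally have "800 * y ^ 3 \<le> real_of_int M" .
    then have "1 \<le> real_of_int M / (800 * y ^ 3)" using y2 by simp
    moreover have "real_of_int M / (400 * y ^ 3) = 2 * (real_of_int M / (800 * y ^ 3))" by simp
    ultimately show ?thesis unfolding d_def by linarith
  qed
  have dup: "real d \<le> real_of_int M / (400 * y ^ 3)"
    unfolding d_def using M0 y2 by (simp add: of_nat_floor)
  have absdiv: "\<bar>real_of_int (a div q0)\<bar> \<le> real_of_int M" if "a \<in> G" for a
  proof -
    have a: "\<bar>a\<bar> < M" using that by (auto simp: G_def diff_range_def)
    have "\<bar>a div q0\<bar> \<le> M"
    proof (cases "a \<ge> 0")
      case True
      then have "0 \<le> a div q0" using q0 by (simp add: pos_imp_zdiv_nonneg_iff)
      moreover have "a div q0 \<le> a"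
      proof -
        have "a * 1 \<le> a * q0" using True q0 by (intro mult_left_mono) auto
        then have "a div q0 \<le> (a * q0) div q0" using q0 by (intro zdiv_mono1) auto
        then show ?thesis using q0 by simp
      qed
      ultimately show ?thesis using a by linarith
    next
      case False
      then have "a div q0 \<le> 0" using q0 by (simp add: div_nonpos_pos_le0)
      moreover have "a div q0 \<ge> a"
      proof -
        have "a * q0 \<le> a * 1" using False q0 by (intro mult_left_mono_neg) auto
        then have "(a * q0) div q0 \<le> a div q0" using q0 by (intro zdiv_mono1) auto
        then show ?thesis using q0 by simp
      qed
      ultimately show ?thesis using a by linarith
    qed
    then show ?thesis by linarith
  qed
  have "card (f ` G) \<le> card ({0..<q0} \<times> {- r..r})"
  proof (rule card_mono)
    show "f ` G \<subseteq> {0..<q0} \<times> {- r..r}"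
    proof (rule image_subsetI)
      fix a assume a: "a \<in> G"
      have "\<bar>2 * of_int (a div q0) * \<beta>\<bar> = 2 * (\<bar>real_of_int (a div q0)\<bar> * \<bar>\<beta>\<bar>)" by (simp add: abs_mult)
      also have "\<dots> \<le> 2 * (real_of_int M * (4 * y / real_of_int M))"
        using M0 by (intro mult_left_mono mult_mono absdiv a \<beta>) auto
      also have "\<dots> = 8 * y" using M0 by simp
      finally have "\<bar>2 * of_int (a div q0) * \<beta>\<bar> \<le> real_of_int r" using r by linarith
      then have "- r \<le> \<lfloor>2 * of_int (a div q0) * \<beta>\<rfloor>" "\<lfloor>2 * of_int (a div q0) * \<beta>\<rfloor> \<le> r"
        by linarith+
      then show "f a \<in> {0..<q0} \<times> {- r..r}" using q0 by (simp add: f_def)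
    qed
  qed simp
  then have "real (card (f ` G)) \<le> real (card ({0..<q0} \<times> {- r..r}))" by (rule of_nat_mono)
  also have "\<dots> = real_of_int q0 * (2 * real_of_int r + 1)"
    using q0 r y2 by (simp add: card_cartesian_product)
  also have "\<dots> \<le> (9 * y) * (19 * y)"
    using q0 q1 r y2 by (intro mult_mono) linarith+
  finally have cf: "real (card (f ` G)) \<le> 171 * y\<^sup>2" by (simp add: power2_eq_square)
  \<comment> \<open>The constant 400 in \<open>d\<close> is chosen to make
    \<open>171 / 400 < 1 / 2\<close>.\<close>
  have "real (card (f ` G)) * real d \<le> 171 * y\<^sup>2 * (real_of_int M / (400 * y ^ 3))"
    by (intro mult_mono cf dup) auto
  also have "\<dots> = (171 / 400) * (real_of_int M / y)" using y2 by (simp add: power2_eq_square power3_eq_cube)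
  also have "\<dots> < real_of_int M / (2 * y)" using M0 y2 by (simp add: field_simps)
  also have "\<dots> \<le> real (card G)" using cardG y2 by (simp add: field_simps)
  finally have "card (f ` G) * d < card G" by (simp flip: of_nat_mult)
  from pigeonhole_far[OF finG this] obtain a b where ab: "a \<in> G" "b \<in> G" "f a = f b" "int d \<le> b - a"
    by auto
  define J where "J = b div q0 - a div q0"
  have bJ: "b - a = q0 * J"
  proof -
    have "b - a = (b div q0 * q0 + b mod q0) - (a div q0 * q0 + a mod q0)"
      by (simp only: div_mult_mod_eq)
    also have "a mod q0 = b mod q0" using ab(3) by (simp add: f_def)
    finally show ?thesis by (simp only: J_def right_diff_distrib mult.commute[of q0] add_diff_cancel_right)
  qed
  have "nd (of_int J * \<beta>) \<le> 4 * y / real_of_int M"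
  proof -
    have "2 * of_int b * \<theta> - 2 * of_int a * \<theta> = of_int J * (2 * of_int q0 * \<theta>)"
      using bJ by (simp add: left_diff_distrib[symmetric] right_diff_distrib[symmetric] flip: of_int_diff)
    also have "\<dots> = of_int J * \<beta> + of_int (J * n)" by (simp add: \<beta>_def algebra_simps)
    finally have "nd (of_int J * \<beta>) = nd (2 * of_int b * \<theta> - 2 * of_int a * \<theta>)" by (simp only: nd_add_int)
    also have "\<dots> \<le> nd (2 * of_int b * \<theta>) + nd (2 * of_int a * \<theta>)" by (rule nd_diff)
    also have "\<dots> \<le> 2 * y / real_of_int M + 2 * y / real_of_int M" by (intro add_mono Gnd ab)
    finally show ?thesis by simp
  qed
  moreover have "\<bar>of_int J * \<beta>\<bar> \<le> 1 / 2"
  proof -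
    have "\<bar>2 * of_int (b div q0) * \<beta> - 2 * of_int (a div q0) * \<beta>\<bar> < 1"
      using ab(3) unfolding f_def prod.inject by linarith
    moreover have "2 * of_int (b div q0) * \<beta> - 2 * of_int (a div q0) * \<beta> = 2 * (of_int J * \<beta>)"
      by (simp add: J_def left_diff_distrib)
    ultimately show ?thesis by linarith
  qed
  ultimately have J\<beta>: "\<bar>real_of_int J\<bar> * \<bar>\<beta>\<bar> \<le> 4 * y / real_of_int M" by (simp add: nd_eq_abs abs_mult)
  have Jlow: "real d \<le> 9 * y * \<bar>real_of_int J\<bar>"
  proof -
    have "real d \<le> real_of_int (q0 * J)" using ab(4) bJ by linarith
    also have "\<dots> \<le> real_of_int q0 * \<bar>real_of_int J\<bar>" using q0 by (simp add: mult_left_mono)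
    also have "\<dots> \<le> 9 * y * \<bar>real_of_int J\<bar>" using q0 q1 by (intro mult_right_mono) linarith+
    finally show ?thesis .
  qed
  have "real_of_int M / (800 * y ^ 3) * \<bar>\<beta>\<bar> \<le> 9 * y * \<bar>real_of_int J\<bar> * \<bar>\<beta>\<bar>"
    using dlow Jlow by (intro mult_right_mono) linarith+
  also have "\<dots> \<le> 9 * y * (4 * y / real_of_int M)"
    using J\<beta> y2 by (simp only: mult.assoc) (intro mult_left_mono, auto simp: mult.assoc)
  finally have "real_of_int M / (800 * y ^ 3) * \<bar>\<beta>\<bar> * ((800 * y ^ 3) / real_of_int M) \<le> 9 * y * (4 * y / real_of_int M) * ((800 * y ^ 3) / real_of_int M)"
    using M0 y2 by (intro mult_right_mono) auto
  then have "\<bar>\<beta>\<bar> \<le> 28800 * y ^ 5 / (real_of_int M)\<^sup>2"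
    using M0 y2 by (simp add: power2_eq_square power_numeral_reduce)
  also have "\<dots> \<le> y ^ 20 / (real_of_int M)\<^sup>2"
  proof (rule divide_right_mono)
    have "28800 * y ^ 5 \<le> 2 ^ 15 * y ^ 5" using y2 by simp
    also have "\<dots> \<le> y ^ 20" using pw[of 15 5] by simp
    finally show "28800 * y ^ 5 \<le> y ^ 20" .
  qed simp
  finally have fin1: "nd (2 * of_int q0 * \<theta>) \<le> y ^ 20 / (real_of_int M)\<^sup>2" by (simp add: \<beta>_def n)
  have "real_of_int (2 * q0) \<le> 18 * y" using q0 q1 by linarith
  also have "\<dots> \<le> y ^ 20"
  proof -
    have "18 * y \<le> 2 ^ 19 * y ^ 1" using y2 by simp
    then show ?thesis using pw[of 19 1] by simp
  qed
  finally have "real (nat (2 * q0)) \<le> y ^ 20" using q0 by simp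
  moreover have "1 \<le> nat (2 * q0)" "real (nat (2 * q0)) = 2 * of_int q0" using q0 by auto
  ultimately show ?thesis using fin1 unfolding y_def by metis
qed

text \<open>The shape left by differencing a quadratic phase once. The coefficients
  \<open>c a\<close> do not depend on \<open>y\<close> and vanish under absolute values.
  \<open>\<eta> = \<delta> ^ 3\<close> pays for the square and the factor 2, hence
  \<open>60 = 3 * 20\<close>.\<close>

lemma quadratic_phase_major_arc:
  fixes M :: int and \<theta> \<delta> :: real and c :: "int \<Rightarrow> complex"
  assumes M: "(1 / \<delta>) ^ 60 \<le> real_of_int M" and \<delta>: "0 < \<delta>" "\<delta> \<le> 1 / 2"
    and c: "\<And>a. norm (c a) \<le> 1"
    and large: "\<delta>\<^sup>2 \<le> 2 * norm (avg (diff_range M) (\<lambda>a. avg {1..M} (\<lambda>y. if y + a \<in> {1..M} then c a * e (\<theta> * of_int (2 * a * y)) else 0)))"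
  shows "\<exists>q::nat. 1 \<le> q \<and> real q \<le> (1 / \<delta>) ^ 60 \<and> nd (real q * \<theta>) \<le> (1 / \<delta>) ^ 60 / (real_of_int M)\<^sup>2"
proof -
  define \<eta> where "\<eta> = \<delta> ^ 3"
  have "avg {1..M} (\<lambda>y. if y + a \<in> {1..M} then c a * e (\<theta> * of_int (2 * a * y)) else 0)
     = c a * avg {1..M} (\<lambda>y. if y + a \<in> {1..M} then e (\<theta> * of_int (2 * a * y)) else 0)" for a
    unfolding avg_mult_left[symmetric] by (rule avg_cong[OF refl]) simp
  then have le: "norm (avg {1..M} (\<lambda>y. if y + a \<in> {1..M} then c a * e (\<theta> * of_int (2 * a * y)) else 0))
     \<le> norm (avg {1..M} (\<lambda>y. if y + a \<in> {1..M} then e (\<theta> * of_int (2 * a * y)) else 0))" for a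
    using c by (simp only: norm_mult mult_left_le_one_le norm_ge_zero)
  have "norm (avg (diff_range M) (\<lambda>a. avg {1..M} (\<lambda>y. if y + a \<in> {1..M} then c a * e (\<theta> * of_int (2 * a * y)) else 0)))
    \<le> avg (diff_range M) (\<lambda>a. norm (avg {1..M} (\<lambda>y. if y + a \<in> {1..M} then e (\<theta> * of_int (2 * a * y)) else 0)))"
    by (rule order_trans[OF norm_avg_le], rule avg_mono[OF le])
  moreover have "\<eta> \<le> \<delta>\<^sup>2 / 2"
    using mult_left_mono[OF \<delta>(2), of "\<delta>\<^sup>2"] by (simp add: \<eta>_def power2_eq_square power3_eq_cube)
  ultimately have l: "\<eta> \<le> avg (diff_range M) (\<lambda>a. norm (avg {1..M} (\<lambda>y. if y + a \<in> {1..M} then e (\<theta> * of_int (2 * a * y)) else 0)))"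
    using large by linarith
  have \<eta>p: "(1 / \<eta>) ^ 20 = (1 / \<delta>) ^ 60" by (simp add: \<eta>_def power_divide flip: power_mult)
  have \<eta>0: "0 < \<eta>" "\<eta> \<le> 1 / 2"
    unfolding \<eta>_def by (rule zero_less_power[OF \<delta>(1)], rule pow_half_le[OF \<delta>]) simp
  from major_arc_core[OF _ \<eta>0 l] show ?thesis unfolding \<eta>p using M by blast
qed

text \<open>Differencing makes the phase linear in \<open>y\<close>; the linear term with
  \<open>\<beta>\<close> enters only the coefficients that depend on \<open>a\<close> alone.\<close>

lemma weyl_quadratic:
  fixes M :: int and \<theta> \<beta> \<delta> :: real
  assumes M: "(1 / \<delta>) ^ 60 \<le> real_of_int M" and \<delta>: "0 < \<delta>" "\<delta> \<le> 1 / 2"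
    and large: "\<delta> \<le> norm (avg {1..M} (\<lambda>i. e (\<theta> * (of_int i)\<^sup>2 + \<beta> * of_int i)))"
  shows "\<exists>q::nat. 1 \<le> q \<and> real q \<le> (1 / \<delta>) ^ 60 \<and> nd (real q * \<theta>) \<le> (1 / \<delta>) ^ 60 / (real_of_int M)\<^sup>2"
proof -
  let ?B = "{1..M}"
  have "1 \<le> (1 / \<delta>) ^ 60" by (rule one_le_power) (use \<delta> in \<open>simp add: field_simps\<close>)
  then have M1: "M \<ge> 1" using M by linarith
  define F where "F = (\<lambda>i::int. e (\<theta> * (of_int i)\<^sup>2 + \<beta> * of_int i))"
  have FF: "F y * cnj (F (y + a)) = e (- \<theta> * (of_int a)\<^sup>2 - \<beta> * of_int a) * e (- \<theta> * of_int (2 * a * y))" for y a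
    unfolding F_def cnj_e e_add[symmetric] by (rule arg_cong[of _ _ e]) (simp add: power2_eq_square algebra_simps)
  have "\<delta>\<^sup>2 \<le> (norm (avg ?B F))\<^sup>2"
    by (rule power_mono) (use large \<delta> in \<open>auto simp: F_def\<close>)
  also have "\<dots> = norm (complex_of_real ((norm (avg ?B F))\<^sup>2))" by (simp only: norm_of_real abs_power2)
  also have "\<dots> = norm (avg ?B (\<lambda>y. avg ?B (\<lambda>y'. F y * cnj (F y'))))" by (simp only: avg_norm_power2)
  also have "\<dots> \<le> 2 * norm (avg (diff_range M) (\<lambda>a. avg ?B (\<lambda>y. if y + a \<in> ?B then F y * cnj (F (y + a)) else 0)))"
    by (rule norm_avg_pairs_by_difference_le) (use M1 diff_range_diff in \<open>auto simp: card_diff_range\<close>)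
  finally have "\<delta>\<^sup>2 \<le> 2 * norm (avg (diff_range M) (\<lambda>a. avg ?B (\<lambda>y. if y + a \<in> ?B
      then e (- \<theta> * (of_int a)\<^sup>2 - \<beta> * of_int a) * e (- \<theta> * of_int (2 * a * y)) else 0)))" by (simp only: FF)
  from quadratic_phase_major_arc[OF M \<delta> _ this] show ?thesis by simp
qed

section \<open>Fourier analysis on the cyclic group\<close>

definition chi :: "int \<Rightarrow> int \<Rightarrow> complex" where
  "chi P n = e (of_int n / of_int P)"

lemma norm_chi [simp]: "norm (chi P n) = 1"
  by (simp add: chi_def)

lemma chi_add: "chi P (m + n) = chi P m * chi P n"
  by (simp add: chi_def add_divide_distrib e_add)

lemma chi_0 [simp]: "chi P 0 = 1"
  by (simp add: chi_def)

lemma cnj_chi: "cnj (chi P n) = chi P (- n)"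
  by (simp add: chi_def cnj_e)

lemma chi_multiple [simp]: "chi P (P * k) = 1"
  by (cases "P = 0") (simp_all add: chi_def)

lemma per_chi_mult: "per P (\<lambda>x. chi P (a * x))"
proof -
  have "chi P (a * (x + P)) = chi P (a * x)" for x
    using chi_add[of P "a * x" "P * a"] by (simp add: algebra_simps)
  then show ?thesis by (simp add: per_def)
qed

text \<open>Translating \<open>j\<close> by 1 multiplies the average by \<open>chi P n\<close>,
  which is 1 only for multiples of \<open>P\<close>.\<close>

lemma avg_chi:
  assumes "P > 0" shows "avg {0..<P} (\<lambda>j. chi P (j * n)) = (if P dvd n then 1 else 0)"
proof (cases "P dvd n")
  case True
  then obtain k where "n = P * k" by blast
  then have "chi P (j * n) = 1" for j using chi_multiple[of P "j * k"] by (simp add: mult_ac)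
  then show ?thesis using True assms by (simp add: avg_const)
next
  case False
  let ?S = "avg {0..<P} (\<lambda>j. chi P (j * n))"
  have "per P (\<lambda>j. chi P (j * n))" using per_chi_mult[of P n] by (simp add: mult.commute)
  from avg_shift[OF this assms, of 1] have "?S = avg {0..<P} (\<lambda>j. chi P ((j + 1) * n))" by simp
  also have "\<dots> = ?S * chi P n" by (simp add: distrib_right chi_add avg_mult_right)
  finally have "?S = 0 \<or> chi P n = 1" by simp
  moreover have "chi P n \<noteq> 1"
  proof
    assume "chi P n = 1"
    then have "nd (of_int n / of_int P) \<le> 0"
      using norm_e_minus_1[of "of_int n / of_int P"] by (simp add: chi_def)
    moreover obtain m where "nd (of_int n / of_int P) = \<bar>of_int n / of_int P - of_int m\<bar>"
      using nd_witness by blast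
    ultimately have "real_of_int n = real_of_int (m * P)" using assms by (simp add: field_simps)
    then have "n = m * P" by linarith
    with False show False by simp
  qed
  ultimately show ?thesis using False by simp
qed

text \<open>Normalised on the physical side, so that frequencies are summed and not averaged. The
  exponent has a positive sign, as in the sum of \<open>h x * e (\<alpha> * x)\<close> to be bounded
  in the end.\<close>

definition ft :: "int \<Rightarrow> (int \<Rightarrow> complex) \<Rightarrow> int \<Rightarrow> complex" where
  "ft P u \<xi> = avg {0..<P} (\<lambda>x. u x * chi P (\<xi> * x))"

lemma parseval_cyclic:
  assumes P: "P > 0"
  shows "(\<Sum>\<xi>\<in>{0..<P}. (norm (ft P u \<xi>))\<^sup>2) = avg {0..<P} (\<lambda>x. (norm (u x))\<^sup>2)"
proof -
  let ?X = "{0..<P}"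
  have "complex_of_real (avg ?X (\<lambda>\<xi>. (norm (ft P u \<xi>))\<^sup>2))
     = avg ?X (\<lambda>x. avg ?X (\<lambda>x'. avg ?X (\<lambda>\<xi>. u x * chi P (\<xi> * x) * cnj (u x' * chi P (\<xi> * x')))))"
    unfolding ft_def by (rule avg_norm_power2_swap)
  also have "\<dots> = avg ?X (\<lambda>x. avg ?X (\<lambda>x'. u x * cnj (u x') * avg ?X (\<lambda>\<xi>. chi P (\<xi> * (x - x')))))"
    by (simp add: avg_mult_left[symmetric] cnj_chi right_diff_distrib chi_add[of P "_ * _" "- (_ * _)", simplified] mult_ac)
  also have "\<dots> = avg ?X (\<lambda>x. avg ?X (\<lambda>x'. if x' = x then u x * cnj (u x) else 0))"
  proof (intro avg_cong[OF refl])
    fix x x' assume x: "x \<in> ?X" "x' \<in> ?X"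
    have "P dvd x - x' \<longleftrightarrow> x' = x"
    proof
      assume "P dvd x - x'"
      then have "x mod P = x' mod P" by (simp only: mod_eq_dvd_iff)
      with x show "x' = x" by simp
    qed simp
    then show "u x * cnj (u x') * avg ?X (\<lambda>\<xi>. chi P (\<xi> * (x - x'))) = (if x' = x then u x * cnj (u x) else 0)"
      by (simp add: avg_chi[OF P])
  qed
  also have "\<dots> = avg ?X (\<lambda>x. u x * cnj (u x) / of_nat (card ?X))"
    by (intro avg_cong[OF refl]) (simp add: avg_def)
  also have "\<dots> = complex_of_real (avg ?X (\<lambda>x. (norm (u x))\<^sup>2 / of_nat (card ?X)))"
    unfolding avg_of_real[symmetric] by (intro avg_cong[OF refl]) (simp only: complex_norm_square of_real_divide of_real_of_nat_eq)
  finally have "avg ?X (\<lambda>\<xi>. (norm (ft P u \<xi>))\<^sup>2) = avg ?X (\<lambda>x. (norm (u x))\<^sup>2 / of_nat (card ?X))"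
    by (simp only: of_real_eq_iff)
  also have "\<dots> = avg ?X (\<lambda>x. (norm (u x))\<^sup>2) / of_nat (card ?X)"
    by (simp add: avg_def sum_divide_distrib)
  finally have "(\<Sum>\<xi>\<in>?X. (norm (ft P u \<xi>))\<^sup>2) / of_nat (card ?X) = avg ?X (\<lambda>x. (norm (u x))\<^sup>2) / of_nat (card ?X)"
    by (simp only: avg_def[of ?X "\<lambda>\<xi>. (norm (ft P u \<xi>))\<^sup>2"])
  moreover have "real (card ?X) \<noteq> 0" using P by simp
  ultimately show ?thesis by (simp only: divide_cancel_right) simp
qed

lemma sum_norm_ft_le_1: "P > 0 \<Longrightarrow> bdd1 u \<Longrightarrow> (\<Sum>\<xi>\<in>{0..<P}. (norm (ft P u \<xi>))\<^sup>2) \<le> 1"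
  unfolding parseval_cyclic by (intro avg_le) (auto simp: bdd1_def abs_square_le_1)

text \<open>As a function of \<open>t\<close>, the average of \<open>D t u\<close> is an
  autocorrelation, whose transform is a product.\<close>

lemma ft_avg_D:
  assumes "per P u" "P > 0"
  shows "ft P (\<lambda>t. avg {0..<P} (D t u)) \<xi> = complex_of_real ((norm (ft P u \<xi>))\<^sup>2)"
proof -
  let ?X = "{0..<P}"
  have "ft P (\<lambda>t. avg ?X (D t u)) \<xi> = avg ?X (\<lambda>t. avg ?X (\<lambda>x. D t u x * chi P (\<xi> * t)))"
    by (simp add: ft_def avg_mult_right)
  also have "\<dots> = avg ?X (\<lambda>x. avg ?X (\<lambda>t. D t u x * chi P (\<xi> * t)))" by (rule avg_swap)
  also have "\<dots> = avg ?X (\<lambda>x. ft P u \<xi> * cnj (u x * chi P (\<xi> * x)))"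
  proof (rule avg_cong[OF refl])
    fix x
    have "D t u x * chi P (\<xi> * t) = u (t + x) * chi P (\<xi> * (t + x)) * cnj (u x * chi P (\<xi> * x))" for t
    proof -
      have "chi P (\<xi> * t) = chi P (\<xi> * (t + x)) * cnj (chi P (\<xi> * x))"
        unfolding cnj_chi chi_add[symmetric] by (simp add: algebra_simps)
      then show ?thesis by (simp add: D_def add.commute)
    qed
    then have "avg ?X (\<lambda>t. D t u x * chi P (\<xi> * t))
        = avg ?X (\<lambda>t. u (t + x) * chi P (\<xi> * (t + x))) * cnj (u x * chi P (\<xi> * x))"
      by (simp only: avg_mult_right)
    also have "avg ?X (\<lambda>t. u (t + x) * chi P (\<xi> * (t + x))) = ft P u \<xi>"
      unfolding ft_def by (rule avg_shift[OF per_mult[OF assms(1) per_chi_mult] assms(2)])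
    finally show "avg ?X (\<lambda>t. D t u x * chi P (\<xi> * t)) = ft P u \<xi> * cnj (u x * chi P (\<xi> * x))" .
  qed
  also have "\<dots> = ft P u \<xi> * cnj (ft P u \<xi>)" by (simp only: avg_mult_left avg_cnj ft_def)
  finally show ?thesis by (simp only: complex_norm_square)
qed

text \<open>The left side is the sum of fourth powers of the Fourier coefficients, at most the
  largest square times the Parseval sum.\<close>

lemma gowers_U2_le_ft:
  assumes u: "per P u" "bdd1 u" and P: "P > 0"
  shows "\<exists>\<xi>. avg {0..<P} (\<lambda>t. (norm (avg {0..<P} (D t u)))\<^sup>2) \<le> (norm (ft P u \<xi>))\<^sup>2"
proof -
  let ?X = "{0..<P}"
  define h where "h = (\<lambda>\<zeta>. (norm (ft P u \<zeta>))\<^sup>2)"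
  have X: "finite (h ` ?X)" "h ` ?X \<noteq> {}" using P by auto
  obtain \<xi> where "Max (h ` ?X) = h \<xi>" using Max_in[OF X] by blast
  then have \<xi>: "(norm (ft P u \<zeta>))\<^sup>2 \<le> (norm (ft P u \<xi>))\<^sup>2" if "\<zeta> \<in> ?X" for \<zeta>
    using Max_ge[OF X(1), of "h \<zeta>"] that by (simp add: h_def)
  have "avg ?X (\<lambda>t. (norm (avg ?X (D t u)))\<^sup>2) = (\<Sum>\<zeta>\<in>?X. (norm (ft P (\<lambda>t. avg ?X (D t u)) \<zeta>))\<^sup>2)"
    by (rule parseval_cyclic[OF P, symmetric])
  also have "\<dots> = (\<Sum>\<zeta>\<in>?X. (norm (ft P u \<zeta>))\<^sup>2 * (norm (ft P u \<zeta>))\<^sup>2)"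
    unfolding ft_avg_D[OF u(1) P] by (simp add: power2_eq_square norm_mult)
  also have "\<dots> \<le> (\<Sum>\<zeta>\<in>?X. (norm (ft P u \<xi>))\<^sup>2 * (norm (ft P u \<zeta>))\<^sup>2)"
    by (intro sum_mono mult_right_mono \<xi>) auto
  also have "\<dots> = (norm (ft P u \<xi>))\<^sup>2 * (\<Sum>\<zeta>\<in>?X. (norm (ft P u \<zeta>))\<^sup>2)" by (simp add: sum_distrib_left)
  also have "\<dots> \<le> (norm (ft P u \<xi>))\<^sup>2 * 1"
    by (intro mult_left_mono sum_norm_ft_le_1 P u) simp
  finally show ?thesis by auto
qed

text \<open>Major arcs on the cyclic group. A single \<open>R\<close> governs denominator and
  precision, since both are powers of \<open>1 / \<delta>\<close> throughout.\<close>

definition maj :: "int \<Rightarrow> real \<Rightarrow> int \<Rightarrow> bool" where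
  "maj P R \<xi> \<longleftrightarrow> (\<exists>q::nat. 1 \<le> q \<and> real q \<le> R \<and> nd (real q * (of_int \<xi> / of_int P)) \<le> R / of_int P)"

lemma per_maj:
  assumes "P > 0" shows "per P (maj P R)"
proof -
  have "nd (real q * (of_int (\<xi> + P) / of_int P)) = nd (real q * (of_int \<xi> / of_int P))" for q :: nat and \<xi>
  proof -
    have "real q * (of_int (\<xi> + P) / of_int P) = real q * (of_int \<xi> / of_int P) + of_int (int q)"
      using assms by (simp add: field_simps)
    then show ?thesis by (simp only: nd_add_int)
  qed
  then show ?thesis by (simp add: per_def maj_def)
qed

text \<open>A major arc frequency is recovered from \<open>q\<close>, the integer \<open>n\<close>
  nearest to \<open>q * \<xi> / P\<close>, and the remainder \<open>v = q * \<xi> - n * P\<close>.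
  Each of the three takes a number of values of order \<open>R\<close>.\<close>

lemma card_maj:
  assumes P: "P > 0" and R: "R \<ge> 1"
  shows "real (card {\<xi> \<in> {0..<P}. maj P R \<xi>}) \<le> 9 * R ^ 3"
proof -
  define r where "r = \<lfloor>R\<rfloor>"
  have r: "r \<ge> 1" "real_of_int r \<le> R" using R by (simp_all add: r_def le_floor_iff)
  let ?T = "{1..r} \<times> {0..r} \<times> {- r..r}"
  have "{\<xi> \<in> {0..<P}. maj P R \<xi>} \<subseteq> (\<lambda>(q, n, v). (n * P + v) div q) ` ?T"
  proof
    fix \<xi> assume "\<xi> \<in> {\<xi> \<in> {0..<P}. maj P R \<xi>}"
    then have \<xi>: "0 \<le> \<xi>" "\<xi> < P" "maj P R \<xi>" by auto
    then obtain q :: nat where q: "1 \<le> q" "real q \<le> R" "nd (real q * (of_int \<xi> / of_int P)) \<le> R / of_int P"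
      by (auto simp: maj_def)
    obtain n where n: "nd (real q * (of_int \<xi> / of_int P)) = \<bar>real q * (of_int \<xi> / of_int P) - of_int n\<bar>"
      using nd_witness by blast
    define v where "v = int q * \<xi> - n * P"
    have P': "real_of_int P > 0" using P by simp
    have "of_int \<xi> / of_int P \<le> (1::real)" using \<xi> P' by simp
    then have "real q * (of_int \<xi> / of_int P) \<le> real q * 1" by (rule mult_left_mono) simp
    then have z: "0 \<le> real q * (of_int \<xi> / of_int P)" "real q * (of_int \<xi> / of_int P) \<le> real q"
      using \<xi> P' by auto
    have h: "\<bar>real q * (of_int \<xi> / of_int P) - of_int n\<bar> \<le> 1 / 2" using nd_le_half n by metis
    have "0 \<le> n" using z h by linarith
    moreover have "n \<le> int q" using z h by linarith
    moreover have qr: "int q \<le> r" using q(2) by (simp add: r_def le_floor_iff)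
    moreover have "\<bar>real_of_int v\<bar> \<le> R"
    proof -
      have "real_of_int v = (real q * (of_int \<xi> / of_int P) - of_int n) * of_int P"
        using P' by (simp add: v_def field_simps)
      then have "\<bar>real_of_int v\<bar> = \<bar>real q * (of_int \<xi> / of_int P) - of_int n\<bar> * of_int P"
        using P' by (simp add: abs_mult)
      also have "\<dots> \<le> R / of_int P * of_int P" using q(3) n P' by (intro mult_right_mono) auto
      finally show ?thesis using P' by simp
    qed
    then have "\<bar>v\<bar> \<le> r" unfolding r_def le_floor_iff by simp
    ultimately have "(int q, n, v) \<in> ?T" using q(1) by auto
    moreover have "\<xi> = (n * P + v) div int q" using q(1) by (simp add: v_def)
    ultimately show "\<xi> \<in> (\<lambda>(q, n, v). (n * P + v) div q) ` ?T" by (intro image_eqI[of _ _ "(int q, n, v)"]) auto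
  qed
  then have "card {\<xi> \<in> {0..<P}. maj P R \<xi>} \<le> card ((\<lambda>(q, n, v). (n * P + v) div q) ` ?T)"
    by (rule card_mono[rotated]) simp
  also have "\<dots> \<le> card ?T" by (rule card_image_le) simp
  finally have "real (card {\<xi> \<in> {0..<P}. maj P R \<xi>}) \<le> real (card ?T)" by (rule of_nat_mono)
  also have "\<dots> = real_of_int r * ((real_of_int r + 1) * (2 * real_of_int r + 1))"
    using r by (simp add: card_cartesian_product)
  also have "\<dots> \<le> R * ((2 * R) * (3 * R))"
    using r R by (intro mult_mono) auto
  also have "\<dots> \<le> 9 * R ^ 3" using R by (simp add: power3_eq_cube)
  finally show ?thesis .
qed

text \<open>With a character in place of \<open>h\<close> a single Cauchy--Schwarz suffices: it
  removes \<open>f\<close>, and \<open>g\<close> survives only in the correlations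
  \<open>c a\<close>, which do not depend on \<open>y\<close>. The exponent 67 is 60 plus 7 for
  \<open>P \<le> 2 ^ 7 * M\<^sup>2\<close>.\<close>

lemma roth_major_arc:
  fixes P M :: int and \<delta> :: real
  assumes M: "(1 / \<delta>) ^ 60 \<le> real_of_int M" and \<delta>: "0 < \<delta>" "\<delta> \<le> 1 / 2"
    and P: "32 * M\<^sup>2 \<le> P" "P \<le> 128 * M\<^sup>2"
    and f: "bdd1 f" and g: "per P g" "bdd1 g"
    and large: "\<delta> \<le> norm (roth P M f g (\<lambda>n. chi P (\<Phi> * n)))"
  shows "maj P ((1 / \<delta>) ^ 67) \<Phi>"
proof -
  let ?B = "{1..M}" and ?X = "{0..<P}"
  have y2: "2 \<le> 1 / \<delta>" using \<delta> by (simp add: field_simps)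
  have "1 \<le> (1 / \<delta>) ^ 60" by (rule one_le_power) (use y2 in simp)
  then have M1: "M \<ge> 1" using M by linarith
  have P0: "P > 0" using P M1 by (smt (verit) zero_less_power)
  define c where "c = (\<lambda>a. avg ?X (\<lambda>x. g x * cnj (g (x + a))))"
  have c1: "norm (c a) \<le> 1" for a
    unfolding c_def by (rule bdd1_avg_norm) (use g(2) in \<open>auto simp: bdd1_def norm_mult mult_le_one\<close>)
  define F where "F = (\<lambda>x y. g (x + y) * chi P (\<Phi> * (x + y\<^sup>2)))"
  have FF: "avg ?X (\<lambda>x. F x y * cnj (F x (y + a)))
     = (c a * chi P (- \<Phi> * a\<^sup>2)) * e ((- of_int \<Phi> / of_int P) * of_int (2 * a * y))" for y a
  proof -
    have "F x y * cnj (F x (y + a)) = (g (x + y) * cnj (g (x + y + a))) * chi P (- \<Phi> * a\<^sup>2 + (- \<Phi> * (2 * a * y)))" for x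
    proof -
      have "chi P (\<Phi> * (x + y\<^sup>2)) * cnj (chi P (\<Phi> * (x + (y + a)\<^sup>2))) = chi P (- \<Phi> * a\<^sup>2 + (- \<Phi> * (2 * a * y)))"
        unfolding cnj_chi chi_add[symmetric] by (rule arg_cong[of _ _ "chi P"]) (simp add: power2_eq_square algebra_simps)
      then show ?thesis by (simp add: F_def add.assoc[symmetric])
    qed
    then have "avg ?X (\<lambda>x. F x y * cnj (F x (y + a)))
       = avg ?X (\<lambda>x. g (x + y) * cnj (g (x + y + a))) * chi P (- \<Phi> * a\<^sup>2 + (- \<Phi> * (2 * a * y)))"
      by (simp only: avg_mult_right)
    also have "avg ?X (\<lambda>x. g (x + y) * cnj (g (x + y + a))) = c a"
      unfolding c_def by (rule avg_shift[where f = "\<lambda>x. g x * cnj (g (x + a))"]) (rule per_mult per_cnj per_shift g P0)+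
    also have "chi P (- \<Phi> * a\<^sup>2 + (- \<Phi> * (2 * a * y))) = chi P (- \<Phi> * a\<^sup>2) * e ((- of_int \<Phi> / of_int P) * of_int (2 * a * y))"
      unfolding chi_add by (simp add: chi_def)
    finally show ?thesis by (simp add: mult.assoc)
  qed
  have "\<delta>\<^sup>2 \<le> (norm (roth P M f g (\<lambda>n. chi P (\<Phi> * n))))\<^sup>2"
    by (rule power_mono) (use large \<delta> in auto)
  also have "roth P M f g (\<lambda>n. chi P (\<Phi> * n)) = avg ?X (\<lambda>x. f x * avg ?B (F x))"
    by (simp add: roth_def F_def mult.assoc avg_mult_left)
  also have "(norm \<dots>)\<^sup>2 \<le> norm (avg ?B (\<lambda>y. avg ?B (\<lambda>y'. avg ?X (\<lambda>x. F x y * cnj (F x y')))))"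
    by (rule cs_plain) (use f in \<open>auto simp: bdd1_def\<close>)
  also have "\<dots> \<le> 2 * norm (avg (diff_range M) (\<lambda>a. avg ?B (\<lambda>y. if y + a \<in> ?B then avg ?X (\<lambda>x. F x y * cnj (F x (y + a))) else 0)))"
    by (rule norm_avg_pairs_by_difference_le) (use M1 diff_range_diff in \<open>auto simp: card_diff_range\<close>)
  finally have "\<delta>\<^sup>2 \<le> 2 * norm (avg (diff_range M) (\<lambda>a. avg ?B (\<lambda>y. if y + a \<in> ?B
      then (c a * chi P (- \<Phi> * a\<^sup>2)) * e ((- of_int \<Phi> / of_int P) * of_int (2 * a * y)) else 0)))" by (simp only: FF)
  from quadratic_phase_major_arc[OF M \<delta> _ this] obtain q :: nat where q: "1 \<le> q" "real q \<le> (1 / \<delta>) ^ 60"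
      "nd (real q * (- of_int \<Phi> / of_int P)) \<le> (1 / \<delta>) ^ 60 / (real_of_int M)\<^sup>2"
    using c1 by (auto simp: norm_mult)
  have p7: "2 ^ 7 * (1 / \<delta>) ^ 60 \<le> (1 / \<delta>) ^ 67"
  proof -
    have "2 ^ 7 * (1 / \<delta>) ^ 60 \<le> (1 / \<delta>) ^ 7 * (1 / \<delta>) ^ 60"
      using y2 by (intro mult_right_mono power_mono) auto
    then show ?thesis by (simp only: power_add[symmetric]) simp
  qed
  have "(1 / \<delta>) ^ 60 \<le> (1 / \<delta>) ^ 67" by (rule power_increasing) (use y2 in auto)
  then have "real q \<le> (1 / \<delta>) ^ 67" using q(2) by linarith
  moreover have "nd (real q * (of_int \<Phi> / of_int P)) \<le> (1 / \<delta>) ^ 67 / of_int P"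
  proof -
    have "nd (real q * (of_int \<Phi> / of_int P)) = nd (- (real q * (- of_int \<Phi> / of_int P)))" by simp
    also have "\<dots> = nd (real q * (- of_int \<Phi> / of_int P))" by (rule nd_minus)
    also have "\<dots> \<le> (1 / \<delta>) ^ 60 / (real_of_int M)\<^sup>2" by (rule q(3))
    also have "\<dots> \<le> (2 ^ 7 * (1 / \<delta>) ^ 60) / of_int P"
    proof -
      have "real_of_int P \<le> real_of_int (128 * M\<^sup>2)" using P(2) by (simp only: of_int_le_iff)
      moreover have "(real_of_int M)\<^sup>2 > 0" "real_of_int P > 0" using M1 P0 by auto
      ultimately have "1 / (real_of_int M)\<^sup>2 \<le> 2 ^ 7 / real_of_int P" by (simp add: field_simps)
      then have "(1 / \<delta>) ^ 60 * (1 / (real_of_int M)\<^sup>2) \<le> (1 / \<delta>) ^ 60 * (2 ^ 7 / real_of_int P)"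
        by (rule mult_left_mono) (use \<delta> in auto)
      then show ?thesis by (simp only: times_divide_eq_right mult_1_right mult.commute[of "2 ^ 7"])
    qed
    also have "\<dots> \<le> (1 / \<delta>) ^ 67 / of_int P" using P0 by (intro divide_right_mono p7) simp
    finally show ?thesis .
  qed
  ultimately show ?thesis using q(1) by (auto simp: maj_def)
qed

section \<open>Degree lowering\<close>

text \<open>The product over a cube whose vertices take \<open>a_i\<close> or \<open>b_i\<close> in
  coordinate \<open>i\<close>, with one conjugation for each \<open>b_i\<close>. For lists of equal
  length, \<open>Dl\<close> is the case in which all \<open>b_i\<close> are 0.\<close>

fun D2 :: "int list \<Rightarrow> int list \<Rightarrow> (int \<Rightarrow> complex) \<Rightarrow> int \<Rightarrow> complex" where
  "D2 (a # as) (b # bs) u = D2 as bs (\<lambda>x. u (x + a) * cnj (u (x + b)))"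
| "D2 _ _ u = u"

text \<open>The frequency that results when the characters with frequencies \<open>\<phi>\<close>
  are multiplied over the same cube with the same conjugations.\<close>

fun altsum :: "int list \<Rightarrow> int list \<Rightarrow> (int list \<Rightarrow> int) \<Rightarrow> int" where
  "altsum (a # as) (b # bs) \<phi> = altsum as bs (\<lambda>l. \<phi> (a # l)) - altsum as bs (\<lambda>l. \<phi> (b # l))"
| "altsum _ _ \<phi> = \<phi> []"

lemma D2_mult: "D2 as bs (\<lambda>x. u x * v x) = (\<lambda>x. D2 as bs u x * D2 as bs v x)"
proof (induction as bs u arbitrary: v rule: D2.induct)
  case (1 a as b bs u)
  have "D2 (a # as) (b # bs) (\<lambda>x. u x * v x)
      = D2 as bs (\<lambda>x. (u (x + a) * cnj (u (x + b))) * (v (x + a) * cnj (v (x + b))))"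
    by (simp add: mult_ac)
  then show ?case by (simp only: 1 D2.simps)
qed simp_all

lemma D2_cnj: "D2 as bs (\<lambda>x. cnj (u x)) = (\<lambda>x. cnj (D2 as bs u x))"
proof (induction as bs u rule: D2.induct)
  case (1 a as b bs u)
  show ?case using 1 by simp
qed simp_all

lemma D2_shift: "D2 as bs (\<lambda>x. u (x + c)) = (\<lambda>x. D2 as bs u (x + c))"
proof (induction as bs u rule: D2.induct)
  case (1 a as b bs u)
  have "D2 (a # as) (b # bs) (\<lambda>x. u (x + c)) = D2 as bs (\<lambda>x. u (x + c + a) * cnj (u (x + c + b)))"
    by (simp add: add_ac)
  then show ?case using 1 by simp
qed simp_all

lemma per_D2: "per P u \<Longrightarrow> per P (D2 as bs u)"
  by (induction as bs u rule: D2.induct) (simp_all add: per_mult per_cnj per_shift)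

lemma bdd1_D2: "bdd1 u \<Longrightarrow> bdd1 (D2 as bs u)"
  by (induction as bs u rule: D2.induct) (simp_all add: bdd1_def norm_mult mult_le_one)

text \<open>Moves the average over \<open>y\<close> outside the derivatives. In
  \<open>D h1 F\<close> only the factor at \<open>x + h1\<close> is expanded into its average; the
  other one turns into \<open>D2 a b F x\<close>, a bounded factor free of \<open>y\<close> and
  \<open>h1\<close>, which Cauchy--Schwarz removes while doubling \<open>h1\<close>. So each
  parameter becomes a pair and \<open>\<phi>\<close> becomes an alternating sum. Of the two weights
  arising at each step the one at \<open>a\<close> is kept, the other being at most 1.\<close>

lemma dual_difference_interchange:
  fixes Fy :: "'y \<Rightarrow> int \<Rightarrow> complex" and c :: "int list \<Rightarrow> real"
  assumes "\<And>y. y \<in> Y \<Longrightarrow> bdd1 (Fy y)" "\<And>h. 0 \<le> c h" "\<And>h. c h \<le> 1"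
  shows "(avg (tup {0..<P} k) (\<lambda>h. c h * norm (avg {0..<P} (\<lambda>x. Dl h (\<lambda>x. avg Y (\<lambda>y. Fy y x)) x * chi P (\<phi> h * x))))) ^ (2 ^ k)
    \<le> avg (tup {0..<P} k) (\<lambda>a. avg (tup {0..<P} k) (\<lambda>b. c a *
        norm (avg Y (\<lambda>y. avg {0..<P} (\<lambda>x. D2 a b (Fy y) x * chi P (altsum a b \<phi> * x))))))"
  using assms
proof (induction k arbitrary: Fy \<phi> c)
  case 0
  have "avg {0..<P} (\<lambda>x. avg Y (\<lambda>y. Fy y x) * chi P (\<phi> [] * x)) = avg Y (\<lambda>y. avg {0..<P} (\<lambda>x. Fy y x * chi P (\<phi> [] * x)))"
    by (simp only: avg_mult_right[symmetric]) (rule avg_swap)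
  then show ?case by simp
next
  case (Suc k)
  let ?X = "{0..<P}" and ?T = "tup {0..<P} k"
  define F where "F = (\<lambda>x. avg Y (\<lambda>y. Fy y x))"
  have F: "bdd1 F" unfolding F_def by (rule bdd1_avg) (rule Suc.prems(1))
  define Fy' where "Fy' = (\<lambda>h1 y x. Fy y (x + h1) * cnj (F x))"
  have DF: "D h1 F = (\<lambda>x. avg Y (\<lambda>y. Fy' h1 y x))" for h1
    by (simp add: D_def Fy'_def avg_mult_right F_def)
  have bFy': "bdd1 (Fy' h1 y)" if "y \<in> Y" for h1 y
    using Suc.prems(1)[OF that] F by (simp add: bdd1_def Fy'_def norm_mult mult_le_one)
  define \<phi>' where "\<phi>' = (\<lambda>h1 l. \<phi> (h1 # l))"
  define N where "N = (\<lambda>h1 a b. norm (avg Y (\<lambda>y. avg ?X (\<lambda>x. D2 a b (Fy' h1 y) x * chi P (altsum a b (\<phi>' h1) * x)))))"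
  define Z where "Z = (\<lambda>h1. avg ?T (\<lambda>h. c (h1 # h) * norm (avg ?X (\<lambda>x. Dl h (D h1 F) x * chi P (\<phi> (h1 # h) * x)))))"
  have Z0: "0 \<le> Z h1" for h1 unfolding Z_def by (intro avg_nonneg mult_nonneg_nonneg Suc.prems(2)) simp
  have IH: "Z h1 ^ (2 ^ k) \<le> avg ?T (\<lambda>a. avg ?T (\<lambda>b. c (h1 # a) * N h1 a b))" for h1
    unfolding Z_def N_def DF using Suc.IH[of "Fy' h1" "\<lambda>l. c (h1 # l)" "\<phi>' h1"] bFy' Suc.prems(2,3) by (simp add: \<phi>'_def)
  have fixed: "(avg ?X (\<lambda>h1. c (h1 # a) * N h1 a b))\<^sup>2 \<le> avg ?X (\<lambda>h1. avg ?X (\<lambda>h2. c (h1 # a) *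
      norm (avg Y (\<lambda>y. avg ?X (\<lambda>x. D2 (h1 # a) (h2 # b) (Fy y) x * chi P (altsum (h1 # a) (h2 # b) \<phi> * x))))))" for a b
  proof -
    define V where "V = (\<lambda>(y, x) h1. of_real (c (h1 # a)) * (D2 a b (Fy y) (x + h1) * chi P (altsum a b (\<phi>' h1) * x)))"
    have "c (h1 # a) * N h1 a b = norm (avg (Y \<times> ?X) (\<lambda>p. cnj (D2 a b F (snd p)) * V p h1))" for h1
    proof -
      have "D2 a b (Fy' h1 y) x = D2 a b (Fy y) (x + h1) * cnj (D2 a b F x)" for y x
        unfolding Fy'_def D2_mult D2_cnj D2_shift ..
      then have "of_real (c (h1 # a)) * avg Y (\<lambda>y. avg ?X (\<lambda>x. D2 a b (Fy' h1 y) x * chi P (altsum a b (\<phi>' h1) * x)))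
          = avg (Y \<times> ?X) (\<lambda>p. cnj (D2 a b F (snd p)) * V p h1)"
        by (simp add: avg_Times V_def avg_mult_left[symmetric] mult_ac)
      then have "norm (complex_of_real (c (h1 # a)) * avg Y (\<lambda>y. avg ?X (\<lambda>x. D2 a b (Fy' h1 y) x * chi P (altsum a b (\<phi>' h1) * x))))
          = norm (avg (Y \<times> ?X) (\<lambda>p. cnj (D2 a b F (snd p)) * V p h1))" by (rule arg_cong)
      then show ?thesis using Suc.prems(2)[of "h1 # a"] by (simp add: norm_mult N_def)
    qed
    then have "(avg ?X (\<lambda>h1. c (h1 # a) * N h1 a b))\<^sup>2
        = (avg ?X (\<lambda>h1. norm (avg (Y \<times> ?X) (\<lambda>p. cnj (D2 a b F (snd p)) * V p h1))))\<^sup>2" by simp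
    also have "\<dots> \<le> avg ?X (\<lambda>h1. avg ?X (\<lambda>h2. norm (avg (Y \<times> ?X) (\<lambda>p. V p h1 * cnj (V p h2)))))"
      by (rule cs_phase) (use bdd1_D2[OF F] in \<open>simp add: bdd1_def\<close>)
    also have "\<dots> \<le> avg ?X (\<lambda>h1. avg ?X (\<lambda>h2. c (h1 # a) *
      norm (avg Y (\<lambda>y. avg ?X (\<lambda>x. D2 (h1 # a) (h2 # b) (Fy y) x * chi P (altsum (h1 # a) (h2 # b) \<phi> * x))))))"
    proof (intro avg_mono)
      fix h1 h2
      let ?S = "avg Y (\<lambda>y. avg ?X (\<lambda>x. D2 (h1 # a) (h2 # b) (Fy y) x * chi P (altsum (h1 # a) (h2 # b) \<phi> * x)))"
      have "V (y, x) h1 * cnj (V (y, x) h2) = of_real (c (h1 # a) * c (h2 # b')) *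
          (D2 (h1 # a) (h2 # b) (Fy y) x * chi P (altsum (h1 # a) (h2 # b) \<phi> * x))" if "b' = a" for y x b'
      proof -
        have "D2 (h1 # a) (h2 # b) (Fy y) x = D2 a b (Fy y) (x + h1) * cnj (D2 a b (Fy y) (x + h2))"
          by (simp add: D2_mult D2_cnj D2_shift)
        moreover have "chi P (altsum (h1 # a) (h2 # b) \<phi> * x) = chi P (altsum a b (\<phi>' h1) * x) * cnj (chi P (altsum a b (\<phi>' h2) * x))"
          unfolding cnj_chi chi_add[symmetric] by (simp add: \<phi>'_def left_diff_distrib)
        ultimately show ?thesis using that by (simp add: V_def)
      qed
      from this[OF refl] have "avg (Y \<times> ?X) (\<lambda>p. V p h1 * cnj (V p h2)) = of_real (c (h1 # a) * c (h2 # a)) * ?S"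
        by (simp only: avg_Times avg_mult_left)
      then have "norm (avg (Y \<times> ?X) (\<lambda>p. V p h1 * cnj (V p h2))) = c (h1 # a) * (c (h2 # a) * norm ?S)"
        using Suc.prems(2) by (simp only: norm_mult norm_of_real) (simp add: abs_mult)
      also have "\<dots> \<le> c (h1 # a) * norm ?S"
        by (intro mult_left_mono mult_left_le_one_le Suc.prems) auto
      finally show "norm (avg (Y \<times> ?X) (\<lambda>p. V p h1 * cnj (V p h2))) \<le> c (h1 # a) * norm ?S" .
    qed
    finally show ?thesis .
  qed
  have "(avg ?X Z) ^ (2 ^ Suc k) = ((avg ?X Z) ^ (2 ^ k))\<^sup>2" by (simp only: power_mult[symmetric] power_Suc mult.commute)
  also have "\<dots> \<le> (avg ?X (\<lambda>h1. avg ?T (\<lambda>a. avg ?T (\<lambda>b. c (h1 # a) * N h1 a b))))\<^sup>2"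
  proof (rule power_mono)
    have "(avg ?X Z) ^ (2 ^ k) \<le> avg ?X (\<lambda>h1. Z h1 ^ (2 ^ k))" by (rule avg_power_le) (rule Z0)
    also have "\<dots> \<le> avg ?X (\<lambda>h1. avg ?T (\<lambda>a. avg ?T (\<lambda>b. c (h1 # a) * N h1 a b)))" by (rule avg_mono) (rule IH)
    finally show "(avg ?X Z) ^ (2 ^ k) \<le> \<dots>" .
  qed (use Z0 in \<open>simp add: avg_nonneg\<close>)
  also have "avg ?X (\<lambda>h1. avg ?T (\<lambda>a. avg ?T (\<lambda>b. c (h1 # a) * N h1 a b)))
     = avg ?T (\<lambda>a. avg ?T (\<lambda>b. avg ?X (\<lambda>h1. c (h1 # a) * N h1 a b)))"
    by (subst avg_swap, rule avg_cong[OF refl], rule avg_swap)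
  also have "\<dots>\<^sup>2 \<le> avg ?T (\<lambda>a. (avg ?T (\<lambda>b. avg ?X (\<lambda>h1. c (h1 # a) * N h1 a b)))\<^sup>2)" by (rule avg_power2_le)
  also have "\<dots> \<le> avg ?T (\<lambda>a. avg ?T (\<lambda>b. (avg ?X (\<lambda>h1. c (h1 # a) * N h1 a b))\<^sup>2))"
    by (rule avg_mono, rule avg_power2_le)
  also have "\<dots> \<le> avg ?T (\<lambda>a. avg ?T (\<lambda>b. avg ?X (\<lambda>h1. avg ?X (\<lambda>h2. c (h1 # a) *
      norm (avg Y (\<lambda>y. avg ?X (\<lambda>x. D2 (h1 # a) (h2 # b) (Fy y) x * chi P (altsum (h1 # a) (h2 # b) \<phi> * x))))))))"
    by (rule avg_mono, rule avg_mono, rule fixed)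
  also have "\<dots> = avg ?T (\<lambda>a. avg ?X (\<lambda>h1. avg ?T (\<lambda>b. avg ?X (\<lambda>h2. c (h1 # a) *
      norm (avg Y (\<lambda>y. avg ?X (\<lambda>x. D2 (h1 # a) (h2 # b) (Fy y) x * chi P (altsum (h1 # a) (h2 # b) \<phi> * x))))))))"
    by (rule avg_cong[OF refl], rule avg_swap)
  also have "\<dots> = avg ?X (\<lambda>h1. avg ?T (\<lambda>a. avg ?T (\<lambda>b. avg ?X (\<lambda>h2. c (h1 # a) *
      norm (avg Y (\<lambda>y. avg ?X (\<lambda>x. D2 (h1 # a) (h2 # b) (Fy y) x * chi P (altsum (h1 # a) (h2 # b) \<phi> * x))))))))"
    by (rule avg_swap)
  also have "\<dots> = avg ?X (\<lambda>h1. avg ?T (\<lambda>a. avg ?X (\<lambda>h2. avg ?T (\<lambda>b. c (h1 # a) *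
      norm (avg Y (\<lambda>y. avg ?X (\<lambda>x. D2 (h1 # a) (h2 # b) (Fy y) x * chi P (altsum (h1 # a) (h2 # b) \<phi> * x))))))))"
    by (rule avg_cong[OF refl], rule avg_cong[OF refl], rule avg_swap)
  finally show ?case by (simp only: avg_tup_Suc Z_def Dl.simps F_def)
qed

text \<open>Products of functions of the list entries, each factor independent of at least one entry.\<close>
primrec miss :: "nat \<Rightarrow> (int list \<Rightarrow> complex) \<Rightarrow> bool" where
  "miss 0 p \<longleftrightarrow> p [] = 1"
| "miss (Suc k) p \<longleftrightarrow> (\<exists>q r. (\<forall>l. norm (q l) \<le> 1) \<and> (\<forall>h. miss k (r h)) \<and> (\<forall>h l. p (h # l) = q l * r h l))"

lemma miss_cnj: "miss k p \<Longrightarrow> miss k (\<lambda>l. cnj (p l))"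
proof (induction k arbitrary: p)
  case (Suc k)
  then obtain q r where "\<And>l. norm (q l) \<le> 1" "\<And>h. miss k (r h)" "\<And>h l. p (h # l) = q l * r h l" by auto
  then show ?case using Suc.IH
    by (auto intro!: exI[of _ "\<lambda>l. cnj (q l)"] exI[of _ "\<lambda>h l. cnj (r h l)"])
qed simp

lemma miss_mult: "miss k p \<Longrightarrow> miss k p' \<Longrightarrow> miss k (\<lambda>l. p l * p' l)"
proof (induction k arbitrary: p p')
  case (Suc k)
  obtain q r where 1: "\<And>l. norm (q l) \<le> 1" "\<And>h. miss k (r h)" "\<And>h l. p (h # l) = q l * r h l" using Suc.prems(1) by auto
  obtain q' r' where 2: "\<And>l. norm (q' l) \<le> 1" "\<And>h. miss k (r' h)" "\<And>h l. p' (h # l) = q' l * r' h l" using Suc.prems(2) by auto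
  have "norm (q l * q' l) \<le> 1" for l using 1(1) 2(1) by (simp add: norm_mult mult_le_one)
  moreover have "miss k (\<lambda>l. r h l * r' h l)" for h by (rule Suc.IH) (rule 1(2), rule 2(2))
  moreover have "p (h # l) * p' (h # l) = (q l * q' l) * (r h l * r' h l)" for h l by (simp add: 1(3) 2(3) mult_ac)
  ultimately show ?case unfolding miss.simps
    by (intro exI[of _ "\<lambda>l. q l * q' l"] exI[of _ "\<lambda>h l. r h l * r' h l"]) blast
qed simp

text \<open>\<open>\<phi> l\<close> is the vertex of the alternating sum at which nothing is
  replaced. At every other vertex some entry of \<open>l\<close> is replaced by an entry of
  \<open>bs\<close>, so the corresponding phase misses it.\<close>

lemma miss_altsum: "miss (length bs) (\<lambda>l. chi P ((\<phi> l - altsum l bs \<phi>) * t))"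
proof (induction bs arbitrary: \<phi>)
  case (Cons b bs)
  define q where "q = (\<lambda>l. chi P (altsum l bs (\<lambda>l. \<phi> (b # l)) * t))"
  define r where "r = (\<lambda>h l. chi P ((\<phi> (h # l) - altsum l bs (\<lambda>l. \<phi> (h # l))) * t))"
  have "miss (length bs) (r h)" for h unfolding r_def by (rule Cons.IH)
  moreover have "chi P ((\<phi> (h # l) - altsum (h # l) (b # bs) \<phi>) * t) = q l * r h l" for h l
    unfolding q_def r_def chi_add[symmetric] by (simp add: algebra_simps)
  moreover have "norm (q l) \<le> 1" for l by (simp add: q_def)
  ultimately show ?case unfolding list.size(4) add_Suc_right add_0_right miss.simps by blast
qed simp

text \<open>Cauchy--Schwarz in the first entry \<open>h\<close> removes \<open>q l\<close>, which
  does not see \<open>h\<close>; the factors \<open>r h\<close> keep their type with one entry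
  fewer, and \<open>u\<close> is replaced by a derivative. By induction all phases vanish and a
  plain Gowers norm, of order \<open>k + 1\<close>, remains.\<close>

lemma remove_lower_order:
  assumes "P > 0" "per P u" "bdd1 u" "miss (Suc k) p"
  shows "norm (avg (tup {0..<P} (Suc k)) (\<lambda>h. p h * avg {0..<P} (Dl h u))) ^ (2 ^ k) \<le> gowers P k u"
  using assms(2-4)
proof (induction k arbitrary: u p)
  case 0
  from 0(3) obtain q r where q: "\<And>l. norm (q l) \<le> 1" and p: "\<And>h l. p (h # l) = q l * r h l" and r: "\<And>h. r h [] = 1" by auto
  have "avg (tup {0..<P} (Suc 0)) (\<lambda>h. p h * avg {0..<P} (Dl h u)) = q [] * complex_of_real ((norm (avg {0..<P} u))\<^sup>2)"
    by (simp add: avg_tup_Suc p r avg_mult_left avg_D[OF 0(1) assms(1), simplified])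
  then have "norm (avg (tup {0..<P} (Suc 0)) (\<lambda>h. p h * avg {0..<P} (Dl h u))) = norm (q []) * (norm (avg {0..<P} u))\<^sup>2"
    by (simp add: norm_mult norm_power)
  also have "\<dots> \<le> (norm (avg {0..<P} u))\<^sup>2" by (rule mult_left_le_one_le) (auto intro: q)
  finally show ?case by (simp add: gowers_def)
next
  case (Suc k)
  let ?X = "{0..<P}" and ?T = "tup {0..<P} (Suc k)"
  note u = Suc.prems(1) and bu = Suc.prems(2)
  from Suc.prems(3) obtain q r where q: "\<And>l. norm (q l) \<le> 1" and p: "\<And>h l. p (h # l) = q l * r h l"
    and r: "\<And>h. miss (Suc k) (r h)" unfolding miss.simps(2)[of "Suc k"] by blast
  define W where "W = (\<lambda>(l, x) h. r h l * Dl l u (x + h))"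
  define v where "v = (\<lambda>h h' x. u (x + h) * cnj (u (x + h')))"
  define I where "I = (\<lambda>h h'. avg ?T (\<lambda>l. (r h l * cnj (r h' l)) * avg ?X (Dl l (v h h'))))"
  have DlD: "Dl l (D h u) x = cnj (Dl l u x) * Dl l u (x + h)" for l h x
    unfolding D_def Dl_mult Dl_cnj Dl_shift by simp
  have pv: "per P (v h h')" for h h' unfolding v_def by (rule per_mult per_cnj per_shift u)+
  have "avg (tup ?X (Suc (Suc k))) (\<lambda>h. p h * avg ?X (Dl h u)) = avg ?X (\<lambda>h. avg ?T (\<lambda>l. avg ?X (\<lambda>x. q l * cnj (Dl l u x) * (r h l * Dl l u (x + h)))))"
    unfolding avg_tup_Suc[of ?X "Suc k"] p Dl.simps DlD avg_mult_left[symmetric] by (simp add: mult_ac)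
  also have "\<dots> = avg ?X (\<lambda>h. avg (?T \<times> ?X) (\<lambda>z. (case z of (l, x) \<Rightarrow> q l * cnj (Dl l u x)) * W z h))"
    by (simp only: avg_Times W_def case_prod_conv)
  also have "\<dots> = avg (?T \<times> ?X) (\<lambda>z. avg ?X (\<lambda>h. (case z of (l, x) \<Rightarrow> q l * cnj (Dl l u x)) * W z h))" by (rule avg_swap)
  also have "\<dots> = avg (?T \<times> ?X) (\<lambda>z. (case z of (l, x) \<Rightarrow> q l * cnj (Dl l u x)) * avg ?X (W z))" by (simp only: avg_mult_left)
  finally have "(norm (avg (tup ?X (Suc (Suc k))) (\<lambda>h. p h * avg ?X (Dl h u))))\<^sup>2
     = (norm (avg (?T \<times> ?X) (\<lambda>z. (case z of (l, x) \<Rightarrow> q l * cnj (Dl l u x)) * avg ?X (W z))))\<^sup>2" by simp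
  also have "\<dots> \<le> norm (avg ?X (\<lambda>h. avg ?X (\<lambda>h'. avg (?T \<times> ?X) (\<lambda>z. W z h * cnj (W z h')))))"
    by (rule cs_plain) (use q bdd1_Dl[OF bu] in \<open>auto simp: bdd1_def norm_mult intro!: mult_le_one\<close>)
  also have "\<dots> = norm (avg ?X (\<lambda>h. avg ?X (\<lambda>h'. I h h')))"
  proof -
    have "avg (?T \<times> ?X) (\<lambda>z. W z h * cnj (W z h')) = I h h'" for h h'
    proof -
      have "Dl l (v h h') x = Dl l u (x + h) * cnj (Dl l u (x + h'))" for l x
        unfolding v_def Dl_mult Dl_cnj Dl_shift ..
      then show ?thesis unfolding I_def avg_mult_left[symmetric] by (simp add: avg_Times W_def mult_ac)
    qed
    then show ?thesis by simp
  qed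
  also have "\<dots> \<le> avg (?X \<times> ?X) (\<lambda>(h, h'). norm (I h h'))"
    unfolding avg_Times case_prod_conv by (rule order_trans[OF norm_avg_le], rule avg_mono, rule norm_avg_le)
  finally have 1: "(norm (avg (tup ?X (Suc (Suc k))) (\<lambda>h. p h * avg ?X (Dl h u))))\<^sup>2 \<le> avg (?X \<times> ?X) (\<lambda>(h, h'). norm (I h h'))" .
  have 2: "norm (I h h') ^ (2 ^ k) \<le> avg (tup ?X k) (\<lambda>ts. (norm (avg ?X (Dl ts (D (h - h') u))))\<^sup>2)" for h h'
  proof -
    have "norm (I h h') ^ (2 ^ k) \<le> gowers P k (v h h')"
      unfolding I_def by (rule Suc.IH[OF pv _ miss_mult[OF r miss_cnj[OF r]]])
        (use bu in \<open>auto simp: bdd1_def v_def norm_mult mult_le_one\<close>)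
    also have "\<dots> = avg (tup ?X k) (\<lambda>ts. (norm (avg ?X (Dl ts (D (h - h') u))))\<^sup>2)"
      unfolding gowers_def v_def Dl_mult Dl_cnj Dl_shift Dl_D by (simp only: avg_translates[OF per_Dl[OF u] assms(1)])
    finally show ?thesis .
  qed
  have "norm (avg (tup ?X (Suc (Suc k))) (\<lambda>h. p h * avg ?X (Dl h u))) ^ (2 ^ Suc k)
     = ((norm (avg (tup ?X (Suc (Suc k))) (\<lambda>h. p h * avg ?X (Dl h u))))\<^sup>2) ^ (2 ^ k)"
    by (simp only: power_mult[symmetric] power_Suc mult.commute)
  also have "\<dots> \<le> (avg (?X \<times> ?X) (\<lambda>(h, h'). norm (I h h'))) ^ (2 ^ k)" by (rule power_mono[OF 1]) simp
  also have "\<dots> \<le> avg (?X \<times> ?X) (\<lambda>z. (case z of (h, h') \<Rightarrow> norm (I h h')) ^ (2 ^ k))"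
    by (rule avg_power_le) auto
  also have "\<dots> = avg ?X (\<lambda>h. avg ?X (\<lambda>h'. norm (I h h') ^ (2 ^ k)))" by (simp only: avg_Times case_prod_conv)
  also have "\<dots> \<le> avg ?X (\<lambda>h. avg ?X (\<lambda>h'. avg (tup ?X k) (\<lambda>ts. (norm (avg ?X (Dl ts (D (h - h') u))))\<^sup>2)))"
    by (rule avg_mono, rule avg_mono, rule 2)
  also have "\<dots> = avg ?X (\<lambda>h'. avg ?X (\<lambda>h. avg (tup ?X k) (\<lambda>ts. (norm (avg ?X (Dl ts (D (h - h') u))))\<^sup>2)))"
    by (rule avg_swap)
  also have "\<dots> = avg ?X (\<lambda>h'. avg ?X (\<lambda>t. avg (tup ?X k) (\<lambda>ts. (norm (avg ?X (Dl ts (D t u))))\<^sup>2)))"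
  proof (rule avg_cong[OF refl])
    fix h'
    have "per P (\<lambda>t. avg (tup ?X k) (\<lambda>ts. (norm (avg ?X (Dl ts (D t u))))\<^sup>2))"
      by (simp add: per_def per_add_dir[OF u])
    from avg_shift_diff[OF this assms(1)]
    show "avg ?X (\<lambda>h. avg (tup ?X k) (\<lambda>ts. (norm (avg ?X (Dl ts (D (h - h') u))))\<^sup>2))
      = avg ?X (\<lambda>t. avg (tup ?X k) (\<lambda>ts. (norm (avg ?X (Dl ts (D t u))))\<^sup>2))" .
  qed
  also have "\<dots> = gowers P (Suc k) u"
    using assms(1) by (simp add: gowers_def avg_tup_Suc avg_const)
  finally show ?case .
qed

text \<open>Collects the configurations whose third point is \<open>x\<close>, so that pairing with
  \<open>h\<close> gives \<open>roth P M f g h\<close> (\<open>avg_dualF_mult\<close>).\<close>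

definition dualF :: "int \<Rightarrow> (int \<Rightarrow> complex) \<Rightarrow> (int \<Rightarrow> complex) \<Rightarrow> int \<Rightarrow> complex" where
  "dualF M f g = (\<lambda>x. avg {1..M} (\<lambda>y. f (x - y\<^sup>2) * g (x - y\<^sup>2 + y)))"

lemma per_dualF: "per P f \<Longrightarrow> per P g \<Longrightarrow> per P (dualF M f g)"
  unfolding dualF_def
proof (rule per_avg, rule per_mult)
  fix y assume "per P f" "per P g"
  then show "per P (\<lambda>x. f (x - y\<^sup>2))" by (intro per_shift_diff)
  have "per P (\<lambda>x. g (x + (y - y\<^sup>2)))" using \<open>per P g\<close> by (rule per_shift)
  then show "per P (\<lambda>x. g (x - y\<^sup>2 + y))" by (simp add: algebra_simps)
qed

lemma bdd1_dualF: "bdd1 f \<Longrightarrow> bdd1 g \<Longrightarrow> bdd1 (dualF M f g)"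
  unfolding dualF_def by (rule bdd1_avg) (simp add: bdd1_def norm_mult mult_le_one)

lemma avg_dual_eq_roth:
  assumes "per P f" "per P g" "per P h" "P > 0"
  shows "avg {1..M} (\<lambda>y. avg {0..<P} (\<lambda>x. f (x - y\<^sup>2) * g (x - y\<^sup>2 + y) * h x)) = roth P M f g h"
proof -
  have "avg {0..<P} (\<lambda>x. f (x - y\<^sup>2) * g (x - y\<^sup>2 + y) * h x) = avg {0..<P} (\<lambda>x. f x * g (x + y) * h (x + y\<^sup>2))" for y
  proof -
    have "per P (\<lambda>x. f x * g (x + y) * h (x + y\<^sup>2))" by (rule per_mult per_shift assms)+
    from avg_shift_diff[OF this assms(4), of "y\<^sup>2"] show ?thesis by simp
  qed
  then have "avg {1..M} (\<lambda>y. avg {0..<P} (\<lambda>x. f (x - y\<^sup>2) * g (x - y\<^sup>2 + y) * h x))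
     = avg {1..M} (\<lambda>y. avg {0..<P} (\<lambda>x. f x * g (x + y) * h (x + y\<^sup>2)))" by simp
  also have "\<dots> = roth P M f g h" unfolding roth_def by (rule avg_swap)
  finally show ?thesis .
qed

lemma avg_dualF_mult:
  assumes "per P f" "per P g" "per P h" "P > 0"
  shows "avg {0..<P} (\<lambda>x. dualF M f g x * h x) = roth P M f g h"
  unfolding avg_dual_eq_roth[OF assms, symmetric] dualF_def avg_mult_right[symmetric] by (rule avg_swap)

text \<open>A large norm of order \<open>k + 3\<close> gives, for many \<open>h\<close>, a large
  Fourier coefficient of \<open>Dl h F\<close> at some frequency \<open>\<phi> h\<close>. Arbitrary
  \<open>\<phi>\<close> would be useless, but the interchange shows that \<open>\<phi>\<close> is,
  up to boundedly many major arc frequencies, a sum of terms that each miss an entry of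
  \<open>h\<close>. Such terms can be removed, which leaves a norm of order
  \<open>k + 2\<close>.\<close>

lemma degree_lowering_step:
  fixes P M :: int and \<delta> :: real and k :: nat
  defines "j \<equiv> 2 ^ Suc k + 1"
  defines "K \<equiv> (202 * j + 4) * (2 * 2 ^ k)"
  assumes \<delta>: "0 < \<delta>" "\<delta> \<le> 1 / 2" and M: "(1 / \<delta>) ^ K \<le> real_of_int M"
    and P: "32 * M\<^sup>2 \<le> P" "P \<le> 128 * M\<^sup>2"
    and f: "per P f" "bdd1 f" and g: "per P g" "bdd1 g"
    and large: "\<delta> \<le> gowers P (Suc (Suc k)) (dualF M f g)"
  shows "\<delta> ^ K \<le> gowers P (Suc k) (dualF M f g)"
proof -
  let ?X = "{0..<P}" and ?T = "tup {0..<P} (Suc k)" and ?B = "{1..M}"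
  define F where "F = dualF M f g"
  have y1: "1 / \<delta> \<ge> 1" using \<delta> by (simp add: field_simps)
  have "1 \<le> (1 / \<delta>) ^ K" using y1 by (rule one_le_power)
  then have M1: "M \<ge> 1" using M by linarith
  have P0: "P > 0" using P M1 by (smt (verit) zero_less_power)
  have X: "finite ?X" "?X \<noteq> {}" using P0 by auto
  have T: "finite ?T" "?T \<noteq> {}" using X by simp_all
  have F: "per P F" "bdd1 F" unfolding F_def using f g by (auto intro: per_dualF bdd1_dualF)
  have "\<exists>\<xi>. avg ?X (\<lambda>t. (norm (avg ?X (D t (Dl h F))))\<^sup>2) \<le> (norm (ft P (Dl h F) \<xi>))\<^sup>2" for h
    using F by (intro gowers_U2_le_ft P0) auto
  then obtain \<phi> where \<phi>: "\<And>h. avg ?X (\<lambda>t. (norm (avg ?X (D t (Dl h F))))\<^sup>2) \<le> (norm (ft P (Dl h F) (\<phi> h)))\<^sup>2" by metis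
  define c where "c = (\<lambda>h. norm (ft P (Dl h F) (\<phi> h)))"
  have c: "0 \<le> c h" "c h \<le> 1" for h
  proof -
    show "0 \<le> c h" by (simp add: c_def)
    have "bdd1 (Dl h F)" using F by auto
    then show "c h \<le> 1" unfolding c_def ft_def by (intro bdd1_avg_norm) (simp add: bdd1_def norm_mult)
  qed
  have "\<delta> \<le> avg ?X (\<lambda>t. avg ?T (\<lambda>h. (norm (avg ?X (D t (Dl h F))))\<^sup>2))"
    using large by (simp add: gowers_def avg_tup_Suc[of _ "Suc k"] Dl_D F_def)
  also have "\<dots> = avg ?T (\<lambda>h. avg ?X (\<lambda>t. (norm (avg ?X (D t (Dl h F))))\<^sup>2))" by (rule avg_swap)
  also have "\<dots> \<le> avg ?T (\<lambda>h. (c h)\<^sup>2)" unfolding c_def by (rule avg_mono[OF \<phi>])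
  finally have \<delta>c: "\<delta> \<le> avg ?T (\<lambda>h. c h * c h)" by (simp only: power2_eq_square)
  \<comment> \<open>the interchange forces alternating sums of the frequencies \<open>\<phi>\<close> onto major arcs\<close>
  define N where "N = (\<lambda>a b. norm (roth P M (D2 a b f) (D2 a b g) (\<lambda>n. chi P (altsum a b \<phi> * n))))"
  have N1: "N a b \<le> 1" for a b
  proof -
    have "bdd1 (D2 a b f)" "bdd1 (D2 a b g)" by (rule bdd1_D2[OF f(2)], rule bdd1_D2[OF g(2)])
    then show ?thesis unfolding N_def roth_def
      by (intro norm_avg_le_bound) (auto simp: norm_mult bdd1_def intro!: mult_le_one)
  qed
  define Fy where "Fy = (\<lambda>y x. f (x - y\<^sup>2) * g (x - y\<^sup>2 + y))"
  have Fy_eq: "dualF M f g = (\<lambda>x. avg ?B (\<lambda>y. Fy y x))" by (simp add: dualF_def Fy_def)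
  have NF: "norm (avg ?B (\<lambda>y. avg ?X (\<lambda>x. D2 a b (Fy y) x * chi P (altsum a b \<phi> * x)))) = N a b" for a b
  proof -
    have "D2 a b (Fy y) x = D2 a b f (x - y\<^sup>2) * D2 a b g (x - y\<^sup>2 + y)" for y x
      using D2_mult[of a b "\<lambda>x. f (x + (- y\<^sup>2))" "\<lambda>x. g (x + (y - y\<^sup>2))"] unfolding D2_shift Fy_def
      by (simp add: algebra_simps)
    then show ?thesis unfolding N_def
      using avg_dual_eq_roth[OF per_D2[OF f(1), of a b] per_D2[OF g(1), of a b] per_chi_mult P0, of M "altsum a b \<phi>"] by simp
  qed
  have "\<delta> ^ (2 ^ Suc k) \<le> (avg ?T (\<lambda>h. c h * c h)) ^ (2 ^ Suc k)" by (rule power_mono[OF \<delta>c]) (use \<delta> in simp)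
  also have "\<dots> = (avg ?T (\<lambda>h. c h * norm (avg ?X (\<lambda>x. Dl h (\<lambda>x. avg ?B (\<lambda>y. Fy y x)) x * chi P (\<phi> h * x))))) ^ (2 ^ Suc k)"
    by (simp only: c_def ft_def F_def Fy_eq)
  also have "\<dots> \<le> avg ?T (\<lambda>a. avg ?T (\<lambda>b. c a * norm (avg ?B (\<lambda>y. avg ?X (\<lambda>x. D2 a b (Fy y) x * chi P (altsum a b \<phi> * x))))))"
    by (rule dual_difference_interchange) (use c f g in \<open>auto simp: bdd1_def Fy_def norm_mult mult_le_one\<close>)
  also have "\<dots> = avg ?T (\<lambda>a. avg ?T (\<lambda>b. c a * N a b))" by (simp only: NF)
  finally have cN: "\<delta> ^ (2 ^ Suc k) \<le> avg ?T (\<lambda>a. avg ?T (\<lambda>b. c a * N a b))" .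
  \<comment> \<open>The extra 1 in \<open>j\<close> provides
    \<open>2 * \<eta> \<le> \<delta> ^ (2 ^ Suc k)\<close>: terms below \<open>\<eta>\<close> may be
    discarded and \<open>\<eta>\<close> is still left.\<close>
  define \<eta> where "\<eta> = \<delta> ^ j"
  have \<eta>: "0 < \<eta>" "\<eta> \<le> 1 / 2" "2 * \<eta> \<le> \<delta> ^ (2 ^ Suc k)"
  proof -
    show "0 < \<eta>" "\<eta> \<le> 1 / 2" unfolding \<eta>_def j_def
      by (rule zero_less_power[OF \<delta>(1)], rule pow_half_le[OF \<delta>]) simp
    have "\<delta> ^ (2 ^ Suc k) * (2 * \<delta>) \<le> \<delta> ^ (2 ^ Suc k) * 1"
      by (rule mult_left_mono) (use \<delta> in auto)
    then show "2 * \<eta> \<le> \<delta> ^ (2 ^ Suc k)" by (simp add: \<eta>_def j_def mult_ac)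
  qed
  define R where "R = (1 / \<eta>) ^ 67"
  have R1: "R \<ge> 1" unfolding R_def by (rule one_le_power) (use \<eta> in \<open>simp add: field_simps\<close>)
  have M\<eta>: "(1 / \<eta>) ^ 60 \<le> real_of_int M"
  proof -
    have "(1 / \<eta>) ^ 60 = (1 / \<delta>) ^ (j * 60)" by (simp add: \<eta>_def power_divide power_mult)
    also have "\<dots> \<le> (1 / \<delta>) ^ K"
    proof (rule power_increasing)
      have "j * 60 \<le> (202 * j + 4) * 1" by simp
      also have "\<dots> \<le> K" unfolding K_def by (rule mult_le_mono2) simp
      finally show "j * 60 \<le> K" .
    qed (use y1 in simp)
    finally show ?thesis using M by simp
  qed
  define mj where "mj = (\<lambda>a b. if maj P R (altsum a b \<phi>) then 1 else (0::real))"
  have "c a * N a b \<le> c a * mj a b + \<eta>" for a b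
  proof (cases "\<eta> \<le> N a b")
    case True
    have "maj P R (altsum a b \<phi>)" unfolding R_def
      by (rule roth_major_arc[OF M\<eta> \<eta>(1,2) P bdd1_D2[OF f(2)] per_D2[OF g(1)] bdd1_D2[OF g(2)] True[unfolded N_def]])
    then have "c a * N a b \<le> c a * mj a b" using N1 c by (intro mult_left_mono) (auto simp: mj_def)
    then show ?thesis using \<eta> by linarith
  next
    case False
    have "c a * N a b \<le> 1 * N a b" using c by (intro mult_right_mono) (auto simp: N_def)
    moreover have "0 \<le> c a * mj a b" using c by (simp add: mj_def)
    ultimately show ?thesis using False by linarith
  qed
  then have "avg ?T (\<lambda>a. avg ?T (\<lambda>b. c a * N a b)) \<le> avg ?T (\<lambda>a. avg ?T (\<lambda>b. c a * mj a b + \<eta>))"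
    by (intro avg_mono)
  also have "\<dots> = avg ?T (\<lambda>a. avg ?T (\<lambda>b. c a * mj a b)) + \<eta>" by (simp only: avg_add avg_const[OF T])
  also have "avg ?T (\<lambda>a. avg ?T (\<lambda>b. c a * mj a b)) = avg ?T (\<lambda>b. avg ?T (\<lambda>a. c a * mj a b))" by (rule avg_swap)
  finally have "\<eta> \<le> avg ?T (\<lambda>b. avg ?T (\<lambda>a. c a * mj a b))" using cN \<eta> by linarith
  moreover obtain b where b: "b \<in> ?T" "avg ?T (\<lambda>b. avg ?T (\<lambda>a. c a * mj a b)) \<le> avg ?T (\<lambda>a. c a * mj a b)"
    using avg_exists_ge[OF T, of "\<lambda>b. avg ?T (\<lambda>a. c a * mj a b)"] by blast
  ultimately have b\<eta>: "\<eta> \<le> avg ?T (\<lambda>a. c a * mj a b)" by linarith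
  have lenb: "length b = Suc k" using b(1) by (simp add: tup_def)
  \<comment> \<open>so \<open>\<phi> a\<close> is a fixed major arc frequency plus terms each missing an entry of \<open>a\<close>\<close>
  define Mj where "Mj = {\<xi> \<in> ?X. maj P R \<xi>}"
  have finMj: "finite Mj" unfolding Mj_def by (rule finite_subset[of _ ?X]) auto
  define ind where "ind = (\<lambda>m a. if altsum a b \<phi> mod P = m then 1 else (0::real))"
  have "c a * mj a b \<le> (\<Sum>m\<in>Mj. c a * ind m a)" for a
  proof (cases "maj P R (altsum a b \<phi>)")
    case True
    then have "altsum a b \<phi> mod P \<in> Mj" using per_mod[OF per_maj[OF P0], of R "altsum a b \<phi>"] P0 by (simp add: Mj_def)
    then have "(\<Sum>m\<in>Mj. c a * ind m a) = c a" using finMj by (simp add: ind_def sum.delta' if_distrib cong: if_cong)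
    then show ?thesis by (simp add: mj_def True)
  next
    case False
    have "0 \<le> (\<Sum>m\<in>Mj. c a * ind m a)" by (intro sum_nonneg mult_nonneg_nonneg c) (simp add: ind_def)
    then show ?thesis using False by (simp add: mj_def)
  qed
  then have "avg ?T (\<lambda>a. c a * mj a b) \<le> avg ?T (\<lambda>a. \<Sum>m\<in>Mj. c a * ind m a)" by (intro avg_mono)
  also have "\<dots> = (\<Sum>m\<in>Mj. avg ?T (\<lambda>a. c a * ind m a))"
    unfolding avg_def by (simp add: sum_divide_distrib sum.swap[of _ Mj])
  finally have sum\<eta>: "\<eta> \<le> (\<Sum>m\<in>Mj. avg ?T (\<lambda>a. c a * ind m a))" using b\<eta> by linarith
  \<comment> \<open>At most \<open>9 * R ^ 3\<close> residues lie on major arcs, so one of them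
    carries its share of the average.\<close>
  have "\<exists>m\<in>Mj. \<eta> / (9 * R ^ 3) \<le> avg ?T (\<lambda>a. c a * ind m a)"
  proof (rule ccontr)
    assume "\<not> ?thesis"
    then have lt: "\<And>m. m \<in> Mj \<Longrightarrow> avg ?T (\<lambda>a. c a * ind m a) < \<eta> / (9 * R ^ 3)" by force
    have "Mj \<noteq> {}" using sum\<eta> \<eta> by auto
    then have "(\<Sum>m\<in>Mj. avg ?T (\<lambda>a. c a * ind m a)) < (\<Sum>m\<in>Mj. \<eta> / (9 * R ^ 3))"
      by (intro sum_strict_mono finMj lt)
    also have "\<dots> = real (card Mj) * (\<eta> / (9 * R ^ 3))" by simp
    also have "\<dots> \<le> (9 * R ^ 3) * (\<eta> / (9 * R ^ 3))"
      unfolding Mj_def by (intro mult_right_mono card_maj P0 R1) (use \<eta> R1 in auto)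
    also have "\<dots> = \<eta>" using R1 by simp
    finally show False using sum\<eta> by simp
  qed
  then obtain m where m: "\<eta> / (9 * R ^ 3) \<le> avg ?T (\<lambda>a. c a * ind m a)" by blast
  define \<psi> where "\<psi> = (\<lambda>a. (\<phi> a - altsum a b \<phi>) + m)"
  define W where "W = avg ?T (\<lambda>a. (norm (ft P (Dl a F) (\<psi> a)))\<^sup>2)"
  have "(\<eta> / (9 * R ^ 3))\<^sup>2 \<le> (avg ?T (\<lambda>a. c a * ind m a))\<^sup>2"
    by (rule power_mono[OF m]) (use \<eta> R1 in simp)
  also have "\<dots> \<le> avg ?T (\<lambda>a. (c a * ind m a)\<^sup>2)" by (rule avg_power2_le)
  \<comment> \<open>Where \<open>ind m a = 1\<close>, the frequencies \<open>\<psi> a\<close> and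
    \<open>\<phi> a\<close> agree modulo \<open>P\<close>; elsewhere the left side vanishes.\<close>
  also have "\<dots> \<le> W" unfolding W_def
  proof (rule avg_mono)
    fix a
    show "(c a * ind m a)\<^sup>2 \<le> (norm (ft P (Dl a F) (\<psi> a)))\<^sup>2"
    proof (cases "altsum a b \<phi> mod P = m")
      case True
      have "chi P (\<psi> a * x) = chi P (\<phi> a * x)" for x
      proof -
        define z where "z = altsum a b \<phi> div P"
        have "altsum a b \<phi> = m + P * z" using mod_mult_div_eq[of "altsum a b \<phi>" P] True by (simp add: z_def)
        then have "\<phi> a * x = \<psi> a * x + P * (z * x)" by (simp add: \<psi>_def algebra_simps)
        then show ?thesis by (simp only: chi_add chi_multiple mult_1_right)
      qed
      then show ?thesis using True by (simp add: c_def ind_def ft_def)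
    qed (simp add: ind_def)
  qed
  finally have \<eta>W: "(\<eta> / (9 * R ^ 3))\<^sup>2 \<le> W" .
  define p where "p = (\<lambda>t a. chi P ((\<phi> a - altsum a b \<phi>) * t))"
  define I where "I = (\<lambda>t. avg ?T (\<lambda>a. p t a * avg ?X (Dl a (D t F))))"
  \<comment> \<open>Writing the squared coefficient as the transform of an autocorrelation turns the
    frequency into a phase in a new variable \<open>t\<close>. For each \<open>t\<close> the terms
    missing an entry then multiply derivatives of \<open>D t F\<close>, to which
    \<open>remove_lower_order\<close> applies.\<close>
  have "complex_of_real W = avg ?T (\<lambda>a. ft P (\<lambda>t. avg ?X (D t (Dl a F))) (\<psi> a))"
  proof -
    have "ft P (\<lambda>t. avg ?X (D t (Dl a F))) (\<psi> a) = complex_of_real ((norm (ft P (Dl a F) (\<psi> a)))\<^sup>2)" for a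
      using F by (intro ft_avg_D P0) auto
    then show ?thesis by (simp only: W_def avg_of_real)
  qed
  also have "\<dots> = avg ?T (\<lambda>a. avg ?X (\<lambda>t. chi P (m * t) * (p t a * avg ?X (Dl a (D t F)))))"
  proof -
    have "chi P (\<psi> a * t) = chi P (m * t) * p t a" for a t
      unfolding p_def \<psi>_def distrib_right chi_add by (rule mult.commute)
    then show ?thesis by (simp add: ft_def Dl_D mult_ac)
  qed
  also have "\<dots> = avg ?X (\<lambda>t. avg ?T (\<lambda>a. chi P (m * t) * (p t a * avg ?X (Dl a (D t F)))))" by (rule avg_swap)
  also have "\<dots> = avg ?X (\<lambda>t. chi P (m * t) * I t)" by (simp only: avg_mult_left I_def)
  finally have "W = Re (avg ?X (\<lambda>t. chi P (m * t) * I t))" by (metis Re_complex_of_real)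
  also have "\<dots> \<le> norm (avg ?X (\<lambda>t. chi P (m * t) * I t))" by (rule complex_Re_le_cmod)
  also have "\<dots> \<le> avg ?X (\<lambda>t. norm (I t))" by (rule order_trans[OF norm_avg_le]) (simp add: norm_mult)
  finally have WI: "W \<le> avg ?X (\<lambda>t. norm (I t))" .
  have II: "norm (I t) ^ (2 ^ k) \<le> gowers P k (D t F)" for t
  proof -
    have "miss (Suc k) (p t)" using miss_altsum[of b P \<phi> t] by (simp only: lenb p_def)
    then show ?thesis unfolding I_def using F by (intro remove_lower_order P0) auto
  qed
  have "((\<eta> / (9 * R ^ 3))\<^sup>2) ^ (2 ^ k) \<le> (avg ?X (\<lambda>t. norm (I t))) ^ (2 ^ k)"
    by (rule power_mono) (use \<eta>W WI in auto)
  also have "\<dots> \<le> avg ?X (\<lambda>t. norm (I t) ^ (2 ^ k))" by (rule avg_power_le) simp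
  also have "\<dots> \<le> avg ?X (\<lambda>t. gowers P k (D t F))" by (rule avg_mono[OF II])
  also have "\<dots> = gowers P (Suc k) (dualF M f g)" by (simp add: gowers_def avg_tup_Suc F_def)
  finally have fin: "((\<eta> / (9 * R ^ 3))\<^sup>2) ^ (2 ^ k) \<le> gowers P (Suc k) (dualF M f g)" .
  \<comment> \<open>With \<open>R = (1 / \<eta>) ^ 67\<close> the right side is
    \<open>\<eta> ^ 202 / 9\<close>, and \<open>9 \<le> (1 / \<delta>) ^ 4\<close>.\<close>
  have "\<delta> ^ (202 * j + 4) \<le> \<eta> / (9 * R ^ 3)"
  proof -
    have "\<delta> ^ 4 \<le> (1 / 2) ^ 4" by (rule power_mono) (use \<delta> in auto)
    also have "\<dots> = (1::real) / 16" by (simp add: power_divide)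
    finally have "9 * \<delta> ^ 4 \<le> 1" by linarith
    then have "\<eta> ^ 202 * (9 * \<delta> ^ 4) \<le> \<eta> ^ 202 * 1" by (rule mult_left_mono) (use \<eta> in simp)
    moreover have "\<eta> ^ 202 = \<eta> * \<eta> ^ 201" by (simp flip: power_Suc)
    ultimately have "9 * (\<eta> ^ 202 * \<delta> ^ 4) \<le> \<eta> * \<eta> ^ 201" by simp
    moreover have "\<eta> ^ 201 * R ^ 3 = 1" using \<eta> by (simp add: R_def power_divide flip: power_mult)
    ultimately have "9 * (\<eta> ^ 202 * \<delta> ^ 4) * R ^ 3 \<le> \<eta>"
      using mult_right_mono[of "9 * (\<eta> ^ 202 * \<delta> ^ 4)" "\<eta> * \<eta> ^ 201" "R ^ 3"] R1 by (simp add: mult.assoc)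
    then have "\<eta> ^ 202 * \<delta> ^ 4 \<le> \<eta> / (9 * R ^ 3)" using R1 by (simp add: pos_le_divide_eq mult_ac)
    moreover have "\<eta> ^ 202 * \<delta> ^ 4 = \<delta> ^ (202 * j + 4)" by (simp add: \<eta>_def power_add mult.commute flip: power_mult)
    ultimately show ?thesis by simp
  qed
  then have "((\<delta> ^ (202 * j + 4))\<^sup>2) ^ (2 ^ k) \<le> ((\<eta> / (9 * R ^ 3))\<^sup>2) ^ (2 ^ k)"
    by (intro power_mono) (use \<delta> in auto)
  with fin show ?thesis unfolding K_def by (simp only: power_mult)
qed

text \<open>Exponents multiply along the induction, but the number of steps depends on
  \<open>k\<close> only, so the loss is still a fixed power of \<open>\<delta>\<close>. The final
  \<open>gowers P 1\<close> is the norm of order 2, which Fourier analysis handles.\<close>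

lemma degree_lowering:
  "\<exists>K\<ge>1. \<forall>(\<delta>::real) P M f g. 0 < \<delta> \<longrightarrow> \<delta> \<le> 1 / 2 \<longrightarrow> (1 / \<delta>) ^ K \<le> real_of_int M \<longrightarrow>
     32 * M\<^sup>2 \<le> P \<longrightarrow> P \<le> 128 * M\<^sup>2 \<longrightarrow> per P f \<longrightarrow> bdd1 f \<longrightarrow> per P g \<longrightarrow> bdd1 g \<longrightarrow>
     \<delta> \<le> gowers P (Suc k) (dualF M f g) \<longrightarrow> \<delta> ^ K \<le> gowers P 1 (dualF M f g)"
proof (induction k)
  case 0
  show ?case by (rule exI[of _ 1]) simp
next
  case (Suc k)
  then obtain K where K1: "K \<ge> 1" and K: "\<And>(\<delta>::real) P M f g. 0 < \<delta> \<Longrightarrow> \<delta> \<le> 1 / 2 \<Longrightarrow> (1 / \<delta>) ^ K \<le> real_of_int M \<Longrightarrow>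
     32 * M\<^sup>2 \<le> P \<Longrightarrow> P \<le> 128 * M\<^sup>2 \<Longrightarrow> per P f \<Longrightarrow> bdd1 f \<Longrightarrow> per P g \<Longrightarrow> bdd1 g \<Longrightarrow>
     \<delta> \<le> gowers P (Suc k) (dualF M f g) \<Longrightarrow> \<delta> ^ K \<le> gowers P 1 (dualF M f g)"
    by blast
  define K0 :: nat where "K0 = (202 * (2 ^ Suc k + 1) + 4) * (2 * 2 ^ k)"
  have K01: "K0 \<ge> 1" by (simp add: K0_def)
  have "\<delta> ^ (K0 * K) \<le> gowers P 1 (dualF M f g)"
    if \<delta>: "0 < \<delta>" "\<delta> \<le> 1 / 2" and M: "(1 / \<delta>) ^ (K0 * K) \<le> real_of_int M"
      and P: "32 * M\<^sup>2 \<le> P" "P \<le> 128 * M\<^sup>2" and fg: "per P f" "bdd1 f" "per P g" "bdd1 g"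
      and large: "\<delta> \<le> gowers P (Suc (Suc k)) (dualF M f g)"
    for \<delta> :: real and P M f g
  proof -
    have y: "1 / \<delta> \<ge> 1" using \<delta> by (simp add: field_simps)
    have "K0 * 1 \<le> K0 * K" using K1 by (rule mult_le_mono2)
    then have "(1 / \<delta>) ^ K0 \<le> (1 / \<delta>) ^ (K0 * K)" using y by (intro power_increasing) auto
    then have M0: "(1 / \<delta>) ^ K0 \<le> real_of_int M" using M by linarith
    have "\<delta> ^ K0 \<le> gowers P (Suc k) (dualF M f g)"
      unfolding K0_def by (rule degree_lowering_step[OF \<delta> M0[unfolded K0_def] P fg large])
    moreover have "(1 / \<delta> ^ K0) ^ K \<le> real_of_int M" using M by (simp add: power_divide flip: power_mult)
    ultimately have "(\<delta> ^ K0) ^ K \<le> gowers P 1 (dualF M f g)"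
      using \<delta> K01 P fg by (intro K) (auto intro: pow_half_le[OF \<delta>, simplified])
    then show ?thesis by (simp add: power_mult)
  qed
  moreover have "K0 * K \<ge> 1" using K01 K1 by (simp add: Suc_le_eq)
  ultimately show ?case by blast
qed

text \<open>Replacing \<open>h\<close> by its dual function, Fourier-analytic information about the dual function
  becomes information about the pair \<open>f\<close>, \<open>g\<close>.\<close>
lemma pair_correlates_with_major_arc:
  "\<exists>K\<ge>1. \<forall>(\<delta>::real) P M f g h. 0 < \<delta> \<longrightarrow> \<delta> \<le> 1 / 2 \<longrightarrow> (1 / \<delta>) ^ K \<le> real_of_int M \<longrightarrow>
     32 * M\<^sup>2 \<le> P \<longrightarrow> P \<le> 128 * M\<^sup>2 \<longrightarrow> per P f \<longrightarrow> bdd1 f \<longrightarrow> per P g \<longrightarrow> bdd1 g \<longrightarrow> per P h \<longrightarrow> bdd1 h \<longrightarrow>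
     \<delta> \<le> norm (roth P M f g h) \<longrightarrow>
     (\<exists>\<Phi>. maj P ((1 / \<delta>) ^ K) \<Phi> \<and> \<delta> ^ K \<le> norm (roth P M f g (\<lambda>n. chi P (\<Phi> * n))))"
proof -
  obtain k1 where k1: "k1 \<ge> 1" and gc: "\<And>(\<delta>::real) P M f g h. 0 < \<delta> \<Longrightarrow> \<delta> \<le> 1 / 2 \<Longrightarrow> (1 / \<delta>) ^ k1 \<le> real_of_int M \<Longrightarrow>
     32 * M\<^sup>2 \<le> P \<Longrightarrow> P \<le> 128 * M\<^sup>2 \<Longrightarrow> bdd1 f \<Longrightarrow> per P g \<Longrightarrow> bdd1 g \<Longrightarrow> per P h \<Longrightarrow> bdd1 h \<Longrightarrow>
     \<delta> \<le> norm (roth P M f g h) \<Longrightarrow> \<delta> ^ k1 \<le> gowers P 5 h"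
    using gowers_control by blast
  obtain k2 where k2: "k2 \<ge> 1" and dl: "\<And>(\<delta>::real) P M f g. 0 < \<delta> \<Longrightarrow> \<delta> \<le> 1 / 2 \<Longrightarrow> (1 / \<delta>) ^ k2 \<le> real_of_int M \<Longrightarrow>
     32 * M\<^sup>2 \<le> P \<Longrightarrow> P \<le> 128 * M\<^sup>2 \<Longrightarrow> per P f \<Longrightarrow> bdd1 f \<Longrightarrow> per P g \<Longrightarrow> bdd1 g \<Longrightarrow>
     \<delta> \<le> gowers P (Suc 4) (dualF M f g) \<Longrightarrow> \<delta> ^ k2 \<le> gowers P 1 (dualF M f g)"
    using degree_lowering[of 4] by blast
  \<comment> \<open>The factors stand for Cauchy--Schwarz, Gowers control, degree lowering and the
    major arc estimate.\<close>
  define K where "K = 2 * k1 * k2 * 67"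
  have "\<exists>\<Phi>. maj P ((1 / \<delta>) ^ K) \<Phi> \<and> \<delta> ^ K \<le> norm (roth P M f g (\<lambda>n. chi P (\<Phi> * n)))"
    if \<delta>: "0 < \<delta>" "\<delta> \<le> 1 / 2" and M: "(1 / \<delta>) ^ K \<le> real_of_int M"
      and P: "32 * M\<^sup>2 \<le> P" "P \<le> 128 * M\<^sup>2" and f: "per P f" "bdd1 f" and g: "per P g" "bdd1 g"
      and h: "per P h" "bdd1 h" and large: "\<delta> \<le> norm (roth P M f g h)"
    for \<delta> :: real and P M f g h
  proof -
    have y: "1 / \<delta> \<ge> 1" using \<delta> by (simp add: field_simps)
    have "1 \<le> (1 / \<delta>) ^ K" using y by (rule one_le_power)
    then have M1: "M \<ge> 1" using M by linarith
    have P0: "P > 0" using P M1 by (smt (verit) zero_less_power)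
    have Mp: "(1 / \<delta> ^ i) ^ j \<le> real_of_int M" if "i * j \<le> K" for i j
    proof -
      have "(1 / \<delta> ^ i) ^ j = (1 / \<delta>) ^ (i * j)" by (simp add: power_divide power_mult)
      also have "\<dots> \<le> (1 / \<delta>) ^ K" by (rule power_increasing[OF that y])
      finally show ?thesis using M by linarith
    qed
    let ?X = "{0..<P}"
    define F where "F = dualF M f g"
    have F: "per P F" "bdd1 F" unfolding F_def using f g by (auto intro: per_dualF bdd1_dualF)
    have cF: "per P (\<lambda>x. cnj (F x))" "bdd1 (\<lambda>x. cnj (F x))" using F by (auto intro: per_cnj bdd1_cnj)
    have i1: "2 * k1 \<le> K" "2 * k1 * k2 \<le> K" "2 * k1 * k2 * 60 \<le> K"
      using k1 k2 by (auto simp: K_def)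
    \<comment> \<open>Cauchy--Schwarz removes \<open>h\<close> and leaves the mean square of
      \<open>F\<close>, which is again a configuration average, now with \<open>cnj F\<close> as
      third function.\<close>
    have "\<delta>\<^sup>2 \<le> (norm (avg ?X (\<lambda>x. h x * F x)))\<^sup>2"
      using power_mono[OF large, of 2] \<delta> avg_dualF_mult[OF f(1) g(1) h(1) P0, of M] by (simp add: F_def mult.commute)
    also have "\<dots> \<le> avg ?X (\<lambda>x. (norm (F x))\<^sup>2)" by (rule cs_kill) (use h in \<open>simp add: bdd1_def\<close>)
    also have "\<dots> \<le> norm (complex_of_real (avg ?X (\<lambda>x. (norm (F x))\<^sup>2)))" by simp
    also have "complex_of_real (avg ?X (\<lambda>x. (norm (F x))\<^sup>2)) = avg ?X (\<lambda>x. F x * cnj (F x))"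
      unfolding avg_of_real[symmetric] by (simp only: complex_norm_square)
    also have "\<dots> = roth P M f g (\<lambda>x. cnj (F x))"
      using avg_dualF_mult[OF f(1) g(1) cF(1) P0, of M] by (simp add: F_def)
    finally have 1: "\<delta>\<^sup>2 \<le> norm (roth P M f g (\<lambda>x. cnj (F x)))" .
    have "(\<delta>\<^sup>2) ^ k1 \<le> gowers P 5 (\<lambda>x. cnj (F x))"
      by (rule gc[OF _ _ Mp P f(2) g cF 1]) (use \<delta> i1 in \<open>auto intro: pow_half_le[OF \<delta>, simplified]\<close>)
    also have "\<dots> = gowers P (Suc 4) F" by (simp add: gowers_def Dl_cnj avg_cnj)
    finally have 2: "\<delta> ^ (2 * k1) \<le> gowers P (Suc 4) F" by (simp add: power_mult)
    have "(\<delta> ^ (2 * k1)) ^ k2 \<le> gowers P 1 F" unfolding F_def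
      by (rule dl[OF _ _ Mp P f g 2[unfolded F_def]]) (use \<delta> i1 k1 in \<open>auto intro: pow_half_le[OF \<delta>, simplified]\<close>)
    also have "gowers P 1 F = avg ?X (\<lambda>t. (norm (avg ?X (D t F)))\<^sup>2)"
      by (simp add: gowers_def avg_tup_Suc)
    finally have 3: "\<delta> ^ (2 * k1 * k2) \<le> avg ?X (\<lambda>t. (norm (avg ?X (D t F)))\<^sup>2)" by (simp add: power_mult)
    obtain \<xi> where \<xi>: "avg ?X (\<lambda>t. (norm (avg ?X (D t F)))\<^sup>2) \<le> (norm (ft P F \<xi>))\<^sup>2"
      using gowers_U2_le_ft[OF F P0] by blast
    have ftr: "ft P F \<xi> = roth P M f g (\<lambda>n. chi P (\<xi> * n))"
      unfolding ft_def F_def by (rule avg_dualF_mult[OF f(1) g(1) per_chi_mult P0])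
    have "norm (ft P F \<xi>) \<le> 1" unfolding ft_def by (rule bdd1_avg_norm) (use F in \<open>simp add: bdd1_def norm_mult\<close>)
    then have "(norm (ft P F \<xi>))\<^sup>2 \<le> norm (ft P F \<xi>)" by (simp add: power2_eq_square mult_left_le_one_le)
    with 3 \<xi> have 4: "\<delta> ^ (2 * k1 * k2) \<le> norm (roth P M f g (\<lambda>n. chi P (\<xi> * n)))"
      unfolding ftr[symmetric] by linarith
    have "maj P ((1 / \<delta> ^ (2 * k1 * k2)) ^ 67) \<xi>"
      by (rule roth_major_arc[OF Mp _ _ P f(2) g 4]) (use \<delta> i1 k1 k2 in \<open>auto intro: pow_half_le[OF \<delta>, simplified]\<close>)
    then have "maj P ((1 / \<delta>) ^ K) \<xi>" by (simp only: K_def power_one_over power_mult[symmetric])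
    moreover have "\<delta> ^ K \<le> \<delta> ^ (2 * k1 * k2)" by (rule power_decreasing) (use \<delta> in \<open>auto simp: K_def\<close>)
    ultimately show ?thesis using 4 by (intro exI[of _ \<xi>]) simp
  qed
  moreover have "K \<ge> 1" using k1 k2 by (simp add: K_def)
  ultimately show ?thesis by blast
qed

section \<open>Local structure and the inverse theorem\<close>

text \<open>Each unit shift exchanges one term at either end.\<close>

lemma avg_interval_shift:
  fixes u :: "int \<Rightarrow> complex" and M s :: int
  assumes "\<And>y. norm (u y) \<le> 1" "0 \<le> s" "M \<ge> 1"
  shows "norm (avg {1..M} u - avg {1..M} (\<lambda>y. u (y + s))) \<le> 2 * real_of_int s / real_of_int M"
proof -
  have step: "norm ((\<Sum>y\<in>{1..M}. u y) - (\<Sum>y\<in>{1..M}. u (y + int n))) \<le> 2 * real n" for n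
  proof (induction n)
    case (Suc n)
    define v where "v = (\<lambda>y. u (y + int n))"
    have "(\<Sum>y\<in>{1..M}. u (y + int (Suc n))) = (\<Sum>y\<in>{2..M + 1}. v y)"
      by (rule sum.reindex_bij_witness[of _ "\<lambda>y. y - 1" "\<lambda>y. y + 1"]) (auto simp: v_def algebra_simps)
    also have "\<dots> = (\<Sum>y\<in>{1..M}. v y) + v (M + 1) - v 1"
    proof -
      have "(\<Sum>y\<in>{1..M + 1}. v y) = (\<Sum>y\<in>{2..M + 1}. v y) + v 1"
      proof -
        have "{1..M + 1} = insert 1 {2..M + 1}" using assms(3) by auto
        then show ?thesis by simp
      qed
      moreover have "(\<Sum>y\<in>{1..M + 1}. v y) = (\<Sum>y\<in>{1..M}. v y) + v (M + 1)"
      proof -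
        have "{1..M + 1} = insert (M + 1) {1..M}" using assms(3) by auto
        then show ?thesis by simp
      qed
      ultimately show ?thesis by (simp add: algebra_simps)
    qed
    finally have "(\<Sum>y\<in>{1..M}. u y) - (\<Sum>y\<in>{1..M}. u (y + int (Suc n)))
       = ((\<Sum>y\<in>{1..M}. u y) - (\<Sum>y\<in>{1..M}. u (y + int n))) + (v 1 - v (M + 1))" by (simp add: v_def)
    also have "norm \<dots> \<le> 2 * real n + norm (v 1 - v (M + 1))"
      by (rule order_trans[OF norm_triangle_ineq]) (use Suc.IH in simp)
    also have "norm (v 1 - v (M + 1)) \<le> 1 + 1"
      by (rule order_trans[OF norm_triangle_ineq4]) (intro add_mono; simp add: v_def assms(1))
    finally show ?case by simp
  qed simp
  have "avg {1..M} u - avg {1..M} (\<lambda>y. u (y + s)) = ((\<Sum>y\<in>{1..M}. u y) - (\<Sum>y\<in>{1..M}. u (y + int (nat s)))) / of_nat (card {1..M})"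
    using assms(2) by (simp add: avg_def diff_divide_distrib)
  then have "norm (avg {1..M} u - avg {1..M} (\<lambda>y. u (y + s)))
     = norm ((\<Sum>y\<in>{1..M}. u y) - (\<Sum>y\<in>{1..M}. u (y + int (nat s)))) / real_of_int M"
    using assms(3) by (simp add: norm_divide)
  also have "\<dots> \<le> 2 * real (nat s) / real_of_int M" by (rule divide_right_mono[OF step]) (use assms in simp)
  finally show ?thesis using assms(2) by simp
qed

lemma avg_progression_smoothing:
  fixes u :: "int \<Rightarrow> complex" and M J q :: int
  assumes u: "\<And>y. norm (u y) \<le> 1" and "0 \<le> q" "M \<ge> 1" "J \<ge> 1"
  shows "norm (avg {1..M} u - avg {1..M} (\<lambda>y. avg {1..J} (\<lambda>j. u (y + q * j)))) \<le> 2 * (real_of_int q * real_of_int J) / real_of_int M"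
proof -
  have "avg {1..M} u - avg {1..M} (\<lambda>y. avg {1..J} (\<lambda>j. u (y + q * j)))
      = avg {1..J} (\<lambda>j. avg {1..M} u - avg {1..M} (\<lambda>y. u (y + q * j)))"
    unfolding avg_diff using assms(4) by (subst avg_swap) (simp add: avg_const)
  also have "norm \<dots> \<le> 2 * (real_of_int q * real_of_int J) / real_of_int M"
  proof (rule norm_avg_le_bound)
    fix j assume j: "j \<in> {1..J}"
    have "norm (avg {1..M} u - avg {1..M} (\<lambda>y. u (y + q * j))) \<le> 2 * real_of_int (q * j) / real_of_int M"
      by (rule avg_interval_shift) (use assms j in auto)
    also have "\<dots> \<le> 2 * (real_of_int q * real_of_int J) / real_of_int M"
      using j assms by (intro divide_right_mono mult_left_mono) (auto intro: mult_left_mono)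
    finally show "norm (avg {1..M} u - avg {1..M} (\<lambda>y. u (y + q * j))) \<le> \<dots>" .
  qed (use assms in auto)
  finally show ?thesis .
qed

text \<open>On a major arc \<open>chi P (\<Phi> * y\<^sup>2)\<close> hardly changes when
  \<open>y\<close> becomes \<open>y + q j\<close>: the phase moves by \<open>n q \<Phi> / P\<close>
  with \<open>n = 2 j y + q j\<^sup>2\<close> of order \<open>J M\<close>, and
  \<open>q \<Phi> / P\<close> is within \<open>R / P\<close> of an integer. Smoothing over
  \<open>j\<close> therefore acts on \<open>g\<close> alone, and \<open>f\<close> and the character
  are bounded by 1.\<close>

lemma local_average_large:
  fixes P M J \<Phi> :: int and q :: nat and R \<epsilon> :: real
  assumes P: "32 * M\<^sup>2 \<le> P" and M: "M \<ge> 1" and J: "J \<ge> 1"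
    and f: "bdd1 f" and g: "per P g" "bdd1 g"
    and q: "1 \<le> q" "real q \<le> R" "nd (real q * (of_int \<Phi> / of_int P)) \<le> R / of_int P"
    and JM: "6 * R * real_of_int J \<le> \<epsilon> * real_of_int M" and \<epsilon>: "\<epsilon> \<le> 1"
    and large: "\<epsilon> \<le> norm (roth P M f g (\<lambda>n. chi P (\<Phi> * n)))"
  shows "\<epsilon> / 2 \<le> avg {0..<P} (\<lambda>z. norm (avg {1..J} (\<lambda>j. g (z + int q * j))))"
proof -
  let ?X = "{0..<P}" and ?B = "{1..M}"
  have M0: "real_of_int M > 0" and J0: "real_of_int J > 0" using M J by auto
  have M2: "real_of_int M * real_of_int M > 0" using M0 by simp
  have P32: "32 * (real_of_int M * real_of_int M) \<le> real_of_int P"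
  proof -
    have "real_of_int (32 * M\<^sup>2) \<le> real_of_int P" using P by (simp only: of_int_le_iff)
    then show ?thesis by (simp add: power2_eq_square)
  qed
  have P0: "P > 0" using P32 M2 by linarith
  have R1: "R \<ge> 1" using q by linarith
  have RJM: "R * real_of_int J \<le> real_of_int M"
  proof -
    have "\<epsilon> * real_of_int M \<le> 1 * real_of_int M" by (rule mult_right_mono) (use \<epsilon> M0 in auto)
    moreover have "0 \<le> R * real_of_int J" using R1 J0 by simp
    ultimately show ?thesis using JM by linarith
  qed
  define u where "u = (\<lambda>x y. g (x + y) * chi P (\<Phi> * y\<^sup>2))"
  define A where "A = (\<lambda>z. avg {1..J} (\<lambda>j. g (z + int q * j)))"
  have u1: "norm (u x y) \<le> 1" for x y using g(2) by (simp add: u_def norm_mult bdd1_def)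
  have phase: "norm (chi P (\<Phi> * (y + int q * j)\<^sup>2) - chi P (\<Phi> * y\<^sup>2)) \<le> R * real_of_int J / real_of_int M"
    if y: "y \<in> ?B" and j: "j \<in> {1..J}" for y j
  proof -
    define n where "n = 2 * j * y + int q * j\<^sup>2"
    have "chi P (\<Phi> * (y + int q * j)\<^sup>2) = chi P (\<Phi> * y\<^sup>2) * chi P (\<Phi> * (int q * n))"
      unfolding chi_add[symmetric] by (rule arg_cong[of _ _ "chi P"]) (simp add: n_def power2_eq_square algebra_simps)
    then have "norm (chi P (\<Phi> * (y + int q * j)\<^sup>2) - chi P (\<Phi> * y\<^sup>2)) = norm (chi P (\<Phi> * y\<^sup>2) * (chi P (\<Phi> * (int q * n)) - 1))"
      by (simp add: right_diff_distrib)
    also have "\<dots> = norm (chi P (\<Phi> * (int q * n)) - 1)" by (simp add: norm_mult)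
    also have "\<dots> = norm (e (of_int n * (real q * (of_int \<Phi> / of_int P))) - 1)" by (simp add: chi_def mult_ac)
    also have "\<dots> \<le> 2 * pi * nd (of_int n * (real q * (of_int \<Phi> / of_int P)))" by (rule norm_e_minus_1_le)
    also have "\<dots> \<le> 2 * pi * (\<bar>of_int n\<bar> * nd (real q * (of_int \<Phi> / of_int P)))"
      by (intro mult_left_mono nd_mult_nat) simp
    also have "\<dots> \<le> 2 * pi * ((3 * real_of_int J * real_of_int M) * (R / of_int P))"
    proof (intro mult_left_mono mult_mono q(3))
      have "real_of_int j * real_of_int y \<le> real_of_int J * real_of_int M" using y j by (intro mult_mono) auto
      moreover have "real q * real_of_int j * real_of_int j \<le> real_of_int M * real_of_int J"
      proof (rule mult_mono)
        have "real q * real_of_int j \<le> R * real_of_int J" using q j R1 by (intro mult_mono) auto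
        then show "real q * real_of_int j \<le> real_of_int M" using RJM by linarith
      qed (use j M0 in auto)
      moreover have "\<bar>real_of_int n\<bar> = 2 * (real_of_int j * real_of_int y) + real q * real_of_int j * real_of_int j"
        using y j by (simp add: n_def power2_eq_square)
      moreover have "real_of_int M * real_of_int J = real_of_int J * real_of_int M" by (rule mult.commute)
      ultimately show "\<bar>real_of_int n\<bar> \<le> 3 * real_of_int J * real_of_int M" by linarith
    qed (use J0 M0 in auto)
    also have "\<dots> \<le> 2 * 4 * ((3 * real_of_int J * real_of_int M) * (R / of_int P))"
      using pi_less_4 J0 M0 R1 P0 by (intro mult_right_mono) auto
    also have "\<dots> = 24 * (R * real_of_int J) * (real_of_int M / of_int P)" by simp
    also have "\<dots> \<le> 24 * (R * real_of_int J) * (1 / (32 * real_of_int M))"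
      using P32 M0 P0 J0 R1 by (intro mult_left_mono) (auto simp: field_simps)
    also have "\<dots> \<le> R * real_of_int J / real_of_int M" using R1 J0 M0 by (simp add: field_simps)
    finally show ?thesis .
  qed
  have err: "norm (avg ?B (u x) - avg ?B (\<lambda>y. chi P (\<Phi> * y\<^sup>2) * A (x + y))) \<le> \<epsilon> / 2" for x
  proof -
    have e1: "norm (avg ?B (u x) - avg ?B (\<lambda>y. avg {1..J} (\<lambda>j. u x (y + int q * j)))) \<le> 2 * (real_of_int (int q) * real_of_int J) / real_of_int M"
      by (rule avg_progression_smoothing) (use u1 M J in auto)
    have "avg ?B (\<lambda>y. avg {1..J} (\<lambda>j. u x (y + int q * j))) - avg ?B (\<lambda>y. chi P (\<Phi> * y\<^sup>2) * A (x + y))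
       = avg ?B (\<lambda>y. avg {1..J} (\<lambda>j. g (x + y + int q * j) * (chi P (\<Phi> * (y + int q * j)\<^sup>2) - chi P (\<Phi> * y\<^sup>2))))"
      unfolding A_def avg_mult_left[symmetric] avg_diff[symmetric] by (simp add: u_def algebra_simps)
    also have "norm \<dots> \<le> R * real_of_int J / real_of_int M"
    proof (intro norm_avg_le_bound)
      fix y j assume yj: "y \<in> ?B" "j \<in> {1..J}"
      have "norm (g (x + y + int q * j) * (chi P (\<Phi> * (y + int q * j)\<^sup>2) - chi P (\<Phi> * y\<^sup>2)))
         \<le> norm (chi P (\<Phi> * (y + int q * j)\<^sup>2) - chi P (\<Phi> * y\<^sup>2))"
        unfolding norm_mult by (intro mult_left_le_one_le) (use g(2) in \<open>auto simp: bdd1_def\<close>)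
      then show "norm (g (x + y + int q * j) * (chi P (\<Phi> * (y + int q * j)\<^sup>2) - chi P (\<Phi> * y\<^sup>2))) \<le> R * real_of_int J / real_of_int M"
        using phase[OF yj] by linarith
    qed (use R1 J0 M0 in auto)
    finally have e2: "norm (avg ?B (\<lambda>y. avg {1..J} (\<lambda>j. u x (y + int q * j))) - avg ?B (\<lambda>y. chi P (\<Phi> * y\<^sup>2) * A (x + y))) \<le> R * real_of_int J / real_of_int M" .
    have "2 * (real_of_int (int q) * real_of_int J) / real_of_int M \<le> 2 * (R * real_of_int J) / real_of_int M"
      using q J0 M0 by (intro divide_right_mono mult_left_mono mult_right_mono) auto
    \<comment> \<open>Smoothing and freezing the phase cost \<open>2 R J / M\<close> and
      \<open>R J / M\<close>; this is where the 6 in the hypothesis comes from.\<close>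
    moreover have "2 * (R * real_of_int J) / real_of_int M + R * real_of_int J / real_of_int M \<le> \<epsilon> / 2"
      using JM M0 by (simp add: field_simps)
    ultimately show ?thesis using norm_triangle_le[OF add_mono[OF e1 e2]] by simp
  qed
  have "roth P M f g (\<lambda>n. chi P (\<Phi> * n)) = avg ?X (\<lambda>x. (f x * chi P (\<Phi> * x)) * avg ?B (u x))"
    by (simp add: roth_def u_def avg_mult_left[symmetric] distrib_left chi_add mult_ac)
  also have "\<dots> = avg ?X (\<lambda>x. (f x * chi P (\<Phi> * x)) * (avg ?B (u x) - avg ?B (\<lambda>y. chi P (\<Phi> * y\<^sup>2) * A (x + y))))
     + avg ?X (\<lambda>x. (f x * chi P (\<Phi> * x)) * avg ?B (\<lambda>y. chi P (\<Phi> * y\<^sup>2) * A (x + y)))"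
    unfolding avg_add[symmetric] by (simp add: algebra_simps)
  also have "norm \<dots> \<le> \<epsilon> / 2 + avg ?X (\<lambda>z. norm (A z))"
  proof (rule norm_triangle_le[OF add_mono])
    have b: "norm (f x * chi P (\<Phi> * x)) \<le> 1" for x using f by (simp add: norm_mult bdd1_def)
    show "norm (avg ?X (\<lambda>x. (f x * chi P (\<Phi> * x)) * (avg ?B (u x) - avg ?B (\<lambda>y. chi P (\<Phi> * y\<^sup>2) * A (x + y))))) \<le> \<epsilon> / 2"
    proof (rule norm_avg_le_bound)
      fix x
      show "norm ((f x * chi P (\<Phi> * x)) * (avg ?B (u x) - avg ?B (\<lambda>y. chi P (\<Phi> * y\<^sup>2) * A (x + y)))) \<le> \<epsilon> / 2"
        unfolding norm_mult[of "f x * chi P (\<Phi> * x)"]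
        by (rule order_trans[OF mult_left_le_one_le err]) (use b in auto)
      show "0 \<le> \<epsilon> / 2" by (rule order_trans[OF norm_ge_zero err])
    qed
    have "norm (avg ?X (\<lambda>x. (f x * chi P (\<Phi> * x)) * avg ?B (\<lambda>y. chi P (\<Phi> * y\<^sup>2) * A (x + y))))
       \<le> avg ?X (\<lambda>x. avg ?B (\<lambda>y. norm (A (x + y))))"
    proof (rule order_trans[OF norm_avg_le], rule avg_mono)
      fix x
      have "norm ((f x * chi P (\<Phi> * x)) * avg ?B (\<lambda>y. chi P (\<Phi> * y\<^sup>2) * A (x + y))) \<le> norm (avg ?B (\<lambda>y. chi P (\<Phi> * y\<^sup>2) * A (x + y)))"
        unfolding norm_mult[of "f x * chi P (\<Phi> * x)"] by (rule mult_left_le_one_le) (use b in auto)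
      also have "\<dots> \<le> avg ?B (\<lambda>y. norm (chi P (\<Phi> * y\<^sup>2) * A (x + y)))" by (rule norm_avg_le)
      finally show "norm ((f x * chi P (\<Phi> * x)) * avg ?B (\<lambda>y. chi P (\<Phi> * y\<^sup>2) * A (x + y))) \<le> avg ?B (\<lambda>y. norm (A (x + y)))"
        by (simp add: norm_mult)
    qed
    also have "\<dots> = avg ?B (\<lambda>y. avg ?X (\<lambda>x. norm (A (x + y))))" by (rule avg_swap)
    also have "\<dots> = avg ?B (\<lambda>y. avg ?X (\<lambda>x. norm (A x)))"
    proof (rule avg_cong[OF refl])
      fix y
      have "per P (\<lambda>z. norm (A z))" unfolding A_def
        by (rule per_norm, rule per_avg, rule per_shift[OF g(1)])
      from avg_shift[OF this P0] show "avg ?X (\<lambda>x. norm (A (x + y))) = avg ?X (\<lambda>x. norm (A x))" .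
    qed
    also have "\<dots> = avg ?X (\<lambda>z. norm (A z))" using M by (simp add: avg_const)
    finally show "norm (avg ?X (\<lambda>x. (f x * chi P (\<Phi> * x)) * avg ?B (\<lambda>y. chi P (\<Phi> * y\<^sup>2) * A (x + y)))) \<le> avg ?X (\<lambda>z. norm (A z))" .
  qed
  finally show ?thesis using large by (simp add: A_def)
qed

text \<open>The second function is nearly constant along steps of size \<open>q\<close>, so a shift
  of \<open>y\<close> by \<open>q i\<close> affects \<open>h\<close> only; afterwards the other two
  functions are bounded by 1. The shift of the interval requires \<open>q I\<close> small against
  \<open>M\<close>, and near constancy requires \<open>I\<close> small against
  \<open>J\<close>.\<close>

lemma h_average_large:
  fixes P M I J q :: int and s :: "int \<Rightarrow> complex" and \<epsilon> :: real
  assumes P: "P > 0" and M: "M \<ge> 1" and I: "I \<ge> 1" and J: "J \<ge> 1" and q: "q \<ge> 0"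
    and f: "bdd1 f" and s: "bdd1 s" and h: "per P h" "bdd1 h"
    and IM: "16 * (real_of_int q * real_of_int I) \<le> \<epsilon> * real_of_int M"
    and IJ: "16 * real_of_int I \<le> \<epsilon> * real_of_int J"
    and large: "\<epsilon> / 2 \<le> norm (roth P M f (\<lambda>z. avg {1..J} (\<lambda>j. s (z - q * j))) h)"
  shows "\<exists>y. \<epsilon> / 4 \<le> avg {0..<P} (\<lambda>x. norm (avg {1..I} (\<lambda>i. h (x + (y + q * i)\<^sup>2))))"
proof -
  let ?X = "{0..<P}" and ?B = "{1..M}"
  have M0: "real_of_int M > 0" and J0: "real_of_int J > 0" and I0: "real_of_int I > 0" using M I J by auto
  have \<epsilon>0: "0 \<le> \<epsilon>"
  proof -
    have "0 * real_of_int J \<le> \<epsilon> * real_of_int J" using IJ I0 by linarith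
    then show ?thesis using J0 by (simp only: mult_le_cancel_right)
  qed
  define \<phi> where "\<phi> = (\<lambda>z. avg {1..J} (\<lambda>j. s (z - q * j)))"
  have \<phi>1: "norm (\<phi> z) \<le> 1" for z unfolding \<phi>_def by (intro norm_avg_le_bound) (use s in \<open>auto simp: bdd1_def\<close>)
  have h1: "norm (h z) \<le> 1" for z using h by (simp add: bdd1_def)
  have \<phi>shift: "norm (\<phi> (z + q * i) - \<phi> z) \<le> \<epsilon> / 8" if i: "i \<in> {1..I}" for z i
  proof -
    have "\<phi> (z + q * i) - \<phi> z = avg {1..J} (\<lambda>j. s (z + q * i - q * j)) - avg {1..J} (\<lambda>j. s (z + q * i - q * (j + i)))"
      by (simp add: \<phi>_def algebra_simps)
    also have "norm \<dots> \<le> 2 * real_of_int i / real_of_int J"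
      by (rule avg_interval_shift[where u = "\<lambda>j. s (z + q * i - q * j)"]) (use s i J in \<open>auto simp: bdd1_def\<close>)
    also have "\<dots> \<le> 2 * real_of_int I / real_of_int J" using i J0 by (intro divide_right_mono) auto
    also have "\<dots> \<le> \<epsilon> / 8" using IJ J0 by (simp add: field_simps)
    finally show ?thesis .
  qed
  define H where "H = (\<lambda>y x. avg {1..I} (\<lambda>i. h (x + (y + q * i)\<^sup>2)))"
  define u where "u = (\<lambda>x y. \<phi> (x + y) * h (x + y\<^sup>2))"
  have u1: "norm (u x y) \<le> 1" for x y unfolding u_def norm_mult by (intro mult_le_one \<phi>1 h1) auto
  have err: "norm (avg ?B (u x) - avg ?B (\<lambda>y. \<phi> (x + y) * H y x)) \<le> \<epsilon> / 4" for x
  proof -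
    have e1: "norm (avg ?B (u x) - avg ?B (\<lambda>y. avg {1..I} (\<lambda>i. u x (y + q * i)))) \<le> 2 * (real_of_int q * real_of_int I) / real_of_int M"
      by (rule avg_progression_smoothing) (use u1 M I q in auto)
    have "avg ?B (\<lambda>y. avg {1..I} (\<lambda>i. u x (y + q * i))) - avg ?B (\<lambda>y. \<phi> (x + y) * H y x)
      = avg ?B (\<lambda>y. avg {1..I} (\<lambda>i. (\<phi> (x + y + q * i) - \<phi> (x + y)) * h (x + (y + q * i)\<^sup>2)))"
      unfolding H_def avg_mult_left[symmetric] avg_diff[symmetric] by (simp add: u_def algebra_simps)
    also have "norm \<dots> \<le> \<epsilon> / 8"
    proof (intro norm_avg_le_bound)
      fix y i assume i: "i \<in> {1..I}"
      have "norm ((\<phi> (x + y + q * i) - \<phi> (x + y)) * h (x + (y + q * i)\<^sup>2)) \<le> norm (\<phi> (x + y + q * i) - \<phi> (x + y))"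
        unfolding norm_mult by (rule mult_right_le_one_le) (auto intro: h1)
      then show "norm ((\<phi> (x + y + q * i) - \<phi> (x + y)) * h (x + (y + q * i)\<^sup>2)) \<le> \<epsilon> / 8"
        using \<phi>shift[OF i, of "x + y"] by linarith
    qed (use \<epsilon>0 in auto)
    finally have e2: "norm (avg ?B (\<lambda>y. avg {1..I} (\<lambda>i. u x (y + q * i))) - avg ?B (\<lambda>y. \<phi> (x + y) * H y x)) \<le> \<epsilon> / 8" .
    have "2 * (real_of_int q * real_of_int I) / real_of_int M \<le> \<epsilon> / 8" using IM M0 by (simp add: field_simps)
    then show ?thesis using norm_triangle_le[OF add_mono[OF e1 e2]] by simp
  qed
  have "roth P M f \<phi> h = avg ?X (\<lambda>x. f x * avg ?B (u x))"
    by (simp add: roth_def u_def avg_mult_left[symmetric] mult.assoc)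
  also have "\<dots> = avg ?X (\<lambda>x. f x * (avg ?B (u x) - avg ?B (\<lambda>y. \<phi> (x + y) * H y x)))
     + avg ?X (\<lambda>x. f x * avg ?B (\<lambda>y. \<phi> (x + y) * H y x))"
    unfolding avg_add[symmetric] by (simp add: algebra_simps)
  also have "norm \<dots> \<le> \<epsilon> / 4 + avg ?X (\<lambda>x. avg ?B (\<lambda>y. norm (H y x)))"
  proof (rule norm_triangle_le[OF add_mono])
    show "norm (avg ?X (\<lambda>x. f x * (avg ?B (u x) - avg ?B (\<lambda>y. \<phi> (x + y) * H y x)))) \<le> \<epsilon> / 4"
    proof (rule norm_avg_le_bound)
      fix x
      show "norm (f x * (avg ?B (u x) - avg ?B (\<lambda>y. \<phi> (x + y) * H y x))) \<le> \<epsilon> / 4"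
        unfolding norm_mult by (rule order_trans[OF mult_left_le_one_le err]) (use f in \<open>auto simp: bdd1_def\<close>)
    qed (use \<epsilon>0 in simp)
    show "norm (avg ?X (\<lambda>x. f x * avg ?B (\<lambda>y. \<phi> (x + y) * H y x))) \<le> avg ?X (\<lambda>x. avg ?B (\<lambda>y. norm (H y x)))"
    proof (rule order_trans[OF norm_avg_le], rule avg_mono)
      fix x
      have "norm (f x * avg ?B (\<lambda>y. \<phi> (x + y) * H y x)) \<le> norm (avg ?B (\<lambda>y. \<phi> (x + y) * H y x))"
        unfolding norm_mult by (rule mult_left_le_one_le) (use f in \<open>auto simp: bdd1_def\<close>)
      also have "\<dots> \<le> avg ?B (\<lambda>y. norm (\<phi> (x + y) * H y x))" by (rule norm_avg_le)
      also have "\<dots> \<le> avg ?B (\<lambda>y. norm (H y x))"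
        unfolding norm_mult by (rule avg_mono, rule mult_left_le_one_le) (auto intro: \<phi>1)
      finally show "norm (f x * avg ?B (\<lambda>y. \<phi> (x + y) * H y x)) \<le> avg ?B (\<lambda>y. norm (H y x))" .
    qed
  qed
  also have "avg ?X (\<lambda>x. avg ?B (\<lambda>y. norm (H y x))) = avg ?B (\<lambda>y. avg ?X (\<lambda>x. norm (H y x)))" by (rule avg_swap)
  finally have "\<epsilon> / 4 \<le> avg ?B (\<lambda>y. avg ?X (\<lambda>x. norm (H y x)))" using large by (simp add: \<phi>_def)
  moreover have "finite ?B" "?B \<noteq> {}" using M by auto
  then obtain y where "avg ?B (\<lambda>y. avg ?X (\<lambda>x. norm (H y x))) \<le> avg ?X (\<lambda>x. norm (H y x))"
    using avg_exists_ge[of ?B "\<lambda>y. avg ?X (\<lambda>x. norm (H y x))"] by blast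
  ultimately show ?thesis unfolding H_def by (intro exI[of _ y]) linarith
qed

lemma ft_average_translates:
  assumes "per P h" "P > 0"
  shows "ft P (\<lambda>x. avg A (\<lambda>i. h (x + n i))) \<xi> = avg A (\<lambda>i. chi P (- \<xi> * n i)) * ft P h \<xi>"
proof -
  let ?X = "{0..<P}"
  have "ft P (\<lambda>x. avg A (\<lambda>i. h (x + n i))) \<xi> = avg ?X (\<lambda>x. avg A (\<lambda>i. h (x + n i) * chi P (\<xi> * x)))"
    by (simp add: ft_def avg_mult_right)
  also have "\<dots> = avg A (\<lambda>i. avg ?X (\<lambda>x. h (x + n i) * chi P (\<xi> * x)))" by (rule avg_swap)
  also have "\<dots> = avg A (\<lambda>i. chi P (- \<xi> * n i) * ft P h \<xi>)"
  proof (rule avg_cong[OF refl])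
    fix i
    have "h (x + n i) * chi P (\<xi> * x) = chi P (- \<xi> * n i) * (h (x + n i) * chi P (\<xi> * (x + n i)))" for x
    proof -
      have "chi P (\<xi> * x) = chi P (- \<xi> * n i) * chi P (\<xi> * (x + n i))"
        unfolding chi_add[symmetric] by (simp add: algebra_simps)
      then show ?thesis by simp
    qed
    then have "avg ?X (\<lambda>x. h (x + n i) * chi P (\<xi> * x)) = chi P (- \<xi> * n i) * avg ?X (\<lambda>x. h (x + n i) * chi P (\<xi> * (x + n i)))"
      by (simp only: avg_mult_left)
    also have "avg ?X (\<lambda>x. h (x + n i) * chi P (\<xi> * (x + n i))) = ft P h \<xi>"
      unfolding ft_def by (rule avg_shift[OF per_mult[OF assms(1) per_chi_mult] assms(2)])
    finally show "avg ?X (\<lambda>x. h (x + n i) * chi P (\<xi> * x)) = chi P (- \<xi> * n i) * ft P h \<xi>" .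
  qed
  finally show ?thesis by (simp only: avg_mult_right)
qed

text \<open>Averaging the translates multiplies each Fourier coefficient by an exponential sum
  \<open>w\<close>. If the conclusion failed, the minor arcs would contribute at most
  \<open>\<eta>\<^sup>2\<close> by Weyl's inequality, and the at most \<open>9 * R ^ 3\<close> major
  arc frequencies another \<open>\<eta>\<^sup>2\<close>, while the hypothesis and Parseval demand
  \<open>4 * \<eta>\<^sup>2\<close>.\<close>

lemma fourier_of_square_average:
  fixes P M I y :: int and q :: nat and \<eta> R :: real
  assumes P: "P > 0" and h: "per P h" "bdd1 h" and \<eta>: "0 < \<eta>" "\<eta> \<le> 1 / 2" "(1 / \<eta>) ^ 60 \<le> real_of_int I"
    and q: "1 \<le> q" and R: "(1 / \<eta>) ^ 60 * (real q)\<^sup>2 \<le> R" "(1 / \<eta>) ^ 60 * real_of_int P \<le> R * (real_of_int I)\<^sup>2"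
    and large: "2 * \<eta> \<le> avg {0..<P} (\<lambda>x. norm (avg {1..I} (\<lambda>i. h (x + (y + int q * i)\<^sup>2))))"
  shows "\<exists>\<xi>. maj P R \<xi> \<and> \<eta>\<^sup>2 / (9 * R ^ 3) \<le> (norm (ft P h \<xi>))\<^sup>2"
proof (rule ccontr)
  assume "\<not> ?thesis"
  then have small: "\<And>\<xi>. maj P R \<xi> \<Longrightarrow> (norm (ft P h \<xi>))\<^sup>2 < \<eta>\<^sup>2 / (9 * R ^ 3)" by force
  let ?X = "{0..<P}"
  have P0: "real_of_int P > 0" using P by simp
  have y1: "1 \<le> (1 / \<eta>) ^ 60" by (rule one_le_power) (use \<eta> in \<open>simp add: field_simps\<close>)
  then have I0: "real_of_int I > 0" using \<eta>(3) by linarith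
  have R1: "1 \<le> R"
  proof -
    have "1 * 1 \<le> (1 / \<eta>) ^ 60 * (real q)\<^sup>2" by (rule mult_mono[OF y1]) (use q y1 in auto)
    then show ?thesis using R(1) by simp
  qed
  define H where "H = (\<lambda>x. avg {1..I} (\<lambda>i. h (x + (y + int q * i)\<^sup>2)))"
  define w where "w = (\<lambda>\<xi>. avg {1..I} (\<lambda>i. chi P (- \<xi> * (y + int q * i)\<^sup>2)))"
  have w1: "norm (w \<xi>) \<le> 1" for \<xi> unfolding w_def by (rule norm_avg_le_bound) auto
  have maj: "maj P R \<xi>" if "\<eta> \<le> norm (w \<xi>)" for \<xi>
  proof -
    define \<theta> where "\<theta> = - (of_int \<xi> / of_int P) * (real q)\<^sup>2"
    define \<beta> where "\<beta> = - (of_int \<xi> / of_int P) * (2 * of_int y * real q)"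
    have "chi P (- \<xi> * (y + int q * i)\<^sup>2) = chi P (- \<xi> * y\<^sup>2) * e (\<theta> * (of_int i)\<^sup>2 + \<beta> * of_int i)" for i
      unfolding chi_def e_add[symmetric] by (rule arg_cong[of _ _ e])
        (simp add: \<theta>_def \<beta>_def power2_eq_square algebra_simps add_divide_distrib diff_divide_distrib)
    then have "w \<xi> = chi P (- \<xi> * y\<^sup>2) * avg {1..I} (\<lambda>i. e (\<theta> * (of_int i)\<^sup>2 + \<beta> * of_int i))"
      by (simp only: w_def avg_mult_left)
    then have "\<eta> \<le> norm (avg {1..I} (\<lambda>i. e (\<theta> * (of_int i)\<^sup>2 + \<beta> * of_int i)))"
      using that by (simp add: norm_mult)
    from weyl_quadratic[OF \<eta>(3,1,2) this] obtain q' :: nat where q': "1 \<le> q'" "real q' \<le> (1 / \<eta>) ^ 60"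
      "nd (real q' * \<theta>) \<le> (1 / \<eta>) ^ 60 / (real_of_int I)\<^sup>2" by blast
    \<comment> \<open>The quadratic coefficient is \<open>q\<^sup>2 \<xi> / P\<close> up to sign, so
      its denominator \<open>q'\<close> becomes \<open>q' q\<^sup>2\<close> for
      \<open>\<xi> / P\<close>.\<close>
    define m where "m = q' * q\<^sup>2"
    have "1 \<le> m" using q q' by (simp add: m_def)
    moreover have "real m \<le> R"
    proof -
      have "real m = real q' * (real q)\<^sup>2" by (simp add: m_def)
      also have "\<dots> \<le> (1 / \<eta>) ^ 60 * (real q)\<^sup>2" by (rule mult_right_mono[OF q'(2)]) simp
      finally show ?thesis using R(1) by linarith
    qed
    moreover have "nd (real m * (of_int \<xi> / of_int P)) \<le> R / of_int P"
    proof -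
      have "nd (real m * (of_int \<xi> / of_int P)) = nd (- (real q' * \<theta>))" by (simp add: m_def \<theta>_def mult_ac)
      also have "\<dots> \<le> (1 / \<eta>) ^ 60 / (real_of_int I)\<^sup>2" unfolding nd_minus by (rule q'(3))
      also have "\<dots> \<le> R / of_int P"
        using R(2) I0 P0 by (simp only: divide_le_eq le_divide_eq zero_less_power if_True times_divide_eq_left)
      finally show ?thesis .
    qed
    ultimately show ?thesis unfolding maj_def by blast
  qed
  have "(2 * \<eta>)\<^sup>2 \<le> (avg ?X (\<lambda>x. norm (H x)))\<^sup>2" by (rule power_mono) (use large \<eta> in \<open>auto simp: H_def\<close>)
  also have "\<dots> \<le> avg ?X (\<lambda>x. (norm (H x))\<^sup>2)" by (rule avg_power2_le)
  also have "\<dots> = (\<Sum>\<xi>\<in>?X. (norm (ft P H \<xi>))\<^sup>2)" by (rule parseval_cyclic[OF P, symmetric])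
  also have "\<dots> = (\<Sum>\<xi>\<in>?X. (norm (w \<xi>))\<^sup>2 * (norm (ft P h \<xi>))\<^sup>2)"
    unfolding H_def w_def ft_average_translates[OF h(1) P] norm_mult power_mult_distrib ..
  also have "\<dots> \<le> (\<Sum>\<xi>\<in>?X. (if maj P R \<xi> then \<eta>\<^sup>2 / (9 * R ^ 3) else 0) + \<eta>\<^sup>2 * (norm (ft P h \<xi>))\<^sup>2)"
  proof (rule sum_mono)
    fix \<xi>
    show "(norm (w \<xi>))\<^sup>2 * (norm (ft P h \<xi>))\<^sup>2 \<le> (if maj P R \<xi> then \<eta>\<^sup>2 / (9 * R ^ 3) else 0) + \<eta>\<^sup>2 * (norm (ft P h \<xi>))\<^sup>2"
    proof (cases "maj P R \<xi>")
      case True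
      have "(norm (w \<xi>))\<^sup>2 * (norm (ft P h \<xi>))\<^sup>2 \<le> (norm (ft P h \<xi>))\<^sup>2"
        by (rule mult_left_le_one_le) (auto simp: power_le_one w1)
      also have "\<dots> \<le> \<eta>\<^sup>2 / (9 * R ^ 3)" using small[OF True] by simp
      finally show ?thesis using True by (simp add: add_increasing2)
    next
      case False
      then have "norm (w \<xi>) \<le> \<eta>" using maj[of \<xi>] by linarith
      then have "(norm (w \<xi>))\<^sup>2 * (norm (ft P h \<xi>))\<^sup>2 \<le> \<eta>\<^sup>2 * (norm (ft P h \<xi>))\<^sup>2"
        by (intro mult_right_mono power_mono) auto
      then show ?thesis using False by simp
    qed
  qed
  also have "\<dots> = real (card {\<xi> \<in> ?X. maj P R \<xi>}) * (\<eta>\<^sup>2 / (9 * R ^ 3)) + \<eta>\<^sup>2 * (\<Sum>\<xi>\<in>?X. (norm (ft P h \<xi>))\<^sup>2)"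
    by (simp add: sum.distrib sum_distrib_left sum.If_cases Int_def)
  also have "\<dots> \<le> (9 * R ^ 3) * (\<eta>\<^sup>2 / (9 * R ^ 3)) + \<eta>\<^sup>2 * 1"
    by (intro add_mono mult_right_mono mult_left_mono card_maj sum_norm_ft_le_1 P R1 h) (use R1 in auto)
  also have "\<dots> = 2 * \<eta>\<^sup>2" using R1 by simp
  finally show False using \<eta>(1) by (simp add: power2_eq_square)
qed

text \<open>The counterpart of \<open>dualF\<close> for the second point of the configuration, so
  that pairing with \<open>g\<close> gives \<open>roth P M f g h\<close>.\<close>

definition dualG :: "int \<Rightarrow> (int \<Rightarrow> complex) \<Rightarrow> (int \<Rightarrow> complex) \<Rightarrow> int \<Rightarrow> complex" where
  "dualG M f h = (\<lambda>z. avg {1..M} (\<lambda>y. f (z - y) * h (z - y + y\<^sup>2)))"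

lemma per_dualG: "per P f \<Longrightarrow> per P h \<Longrightarrow> per P (dualG M f h)"
  unfolding dualG_def
proof (rule per_avg)
  fix y assume "per P f" "per P h"
  then have "per P (\<lambda>z. f (z - y) * h (z + (- y + y\<^sup>2)))" by (intro per_mult per_shift_diff per_shift)
  then show "per P (\<lambda>z. f (z - y) * h (z - y + y\<^sup>2))" by (simp add: algebra_simps)
qed

lemma bdd1_dualG: "bdd1 f \<Longrightarrow> bdd1 h \<Longrightarrow> bdd1 (dualG M f h)"
  unfolding dualG_def by (rule bdd1_avg) (simp add: bdd1_def norm_mult mult_le_one)

lemma avg_dualG_mult:
  assumes "per P f" "per P g" "per P h" "P > 0"
  shows "avg {0..<P} (\<lambda>z. dualG M f h z * g z) = roth P M f g h"
proof -
  let ?X = "{0..<P}" and ?B = "{1..M}"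
  have "avg ?X (\<lambda>z. dualG M f h z * g z) = avg ?B (\<lambda>y. avg ?X (\<lambda>z. f (z - y) * h (z - y + y\<^sup>2) * g z))"
    unfolding dualG_def avg_mult_right[symmetric] by (rule avg_swap)
  also have "\<dots> = avg ?B (\<lambda>y. avg ?X (\<lambda>x. f x * g (x + y) * h (x + y\<^sup>2)))"
  proof (rule avg_cong[OF refl])
    fix y
    have "per P (\<lambda>x. f x * g (x + y) * h (x + y\<^sup>2))" by (rule per_mult per_shift assms)+
    from avg_shift_diff[OF this assms(4), of y]
    show "avg ?X (\<lambda>z. f (z - y) * h (z - y + y\<^sup>2) * g z) = avg ?X (\<lambda>x. f x * g (x + y) * h (x + y\<^sup>2))"
      by (simp add: mult_ac)
  qed
  also have "\<dots> = roth P M f g h" unfolding roth_def by (rule avg_swap)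
  finally show ?thesis .
qed

lemma maj_mono: "maj P R \<xi> \<Longrightarrow> R \<le> R' \<Longrightarrow> P > 0 \<Longrightarrow> maj P R' \<xi>"
proof -
  assume "maj P R \<xi>" and R: "R \<le> R'" and P: "P > 0"
  then obtain q :: nat where q: "1 \<le> q" "real q \<le> R" "nd (real q * (of_int \<xi> / of_int P)) \<le> R / of_int P"
    by (auto simp: maj_def)
  have "R / of_int P \<le> R' / of_int P" using R P by (intro divide_right_mono) auto
  then show ?thesis unfolding maj_def using q R by (intro exI[of _ q]) linarith
qed

lemma floor_ge_half: "1 \<le> z \<Longrightarrow> z / 2 \<le> real_of_int \<lfloor>z\<rfloor>"
proof -
  assume z: "1 \<le> z"
  then have "1 \<le> \<lfloor>z\<rfloor>" by (simp add: le_floor_iff)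
  then have "1 \<le> real_of_int \<lfloor>z\<rfloor>" by simp
  moreover have "z < real_of_int \<lfloor>z\<rfloor> + 1" by (rule floor_correct[THEN conjunct2, simplified])
  ultimately show ?thesis by linarith
qed

text \<open>Replacing \<open>g\<close> by its dual function, the local structure of the dual function allows us to
  replace \<open>g\<close> by a function which is nearly constant along short progressions of step \<open>q\<close>.\<close>
lemma roth_local_structure:
  fixes P M J :: int and q :: nat and \<epsilon> :: real
  assumes P0: "P > 0" and f: "per P f" and h: "per P h"
    and large: "\<epsilon> / 2 \<le> avg {0..<P} (\<lambda>z. norm (avg {1..J} (\<lambda>j. cnj (dualG M f h (z + int q * j)))))"
  shows "\<exists>s. bdd1 s \<and> \<epsilon> / 2 \<le> norm (roth P M f (\<lambda>z. avg {1..J} (\<lambda>j. s (z - int q * j))) h)"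
proof -
  let ?X = "{0..<P}"
  define G where "G = dualG M f h"
  have perG: "per P G" unfolding G_def by (rule per_dualG[OF f h])
  define A where "A = (\<lambda>z. avg {1..J} (\<lambda>j. cnj (G (z + int q * j))))"
  have perA: "per P A" unfolding A_def by (rule per_avg, rule per_cnj, rule per_shift[OF perG])
  obtain ph :: "complex \<Rightarrow> complex" where ph: "\<And>z. norm (ph z) \<le> 1" "\<And>z. of_real (norm z) = ph z * z"
    using phase_function by blast
  \<comment> \<open>\<open>s z * A z\<close> is the absolute value of the local average
    \<open>A z\<close>. Moving the shift by \<open>q j\<close> from the dual function to
    \<open>s\<close> exhibits a pairing of \<open>G\<close> with local averages, that is, a
    configuration average.\<close>
  define s where "s = (\<lambda>z. ph (A z))"
  have pers: "per P s" using perA by (simp add: s_def per_def)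
  have "complex_of_real (avg ?X (\<lambda>z. norm (A z))) = avg ?X (\<lambda>z. s z * A z)"
    by (simp only: avg_of_real[symmetric] s_def ph(2))
  also have "\<dots> = avg ?X (\<lambda>z. avg {1..J} (\<lambda>j. s z * cnj (G (z + int q * j))))"
    by (simp only: A_def avg_mult_left)
  also have "\<dots> = avg {1..J} (\<lambda>j. avg ?X (\<lambda>z. s z * cnj (G (z + int q * j))))" by (rule avg_swap)
  also have "\<dots> = avg {1..J} (\<lambda>j. avg ?X (\<lambda>z. s (z - int q * j) * cnj (G z)))"
  proof (rule avg_cong[OF refl])
    fix j
    have "per P (\<lambda>z. s z * cnj (G (z + int q * j)))" by (rule per_mult per_cnj per_shift pers perG)+
    from avg_shift_diff[OF this P0, of "int q * j"]
    show "avg ?X (\<lambda>z. s z * cnj (G (z + int q * j))) = avg ?X (\<lambda>z. s (z - int q * j) * cnj (G z))" by simp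
  qed
  also have "\<dots> = avg ?X (\<lambda>z. avg {1..J} (\<lambda>j. s (z - int q * j) * cnj (G z)))" by (rule avg_swap)
  also have "\<dots> = avg ?X (\<lambda>z. cnj (G z * avg {1..J} (\<lambda>j. cnj (s (z - int q * j)))))"
    by (simp only: avg_mult_right complex_cnj_mult avg_cnj complex_cnj_cnj mult.commute[of "cnj (G _)"])
  also have "\<dots> = cnj (avg ?X (\<lambda>z. G z * avg {1..J} (\<lambda>j. cnj (s (z - int q * j)))))"
    by (rule avg_cnj)
  also have "avg ?X (\<lambda>z. G z * avg {1..J} (\<lambda>j. cnj (s (z - int q * j)))) = roth P M f (\<lambda>z. avg {1..J} (\<lambda>j. cnj (s (z - int q * j)))) h"
    unfolding G_def by (rule avg_dualG_mult[OF f _ h P0]) (rule per_avg, rule per_cnj, rule per_shift_diff[OF pers])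
  finally have "norm (complex_of_real (avg ?X (\<lambda>z. norm (A z)))) = norm (roth P M f (\<lambda>z. avg {1..J} (\<lambda>j. cnj (s (z - int q * j)))) h)"
    by (simp only: complex_mod_cnj)
  moreover have "0 \<le> avg ?X (\<lambda>z. norm (A z))" by (rule avg_nonneg) simp
  ultimately have "avg ?X (\<lambda>z. norm (A z)) = norm (roth P M f (\<lambda>z. avg {1..J} (\<lambda>j. cnj (s (z - int q * j)))) h)" by simp
  moreover have "bdd1 (\<lambda>z. cnj (s z))" by (simp add: bdd1_def s_def ph(1))
  moreover have "\<epsilon> / 2 \<le> avg ?X (\<lambda>z. norm (A z))" using large by (simp only: A_def G_def)
  ultimately show ?thesis by (intro exI[of _ "\<lambda>z. cnj (s z)"]) simp
qed

lemma roth_inverse_cyclic: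
  "\<exists>K\<ge>1. \<forall>(\<delta>::real) P M f g h. 0 < \<delta> \<longrightarrow> \<delta> \<le> 1 / 2 \<longrightarrow> (1 / \<delta>) ^ K \<le> real_of_int M \<longrightarrow>
     32 * M\<^sup>2 \<le> P \<longrightarrow> P \<le> 128 * M\<^sup>2 \<longrightarrow> per P f \<longrightarrow> bdd1 f \<longrightarrow> per P g \<longrightarrow> bdd1 g \<longrightarrow> per P h \<longrightarrow> bdd1 h \<longrightarrow>
     \<delta> \<le> norm (roth P M f g h) \<longrightarrow>
     (\<exists>\<xi>. maj P ((1 / \<delta>) ^ K) \<xi> \<and> \<delta> ^ K \<le> norm (ft P h \<xi>))"
proof -
  obtain K0 where K0: "K0 \<ge> 1" and pair: "\<And>(\<delta>::real) P M f g h. 0 < \<delta> \<Longrightarrow> \<delta> \<le> 1 / 2 \<Longrightarrow> (1 / \<delta>) ^ K0 \<le> real_of_int M \<Longrightarrow>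
     32 * M\<^sup>2 \<le> P \<Longrightarrow> P \<le> 128 * M\<^sup>2 \<Longrightarrow> per P f \<Longrightarrow> bdd1 f \<Longrightarrow> per P g \<Longrightarrow> bdd1 g \<Longrightarrow> per P h \<Longrightarrow> bdd1 h \<Longrightarrow>
     \<delta> \<le> norm (roth P M f g h) \<Longrightarrow>
     (\<exists>\<Phi>. maj P ((1 / \<delta>) ^ K0) \<Phi> \<and> \<delta> ^ K0 \<le> norm (roth P M f g (\<lambda>n. chi P (\<Phi> * n))))"
    using pair_correlates_with_major_arc by blast
  \<comment> \<open>\<open>825 = 3 * 271 + 2 + 10\<close>: the cube of \<open>R = x ^ 271\<close>,
    the square of \<open>\<epsilon>\<close>, and \<open>576 \<le> 2 ^ 10\<close>. The factor
    \<open>2 * K0\<close> is the exponent of \<open>\<epsilon>\<close>.\<close>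
  define K where "K = 2 * K0 * 825"
  have "\<exists>\<xi>. maj P ((1 / \<delta>) ^ K) \<xi> \<and> \<delta> ^ K \<le> norm (ft P h \<xi>)"
    if \<delta>: "0 < \<delta>" "\<delta> \<le> 1 / 2" and M: "(1 / \<delta>) ^ K \<le> real_of_int M"
      and P: "32 * M\<^sup>2 \<le> P" "P \<le> 128 * M\<^sup>2" and f: "per P f" "bdd1 f" and g: "per P g" "bdd1 g"
      and h: "per P h" "bdd1 h" and large: "\<delta> \<le> norm (roth P M f g h)"
    for \<delta> :: real and P M f g h
  proof -
    let ?X = "{0..<P}"
    define \<epsilon> where "\<epsilon> = \<delta> ^ (2 * K0)"
    define x where "x = 1 / \<epsilon>"
    have \<epsilon>: "0 < \<epsilon>" "\<epsilon> \<le> 1 / 2"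
      unfolding \<epsilon>_def by (rule zero_less_power[OF \<delta>(1)], rule pow_half_le[OF \<delta>]) (use K0 in simp)
    have x2: "2 \<le> x" using \<epsilon> by (simp add: x_def field_simps)
    have \<epsilon>x: "\<epsilon> * x = 1" "\<epsilon> = 1 / x" using \<epsilon> by (simp_all add: x_def)
    have xK: "x ^ 825 = (1 / \<delta>) ^ K" unfolding x_def \<epsilon>_def K_def by (simp only: power_one_over power_mult)
    have xM: "x ^ n \<le> real_of_int M" if "n \<le> 825" for n
      using power_increasing[OF that, of x] x2 M unfolding xK by linarith
    have pw: "2 ^ n * x ^ k \<le> x ^ (n + k)" for n k
      unfolding power_add using x2 by (intro mult_right_mono power_mono) auto
    have M1: "M \<ge> 1" using xM[of 0] by simp
    have M0: "real_of_int M > 0" using M1 by simp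
    have P0: "P > 0" using P M1 by (smt (verit) zero_less_power)
    define G where "G = dualG M f h"
    have perG: "per P G" unfolding G_def by (rule per_dualG[OF f(1) h(1)])
    have bG: "bdd1 G" unfolding G_def by (rule bdd1_dualG[OF f(2) h(2)])
    have cG: "per P (\<lambda>z. cnj (G z))" "bdd1 (\<lambda>z. cnj (G z))" by (rule per_cnj[OF perG], rule bdd1_cnj[OF bG])
    have "\<delta>\<^sup>2 \<le> (norm (avg ?X (\<lambda>z. g z * G z)))\<^sup>2"
      using power_mono[OF large, of 2] \<delta> avg_dualG_mult[OF f(1) g(1) h(1) P0, of M] by (simp add: G_def mult.commute)
    also have "\<dots> \<le> avg ?X (\<lambda>z. (norm (G z))\<^sup>2)" by (rule cs_kill) (use g in \<open>simp add: bdd1_def\<close>)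
    also have "\<dots> \<le> norm (complex_of_real (avg ?X (\<lambda>z. (norm (G z))\<^sup>2)))" by simp
    also have "complex_of_real (avg ?X (\<lambda>z. (norm (G z))\<^sup>2)) = avg ?X (\<lambda>z. G z * cnj (G z))"
      unfolding avg_of_real[symmetric] by (simp only: complex_norm_square)
    also have "\<dots> = roth P M f (\<lambda>z. cnj (G z)) h"
      using avg_dualG_mult[OF f(1) cG(1) h(1) P0, of M] by (simp add: G_def)
    finally have 1: "\<delta>\<^sup>2 \<le> norm (roth P M f (\<lambda>z. cnj (G z)) h)" .
    have x1: "(1 / \<delta>\<^sup>2) ^ K0 = x" "(\<delta>\<^sup>2) ^ K0 = \<epsilon>"
      unfolding x_def \<epsilon>_def by (simp_all only: power_one_over power_mult)
    have d2: "0 < \<delta>\<^sup>2" "\<delta>\<^sup>2 \<le> 1 / 2" using \<delta> pow_half_le[OF \<delta>, of 2] by auto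
    have "\<exists>\<Phi>. maj P ((1 / \<delta>\<^sup>2) ^ K0) \<Phi> \<and> (\<delta>\<^sup>2) ^ K0 \<le> norm (roth P M f (\<lambda>z. cnj (G z)) (\<lambda>n. chi P (\<Phi> * n)))"
      by (rule pair[OF d2 _ P f cG h 1]) (use xM[of 1] x1 in simp)
    then obtain \<Phi> where \<Phi>: "maj P x \<Phi>" "\<epsilon> \<le> norm (roth P M f (\<lambda>z. cnj (G z)) (\<lambda>n. chi P (\<Phi> * n)))"
      unfolding x1 by blast
    then obtain q :: nat where q: "1 \<le> q" "real q \<le> x" "nd (real q * (of_int \<Phi> / of_int P)) \<le> x / of_int P"
      by (auto simp: maj_def)
    \<comment> \<open>\<open>J\<close> and then \<open>I\<close> are fitted to the requirements
      \<open>6 x J \<le> \<epsilon> M\<close> of \<open>local_average_large\<close> and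
      \<open>16 I \<le> \<epsilon> J\<close> of \<open>h_average_large\<close>.\<close>
    define J where "J = \<lfloor>\<epsilon>\<^sup>2 * real_of_int M / 6\<rfloor>"
    define I where "I = \<lfloor>\<epsilon> ^ 3 * real_of_int M / 192\<rfloor>"
    have big: "1 \<le> \<epsilon> ^ n * real_of_int M / 2 ^ k" if "n + k \<le> 825" for n k
    proof -
      have "2 ^ k * x ^ n \<le> real_of_int M" using pw[of k n] xM[of "k + n"] that by linarith
      then have "\<epsilon> ^ n * (2 ^ k * x ^ n) \<le> \<epsilon> ^ n * real_of_int M" by (rule mult_left_mono) (use \<epsilon> in simp)
      moreover have "\<epsilon> ^ n * (2 ^ k * x ^ n) = 2 ^ k" by (simp add: power_mult_distrib[symmetric] \<epsilon>x(1) mult.left_commute)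
      ultimately show ?thesis by simp
    qed
    have J: "\<epsilon>\<^sup>2 * real_of_int M / 12 \<le> real_of_int J" "real_of_int J \<le> \<epsilon>\<^sup>2 * real_of_int M / 6"
    proof -
      have "1 \<le> \<epsilon>\<^sup>2 * real_of_int M / 6" using big[of 2 3] M0 \<epsilon> by simp
      from floor_ge_half[OF this] show "\<epsilon>\<^sup>2 * real_of_int M / 12 \<le> real_of_int J" by (simp add: J_def)
      show "real_of_int J \<le> \<epsilon>\<^sup>2 * real_of_int M / 6" unfolding J_def by (rule of_int_floor_le)
    qed
    have I: "\<epsilon> ^ 3 * real_of_int M / 384 \<le> real_of_int I" "real_of_int I \<le> \<epsilon> ^ 3 * real_of_int M / 192"
    proof -
      have "1 \<le> \<epsilon> ^ 3 * real_of_int M / 192" using big[of 3 8] M0 \<epsilon> by simp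
      from floor_ge_half[OF this] show "\<epsilon> ^ 3 * real_of_int M / 384 \<le> real_of_int I" by (simp add: I_def)
      show "real_of_int I \<le> \<epsilon> ^ 3 * real_of_int M / 192" unfolding I_def by (rule of_int_floor_le)
    qed
    have J1: "J \<ge> 1"
    proof -
      have "0 < \<epsilon>\<^sup>2 * real_of_int M / 12" using \<epsilon> M0 by simp
      then have "0 < real_of_int J" using J(1) by linarith
      then show ?thesis by linarith
    qed
    have I1: "I \<ge> 1"
    proof -
      have "0 < \<epsilon> ^ 3 * real_of_int M / 384" using \<epsilon> M0 by simp
      then have "0 < real_of_int I" using I(1) by linarith
      then show ?thesis by linarith
    qed
    have "6 * x * real_of_int J \<le> 6 * x * (\<epsilon>\<^sup>2 * real_of_int M / 6)" using J(2) x2 by (intro mult_left_mono) auto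
    also have "\<dots> = (\<epsilon> * x) * (\<epsilon> * real_of_int M)" by (simp add: power2_eq_square)
    finally have JM: "6 * x * real_of_int J \<le> \<epsilon> * real_of_int M" by (simp add: \<epsilon>x(1))
    have e1: "\<epsilon> \<le> 1" using \<epsilon> by simp
    from local_average_large[OF P(1) M1 J1 f(2) cG q JM e1 \<Phi>(2)]
    have "\<epsilon> / 2 \<le> avg ?X (\<lambda>z. norm (avg {1..J} (\<lambda>j. cnj (G (z + int q * j)))))" .
    then obtain s where s: "bdd1 s" "\<epsilon> / 2 \<le> norm (roth P M f (\<lambda>z. avg {1..J} (\<lambda>j. s (z - int q * j))) h)"
      using roth_local_structure[OF P0 f(1) h(1), of \<epsilon> J M q] unfolding G_def by blast
    have "real_of_int (int q) * real_of_int I \<le> x * (\<epsilon> ^ 3 * real_of_int M / 192)"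
      using q I x2 I1 by (intro mult_mono) auto
    also have "\<dots> = (\<epsilon> * x) * (\<epsilon>\<^sup>2 * real_of_int M / 192)" by (simp add: power2_eq_square power3_eq_cube)
    also have "\<dots> = \<epsilon> * (\<epsilon> * real_of_int M) / 192" by (simp add: \<epsilon>x(1) power2_eq_square)
    also have "\<dots> \<le> 1 * (\<epsilon> * real_of_int M) / 192" using e1 \<epsilon> M0 by (intro divide_right_mono mult_right_mono) auto
    finally have IM: "16 * (real_of_int (int q) * real_of_int I) \<le> \<epsilon> * real_of_int M"
      using mult_pos_pos[OF \<epsilon>(1) M0] by linarith
    have "\<epsilon> * (\<epsilon>\<^sup>2 * real_of_int M / 12) \<le> \<epsilon> * real_of_int J" using J(1) \<epsilon> by (intro mult_left_mono) auto
    then have IJ: "16 * real_of_int I \<le> \<epsilon> * real_of_int J" using I(2) by (simp add: power2_eq_square power3_eq_cube)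
    obtain y where y: "\<epsilon> / 4 \<le> avg ?X (\<lambda>x. norm (avg {1..I} (\<lambda>i. h (x + (y + int q * i)\<^sup>2))))"
      using h_average_large[OF P0 M1 I1 J1 _ f(2) s(1) h IM IJ s(2)] by auto
    define \<eta> where "\<eta> = \<epsilon> / 8"
    have \<eta>: "0 < \<eta>" "\<eta> \<le> 1 / 2" using \<epsilon> by (auto simp: \<eta>_def)
    have \<eta>x: "(1 / \<eta>) ^ 60 \<le> x ^ 240"
    proof -
      have "1 / \<eta> = 2 ^ 3 * x ^ 1" using \<epsilon> by (simp add: \<eta>_def x_def)
      also have "\<dots> \<le> x ^ 4" using pw[of 3 1] by simp
      finally have "(1 / \<eta>) ^ 60 \<le> (x ^ 4) ^ 60" by (rule power_mono) (use \<eta> in simp)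
      then show ?thesis by (simp flip: power_mult)
    qed
    have Ix: "x ^ n \<le> real_of_int I" if "n \<le> 800" for n
    proof -
      have "1 \<le> \<epsilon> ^ (3 + n) * real_of_int M / 2 ^ 9" by (rule big) (use that in simp)
      then have "x ^ n * 1 \<le> x ^ n * (\<epsilon> ^ (3 + n) * real_of_int M / 2 ^ 9)" by (rule mult_left_mono) (use x2 in simp)
      also have "\<dots> = (\<epsilon> * x) ^ n * (\<epsilon> ^ 3 * real_of_int M / 512)" by (simp add: power_add power_mult_distrib)
      also have "\<dots> \<le> \<epsilon> ^ 3 * real_of_int M / 384" using \<epsilon> M0 by (simp add: \<epsilon>x(1))
      finally show ?thesis using I(1) by linarith
    qed
    have \<eta>I: "(1 / \<eta>) ^ 60 \<le> real_of_int I" using \<eta>x Ix[of 240] by linarith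
    \<comment> \<open>The exponent is 240 from \<open>\<eta>\<close>, 25 from the constants
      \<open>2 ^ 7\<close> and \<open>2 ^ 18\<close>, and 6 because \<open>I\<^sup>2\<close> is of
      order \<open>\<epsilon> ^ 6 * M\<^sup>2\<close>.\<close>
    define R where "R = x ^ 271"
    have R1: "(1 / \<eta>) ^ 60 * (real q)\<^sup>2 \<le> R"
    proof -
      have "(1 / \<eta>) ^ 60 * (real q)\<^sup>2 \<le> x ^ 240 * x\<^sup>2" using \<eta>x q x2 by (intro mult_mono power_mono) auto
      also have "\<dots> = x ^ 242" by (simp flip: power_add)
      also have "\<dots> \<le> R" unfolding R_def by (rule power_increasing) (use x2 in auto)
      finally show ?thesis .
    qed
    have R2: "(1 / \<eta>) ^ 60 * real_of_int P \<le> R * (real_of_int I)\<^sup>2"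
    proof -
      have "real_of_int P \<le> real_of_int (128 * M\<^sup>2)" using P(2) by (simp only: of_int_le_iff)
      then have "(1 / \<eta>) ^ 60 * real_of_int P \<le> x ^ 240 * (2 ^ 7 * (real_of_int M)\<^sup>2)"
        using P0 x2 by (intro mult_mono \<eta>x) auto
      also have "\<dots> = (2 ^ 25 * x ^ 240) * (real_of_int M)\<^sup>2 / 2 ^ 18" by simp
      also have "\<dots> \<le> x ^ 265 * (real_of_int M)\<^sup>2 / 2 ^ 18"
        using pw[of 25 240] by (intro divide_right_mono mult_right_mono) auto
      also have "\<dots> = (\<epsilon> * x) ^ 6 * (x ^ 265 * (real_of_int M)\<^sup>2 / 2 ^ 18)" by (simp add: \<epsilon>x(1))
      also have "\<dots> = R * (\<epsilon> ^ 3 * real_of_int M / 512)\<^sup>2"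
      proof -
        have "x ^ 6 * x ^ 265 = R" by (simp add: R_def flip: power_add)
        moreover have "(\<epsilon> ^ 3 * real_of_int M / 512)\<^sup>2 = \<epsilon> ^ 6 * (real_of_int M)\<^sup>2 / 2 ^ 18"
          by (simp add: power_divide power_mult_distrib flip: power_mult)
        ultimately show ?thesis by (simp add: power_mult_distrib mult_ac)
      qed
      also have "\<dots> \<le> R * (real_of_int I)\<^sup>2"
      proof (intro mult_left_mono power_mono)
        have "\<epsilon> ^ 3 * real_of_int M / 512 \<le> \<epsilon> ^ 3 * real_of_int M / 384" using \<epsilon> M0 by simp
        then show "\<epsilon> ^ 3 * real_of_int M / 512 \<le> real_of_int I" using I(1) by linarith
      qed (use \<epsilon> M0 x2 in \<open>auto simp: R_def\<close>)
      finally show ?thesis .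
    qed
    have "2 * \<eta> \<le> avg ?X (\<lambda>x. norm (avg {1..I} (\<lambda>i. h (x + (y + int q * i)\<^sup>2))))" using y by (simp add: \<eta>_def)
    from fourier_of_square_average[OF P0 h \<eta> \<eta>I q(1) R1 R2 this]
    obtain \<xi> where \<xi>: "maj P R \<xi>" "\<eta>\<^sup>2 / (9 * R ^ 3) \<le> (norm (ft P h \<xi>))\<^sup>2" by blast
    have "R \<le> x ^ 825" unfolding R_def by (rule power_increasing) (use x2 in auto)
    then have "maj P ((1 / \<delta>) ^ K) \<xi>" using maj_mono[OF \<xi>(1) _ P0] by (simp only: xK)
    moreover have "\<delta> ^ K \<le> norm (ft P h \<xi>)"
    proof -
      have "norm (ft P h \<xi>) \<le> 1" unfolding ft_def by (rule bdd1_avg_norm) (use h in \<open>simp add: bdd1_def norm_mult\<close>)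
      then have "(norm (ft P h \<xi>))\<^sup>2 \<le> norm (ft P h \<xi>)" by (simp add: power2_eq_square mult_left_le_one_le)
      moreover have "1 / x ^ 825 \<le> \<eta>\<^sup>2 / (9 * R ^ 3)"
      proof -
        have "R ^ 3 = x ^ 813" by (simp add: R_def flip: power_mult)
        then have "\<eta>\<^sup>2 / (9 * R ^ 3) = 1 / (576 * x\<^sup>2 * x ^ 813)" by (simp add: \<eta>_def \<epsilon>x(2) power_divide)
        moreover have "576 * x\<^sup>2 * x ^ 813 \<le> x ^ 825"
        proof -
          have "576 * x\<^sup>2 * x ^ 813 = 576 * x ^ (2 + 813)" by (simp only: mult.assoc power_add)
          also have "\<dots> \<le> 2 ^ 10 * x ^ (2 + 813)" using x2 by (intro mult_right_mono) auto
          also have "\<dots> \<le> x ^ (10 + (2 + 813))" by (rule pw)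
          finally show ?thesis by simp
        qed
        moreover have "0 < 576 * x\<^sup>2 * x ^ 813" using x2 by simp
        ultimately show ?thesis by (simp only:) (rule divide_left_mono, auto)
      qed
      moreover have "\<delta> ^ K = 1 / x ^ 825" unfolding xK by (simp add: power_one_over)
      ultimately show ?thesis using \<xi>(2) by linarith
    qed
    ultimately show ?thesis by blast
  qed
  moreover have "K \<ge> 1" using K0 by (simp add: K_def)
  ultimately show ?thesis by blast
qed

section \<open>Transfer from sums over the integers to the cyclic group\<close>

lemma infsum_finite_support:
  fixes F :: "'a \<Rightarrow> complex"
  assumes "finite B" "B \<subseteq> A" "\<And>x. x \<in> A - B \<Longrightarrow> F x = 0"
  shows "infsum F A = sum F B"
proof -
  have "infsum F A = infsum F B" by (rule infsum_cong_neutral) (use assms in auto)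
  then show ?thesis using assms(1) by simp
qed

lemma inverse_power_le_powr:
  fixes \<delta> C :: real
  assumes "0 < \<delta>" "\<delta> \<le> 1" "real n \<le> C"
  shows "(1 / \<delta>) ^ n \<le> \<delta> powr (- C)" "\<delta> powr C \<le> \<delta> ^ n"
proof -
  have "\<delta> powr (- real n) \<le> \<delta> powr (- C)" by (rule powr_mono') (use assms in auto)
  moreover have "\<delta> powr (- real n) = (1 / \<delta>) ^ n"
    using assms by (simp add: powr_minus powr_realpow power_one_over inverse_eq_divide)
  ultimately show "(1 / \<delta>) ^ n \<le> \<delta> powr (- C)" by simp
  have "\<delta> powr C \<le> \<delta> powr real n" by (rule powr_mono') (use assms in auto)
  then show "\<delta> powr C \<le> \<delta> ^ n" using assms by (simp add: powr_realpow)
qed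

text \<open>Terms with \<open>y > M\<close> vanish because \<open>y\<^sup>2 > N\<close> leaves the
  support of \<open>h\<close>, and \<open>P = 32 * N\<close> exceeds all points that remain, so
  making the functions periodic does not change the sum. The trivial bound gives
  \<open>\<delta> \<le> 1\<close>, which is what allows exponents to be enlarged afterwards.\<close>

lemma roth_inverse:
  fixes \<delta> :: real and N K :: nat and f g h :: "int \<Rightarrow> complex"
  assumes cyclic: "\<forall>(\<delta>::real) P M f g h. 0 < \<delta> \<longrightarrow> \<delta> \<le> 1 / 2 \<longrightarrow> (1 / \<delta>) ^ K \<le> real_of_int M \<longrightarrow>
     32 * M\<^sup>2 \<le> P \<longrightarrow> P \<le> 128 * M\<^sup>2 \<longrightarrow> per P f \<longrightarrow> bdd1 f \<longrightarrow> per P g \<longrightarrow> bdd1 g \<longrightarrow> per P h \<longrightarrow> bdd1 h \<longrightarrow>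
     \<delta> \<le> norm (roth P M f g h) \<longrightarrow> (\<exists>\<xi>. maj P ((1 / \<delta>) ^ K) \<xi> \<and> \<delta> ^ K \<le> norm (ft P h \<xi>))"
    and \<delta>: "\<delta> > 0" and N: "N > 0"
    and f: "\<And>x. norm (f x) \<le> 1" and g: "\<And>x. norm (g x) \<le> 1" and h: "\<And>x. norm (h x) \<le> 1"
    and fs: "{x. f x \<noteq> 0} \<subseteq> {1..int N}" and hs: "{x. h x \<noteq> 0} \<subseteq> {1..int N}"
    and large: "norm (\<Sum>\<^sub>\<infinity>x::int. \<Sum>\<^sub>\<infinity>y::nat\<in>{1..}. f x * g (x + int y) * h (x + int (y ^ 2))) \<ge> \<delta> * real N powr (3 / 2)"
  shows "\<delta> \<le> 1 \<and> (real N \<le> 4 * 64 ^ (2 * K) * (1 / \<delta>) ^ (2 * K) \<or>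
      (\<exists>(\<alpha>::real) (q::nat). q > 0 \<and> real q \<le> 64 ^ K * (1 / \<delta>) ^ K \<and>
        nd (real q * \<alpha>) \<le> 64 ^ K * (1 / \<delta>) ^ K / real N \<and>
        norm (\<Sum>\<^sub>\<infinity>x::int. h x * e (\<alpha> * of_int x)) \<ge> \<delta> ^ K / 64 ^ K * real N))"
proof -
  define P where "P = 32 * int N"
  define M where "M = \<lfloor>sqrt (real N)\<rfloor>"
  have sN: "1 \<le> sqrt (real N)" using N by simp
  have M1: "M \<ge> 1" unfolding M_def using sN by (simp add: le_floor_iff)
  have Ms: "real_of_int M \<le> sqrt (real N)" unfolding M_def by (rule of_int_floor_le)
  have sM: "sqrt (real N) \<le> 2 * real_of_int M"
  proof -
    have "sqrt (real N) < real_of_int M + 1" unfolding M_def by linarith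
    then show ?thesis using M1 by linarith
  qed
  have "(real_of_int M)\<^sup>2 \<le> (sqrt (real N))\<^sup>2" by (rule power_mono[OF Ms]) (use M1 in simp)
  then have "real_of_int (M\<^sup>2) \<le> real_of_int (int N)" by simp
  then have MN: "M\<^sup>2 \<le> int N" by (simp only: of_int_le_iff)
  have NM': "real N \<le> 4 * (real_of_int M)\<^sup>2"
  proof -
    have "(sqrt (real N))\<^sup>2 \<le> (2 * real_of_int M)\<^sup>2" by (rule power_mono[OF sM]) simp
    then show ?thesis by (simp add: power_mult_distrib)
  qed
  then have "real_of_int (int N) \<le> real_of_int (4 * M\<^sup>2)" by simp
  then have NM: "int N \<le> 4 * M\<^sup>2" by (simp only: of_int_le_iff)
  have P: "32 * M\<^sup>2 \<le> P" "P \<le> 128 * M\<^sup>2" using MN NM by (simp_all add: P_def)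
  have P0: "P > 0" using N by (simp add: P_def)
  have lt: "M < y \<Longrightarrow> int N < y\<^sup>2" for y
  proof -
    assume "M < y"
    then have "sqrt (real N) < real_of_int y" unfolding M_def by linarith
    then have "(sqrt (real N))\<^sup>2 < (real_of_int y)\<^sup>2" by (rule power_strict_mono) auto
    then have "real_of_int (int N) < real_of_int (y\<^sup>2)" by simp
    then show "int N < y\<^sup>2" by (simp only: of_int_less_iff)
  qed
  have MleN: "M \<le> int N"
  proof -
    have "M * 1 \<le> M * M" using M1 by (intro mult_left_mono) auto
    then show ?thesis using MN by (simp add: power2_eq_square)
  qed
  have f0: "f x = 0" if "x \<notin> {1..int N}" for x using fs that by auto
  have h0: "h x = 0" if "x \<notin> {1..int N}" for x using hs that by auto
  define S where "S = (\<Sum>x\<in>{1..int N}. \<Sum>y\<in>{1..M}. f x * g (x + y) * h (x + y\<^sup>2))"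
  have "(\<Sum>\<^sub>\<infinity>x::int. \<Sum>\<^sub>\<infinity>y::nat\<in>{1..}. f x * g (x + int y) * h (x + int (y ^ 2)))
     = (\<Sum>x\<in>{1..int N}. \<Sum>\<^sub>\<infinity>y::nat\<in>{1..}. f x * g (x + int y) * h (x + int (y ^ 2)))"
    by (rule infsum_finite_support) (auto simp: f0)
  also have "\<dots> = S" unfolding S_def
  proof (rule sum.cong[OF refl])
    fix x assume x: "x \<in> {1..int N}"
    have "(\<Sum>\<^sub>\<infinity>y::nat\<in>{1..}. f x * g (x + int y) * h (x + int (y ^ 2)))
       = (\<Sum>y\<in>{1..nat M}. f x * g (x + int y) * h (x + int (y ^ 2)))"
    proof (rule infsum_finite_support)
      fix y :: nat assume "y \<in> {1..} - {1..nat M}"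
      then have "M < int y" by auto
      from lt[OF this] have "int N < int (y ^ 2)" by (simp only: of_nat_power)
      moreover have "1 \<le> x" using x by simp
      ultimately have "\<not> x + int (y ^ 2) \<le> int N" by linarith
      then have "x + int (y ^ 2) \<notin> {1..int N}" by (simp only: atLeastAtMost_iff) blast
      then have "h (x + int (y ^ 2)) = 0" by (rule h0)
      then show "f x * g (x + int y) * h (x + int (y ^ 2)) = 0" by (simp only: mult_zero_right)
    qed auto
    also have "\<dots> = (\<Sum>y\<in>{1..M}. f x * g (x + y) * h (x + y\<^sup>2))"
      by (rule sum.reindex_bij_witness[of _ nat int]) auto
    finally show "(\<Sum>\<^sub>\<infinity>y::nat\<in>{1..}. f x * g (x + int y) * h (x + int (y ^ 2)))
       = (\<Sum>y\<in>{1..M}. f x * g (x + y) * h (x + y\<^sup>2))" .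
  qed
  finally have largeS: "\<delta> * real N powr (3 / 2) \<le> norm S" using large by simp
  have N32: "real N powr (3 / 2) = real N * sqrt (real N)"
  proof -
    have "real N powr (3 / 2) = real N powr (1 + 1 / 2)" by simp
    also have "\<dots> = real N powr 1 * real N powr (1 / 2)" by (rule powr_add)
    finally show ?thesis using N by (simp add: powr_half_sqrt)
  qed
  have NS: "0 < real N * sqrt (real N)" using N by simp
  have "norm S \<le> (\<Sum>x\<in>{1..int N}. \<Sum>y\<in>{1..M}. 1)"
    unfolding S_def
    by (intro order_trans[OF norm_sum] sum_mono) (auto simp: norm_mult intro!: mult_le_one f g h)
  also have "\<dots> = real N * real_of_int M" using M1 by simp
  also have "\<dots> \<le> real N * sqrt (real N)" by (intro mult_left_mono Ms) simp
  finally have "\<delta> * (real N * sqrt (real N)) \<le> 1 * (real N * sqrt (real N))" using largeS N32 by simp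
  then have \<delta>1: "\<delta> \<le> 1" using NS by (simp only: mult_le_cancel_right)
  define f' where "f' = (\<lambda>x. f (x mod P))"
  define g' where "g' = (\<lambda>x. g (x mod P))"
  define h' where "h' = (\<lambda>x. h (x mod P))"
  have per: "per P f'" "per P g'" "per P h'" unfolding f'_def g'_def h'_def by (rule per_of_mod)+
  have bdd: "bdd1 f'" "bdd1 g'" "bdd1 h'" by (simp_all add: bdd1_def f'_def g'_def h'_def f g h)
  have rothS: "roth P M f' g' h' = S / (of_int P * of_int M)"
  proof -
    have "(\<Sum>x\<in>{0..<P}. \<Sum>y\<in>{1..M}. f' x * g' (x + y) * h' (x + y\<^sup>2)) = S"
      unfolding S_def
    proof (rule sum.mono_neutral_cong_right)
      show "{1..int N} \<subseteq> {0..<P}" using N by (auto simp: P_def)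
      show "\<forall>x\<in>{0..<P} - {1..int N}. (\<Sum>y\<in>{1..M}. f' x * g' (x + y) * h' (x + y\<^sup>2)) = 0"
        by (auto simp: f'_def f0 intro!: sum.neutral)
      fix x assume x: "x \<in> {1..int N}"
      show "(\<Sum>y\<in>{1..M}. f' x * g' (x + y) * h' (x + y\<^sup>2)) = (\<Sum>y\<in>{1..M}. f x * g (x + y) * h (x + y\<^sup>2))"
      proof (rule sum.cong[OF refl])
        fix y assume y: "y \<in> {1..M}"
        have y2: "y\<^sup>2 \<le> int N" by (rule order_trans[OF power_mono MN]) (use y in auto)
        have "x + y < P" "x + y\<^sup>2 < P" "x < P" using x y y2 MN MleN N by (auto simp: P_def)
        then show "f' x * g' (x + y) * h' (x + y\<^sup>2) = f x * g (x + y) * h (x + y\<^sup>2)"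
          using x y by (simp add: f'_def g'_def h'_def)
      qed
    qed simp
    moreover have "roth P M f' g' h' = (\<Sum>x\<in>{0..<P}. \<Sum>y\<in>{1..M}. f' x * g' (x + y) * h' (x + y\<^sup>2)) / (of_int P * of_int M)"
      using P0 M1 by (simp add: roth_def avg_def sum_divide_distrib[symmetric])
    ultimately show ?thesis by simp
  qed
  \<comment> \<open>The normalisation is by \<open>P * M\<close>, where \<open>P / N = 32\<close>
    and \<open>M \<le> sqrt N\<close>; a factor 2 is to spare.\<close>
  define \<delta>0 where "\<delta>0 = \<delta> / 64"
  have \<delta>0: "0 < \<delta>0" "\<delta>0 \<le> 1 / 2" using \<delta> \<delta>1 by (auto simp: \<delta>0_def)
  have "\<delta>0 \<le> norm (roth P M f' g' h')"
  proof -
    have PM: "0 < real_of_int P * real_of_int M" using P0 M1 by simp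
    have "\<delta>0 * (real_of_int P * real_of_int M) = \<delta> / 2 * (real N * real_of_int M)" by (simp add: \<delta>0_def P_def)
    also have "\<dots> \<le> \<delta> / 2 * (real N * sqrt (real N))"
      using \<delta> by (intro mult_left_mono Ms) auto
    also have "\<dots> \<le> \<delta> * (real N * sqrt (real N))" using \<delta> NS by simp
    also have "\<dots> \<le> norm S" using largeS N32 by simp
    finally have "\<delta>0 \<le> norm S / (real_of_int P * real_of_int M)" using PM by (simp only: pos_le_divide_eq)
    then show ?thesis using P0 M1 by (simp add: rothS norm_divide norm_mult)
  qed
  note cyc = cyclic[rule_format, OF \<delta>0 _ P per(1) bdd(1) per(2) bdd(2) per(3) bdd(3) this]
  have p64: "(1 / \<delta>0) ^ n = 64 ^ n * (1 / \<delta>) ^ n" for n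
    by (simp add: \<delta>0_def power_divide)
  show ?thesis
  proof (cases "(1 / \<delta>0) ^ K \<le> real_of_int M")
    \<comment> \<open>\<open>M\<close> is below the power of \<open>1 / \<delta>0\<close>; since
      \<open>N \<le> 4 * M\<^sup>2\<close>, this is the alternative that bounds
      \<open>N\<close>.\<close>
    case False
    then have "(real_of_int M)\<^sup>2 \<le> ((1 / \<delta>0) ^ K)\<^sup>2" using M1 by (intro power_mono) auto
    also have "\<dots> = (1 / \<delta>0) ^ (2 * K)" by (simp only: power_mult[symmetric] mult.commute)
    finally have "real N \<le> 4 * (1 / \<delta>0) ^ (2 * K)" using NM' by linarith
    then show ?thesis using \<delta>1 by (simp only: p64) simp
  next
    case True
    from cyc[OF this] obtain \<xi> where \<xi>: "maj P ((1 / \<delta>0) ^ K) \<xi>" "\<delta>0 ^ K \<le> norm (ft P h' \<xi>)" by blast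
    then obtain q :: nat where q: "1 \<le> q" "real q \<le> (1 / \<delta>0) ^ K" "nd (real q * (of_int \<xi> / of_int P)) \<le> (1 / \<delta>0) ^ K / of_int P"
      by (auto simp: maj_def)
    define \<alpha> where "\<alpha> = real_of_int \<xi> / real_of_int P"
    have "(\<Sum>\<^sub>\<infinity>x::int. h x * e (\<alpha> * of_int x)) = (\<Sum>x\<in>{0..<P}. h x * e (\<alpha> * of_int x))"
      by (rule infsum_finite_support) (auto simp: P_def intro!: h0)
    also have "\<dots> = (\<Sum>x\<in>{0..<P}. h' x * chi P (\<xi> * x))"
      by (rule sum.cong) (auto simp: h'_def chi_def \<alpha>_def)
    also have "\<dots> = of_int P * ft P h' \<xi>" using P0 by (simp add: ft_def avg_def)
    finally have "norm (\<Sum>\<^sub>\<infinity>x::int. h x * e (\<alpha> * of_int x)) = real_of_int P * norm (ft P h' \<xi>)"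
      using P0 by (simp add: norm_mult)
    also have "\<dots> \<ge> real N * \<delta>0 ^ K" using \<xi>(2) \<delta>0 by (intro mult_mono) (auto simp: P_def)
    finally have "norm (\<Sum>\<^sub>\<infinity>x::int. h x * e (\<alpha> * of_int x)) \<ge> \<delta> ^ K / 64 ^ K * real N"
      by (simp add: \<delta>0_def power_divide mult.commute)
    moreover have "nd (real q * \<alpha>) \<le> 64 ^ K * (1 / \<delta>) ^ K / real N"
    proof -
      have "nd (real q * \<alpha>) \<le> (1 / \<delta>0) ^ K / of_int P" using q(3) by (simp add: \<alpha>_def)
      also have "\<dots> \<le> (1 / \<delta>0) ^ K / real N" using N \<delta>0 by (intro divide_left_mono) (auto simp: P_def)
      finally show ?thesis by (simp only: p64)
    qed
    moreover have "real q \<le> 64 ^ K * (1 / \<delta>) ^ K" using q(2) by (simp only: p64)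
    ultimately show ?thesis using q(1) \<delta>1 by (intro conjI disjI2 exI[of _ \<alpha>] exI[of _ q]) auto
  qed
qed

theorem theorem1p2:
  shows "\<exists>C::real. C \<ge> 1 \<and>
    (\<forall>(\<delta>::real) (N::nat) (f::int \<Rightarrow> complex) (g::int \<Rightarrow> complex) (h::int \<Rightarrow> complex).
      \<delta> > 0 \<longrightarrow> N > 0 \<longrightarrow>
      (\<forall>x. norm (f x) \<le> 1) \<longrightarrow> (\<forall>x. norm (g x) \<le> 1) \<longrightarrow> (\<forall>x. norm (h x) \<le> 1) \<longrightarrow>
      {x. f x \<noteq> 0} \<subseteq> {1..int N} \<longrightarrow>
      {x. g x \<noteq> 0} \<subseteq> {1..int N} \<longrightarrow>
      {x. h x \<noteq> 0} \<subseteq> {1..int N} \<longrightarrow>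
      norm (\<Sum>\<^sub>\<infinity>x::int. \<Sum>\<^sub>\<infinity>y::nat\<in>{1..}. f x * g (x + int y) * h (x + int (y ^ 2)))
        \<ge> \<delta> * real N powr (3 / 2) \<longrightarrow>
      real N \<le> C * \<delta> powr (- C) \<or>
      (\<exists>(\<alpha>::real) (q::nat). q > 0 \<and> real q \<le> C * \<delta> powr (- C) \<and>
        nearest_int_dist (real q * \<alpha>) \<le> C * \<delta> powr (- C) / real N \<and>
        norm (\<Sum>\<^sub>\<infinity>x::int. h x * e (\<alpha> * of_int x)) \<ge> inverse C * \<delta> powr C * real N))"
proof -
  obtain K :: nat where cyclic: "\<forall>(\<delta>::real) P M f g h. 0 < \<delta> \<longrightarrow> \<delta> \<le> 1 / 2 \<longrightarrow> (1 / \<delta>) ^ K \<le> real_of_int M \<longrightarrow>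
     32 * M\<^sup>2 \<le> P \<longrightarrow> P \<le> 128 * M\<^sup>2 \<longrightarrow> per P f \<longrightarrow> bdd1 f \<longrightarrow> per P g \<longrightarrow> bdd1 g \<longrightarrow> per P h \<longrightarrow> bdd1 h \<longrightarrow>
     \<delta> \<le> norm (roth P M f g h) \<longrightarrow> (\<exists>\<xi>. maj P ((1 / \<delta>) ^ K) \<xi> \<and> \<delta> ^ K \<le> norm (ft P h \<xi>))"
    using roth_inverse_cyclic by blast
  \<comment> \<open>At least as large as the factors \<open>4 * 64 ^ (2 * K)\<close> and
    \<open>64 ^ K\<close> and the exponents \<open>K\<close> and \<open>2 * K\<close>, so that one
    constant serves in every place.\<close>
  define C :: real where "C = 4 * 64 ^ (2 * K)"
  have C1: "1 \<le> (64::real) ^ (2 * K)" by (rule one_le_power) simp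
  have CK: "(64::real) ^ K \<le> C"
  proof -
    have "(64::real) ^ K \<le> 64 ^ (2 * K)" by (rule power_increasing) auto
    then show ?thesis using C1 unfolding C_def by linarith
  qed
  have C2K: "real (2 * K) \<le> C"
  proof -
    have "real (2 * K) \<le> 2 ^ (2 * K)" using of_nat_less_two_power[of "2 * K", where 'a = real] by linarith
    also have "\<dots> \<le> (64::real) ^ (2 * K)" by (rule power_mono) auto
    finally show ?thesis using C1 unfolding C_def by linarith
  qed
  then have CK': "real K \<le> C" by simp
  have Cpos: "C > 0" using C1 unfolding C_def by linarith
  show ?thesis
  proof (intro exI[of _ C] conjI allI impI)
    show "C \<ge> 1" using C1 unfolding C_def by linarith
    fix \<delta> :: real and N :: nat and f g h :: "int \<Rightarrow> complex"
    assume \<delta>: "\<delta> > 0" and N: "N > 0" and f: "\<forall>x. norm (f x) \<le> 1" and g: "\<forall>x. norm (g x) \<le> 1" and h: "\<forall>x. norm (h x) \<le> 1"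
      and fs: "{x. f x \<noteq> 0} \<subseteq> {1..int N}" and hs: "{x. h x \<noteq> 0} \<subseteq> {1..int N}"
      and large: "norm (\<Sum>\<^sub>\<infinity>x::int. \<Sum>\<^sub>\<infinity>y::nat\<in>{1..}. f x * g (x + int y) * h (x + int (y ^ 2))) \<ge> \<delta> * real N powr (3 / 2)"
    note main = roth_inverse[OF cyclic \<delta> N f[rule_format] g[rule_format] h[rule_format] fs hs large]
    then have \<delta>1: "\<delta> \<le> 1" by blast
    have pK: "64 ^ K * (1 / \<delta>) ^ K \<le> C * \<delta> powr (- C)"
      using \<delta> by (intro mult_mono CK inverse_power_le_powr(1) \<delta>1 CK') (auto simp: C_def)
    from main consider "real N \<le> 4 * 64 ^ (2 * K) * (1 / \<delta>) ^ (2 * K)"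
      | \<alpha> :: real and q :: nat where "q > 0" "real q \<le> 64 ^ K * (1 / \<delta>) ^ K" "nd (real q * \<alpha>) \<le> 64 ^ K * (1 / \<delta>) ^ K / real N"
        "norm (\<Sum>\<^sub>\<infinity>x::int. h x * e (\<alpha> * of_int x)) \<ge> \<delta> ^ K / 64 ^ K * real N" by blast
    then show "real N \<le> C * \<delta> powr (- C) \<or>
      (\<exists>(\<alpha>::real) (q::nat). q > 0 \<and> real q \<le> C * \<delta> powr (- C) \<and>
        nearest_int_dist (real q * \<alpha>) \<le> C * \<delta> powr (- C) / real N \<and>
        norm (\<Sum>\<^sub>\<infinity>x::int. h x * e (\<alpha> * of_int x)) \<ge> inverse C * \<delta> powr C * real N)"
    proof cases
      case 1
      also have "4 * 64 ^ (2 * K) * (1 / \<delta>) ^ (2 * K) \<le> C * \<delta> powr (- C)"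
        unfolding C_def[symmetric] by (intro mult_left_mono inverse_power_le_powr(1) \<delta> \<delta>1 C2K) (use Cpos in simp)
      finally show ?thesis ..
    next
      case 2
      have "64 ^ K * (1 / \<delta>) ^ K / real N \<le> C * \<delta> powr (- C) / real N" by (rule divide_right_mono[OF pK]) simp
      moreover have "inverse C * \<delta> powr C * real N \<le> \<delta> ^ K / 64 ^ K * real N"
      proof (rule mult_right_mono)
        have "inverse C \<le> inverse (64 ^ K)" by (rule le_imp_inverse_le[OF CK]) simp
        then have "inverse C * \<delta> powr C \<le> inverse (64 ^ K) * \<delta> ^ K"
          using \<delta> Cpos by (intro mult_mono inverse_power_le_powr(2) \<delta>1 CK') auto
        then show "inverse C * \<delta> powr C \<le> \<delta> ^ K / 64 ^ K" by (simp add: divide_inverse mult.commute)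
      qed simp
      ultimately show ?thesis using 2 pK by (intro disjI2 exI[of _ \<alpha>] exI[of _ q] conjI) linarith+
    qed
  qed
qed

end
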